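(* Let $K$ be a field of characteristic zero, $n\ge 3$, and let $\Omega_{\mathrm{sreg}}$ be a subregular coadjoint orbit of $\mathrm{UT}(n,K)$ in $\mathfrak{ut}(n,K)^*$. Let $I(\Omega_{\mathrm{sreg}})$ be the ideal of elements of $S(\mathfrak{ut}(n,K))=K[\mathfrak{ut}(n,K)^*]$ vanishing on $\Omega_{\mathrm{sreg}}$. (The restrictions of the $P_j$, $1\le j\le n_0$, to any orbit are constant.) 1) If $P_{n_\otimes}(\Omega_{\mathrm{sreg}})\ne 0$, then there are a number $1\leq j_0 < n_\otimes$ and numbers $\{c_1,\ldots, c_{j_0-1},c',c'',c_{j_0+2},\ldots, c_{n_0-1}\}\subset K^*$, $\{c_{n_0}, c\}\subset K$ (with $c_{n_0}\neq 0$ for odd $n$) such that $I(\Omega_{\mathrm{sreg}})$ is generated by the elements $$P_i -c_i,\ \ i=1,\ldots, j_0-1, j_0+2,\ldots, n_0,\qquad P_{j_0}'-c',\quad P_{j_0}''-c'',\quad P_{j_0},\quad Z_{j_0}-c.$$ 2) If $P_{n_{\otimes}}(\Omega_{\mathrm{sreg}}) = 0$ and $n$ is odd, then there are numbers $\{c_1,\ldots,c_{n_\otimes-1}\}\subset K^*$, $\{c',c''\}\subset K$ such that $I(\Omega_{\mathrm{sreg}})$ is generated by the elements $$P_i-c_i,\ \ i=1,\ldots,n_{\otimes}-1,\qquad P_{n_{\otimes}}'-c',\quad P_{n_{\otimes}}''-c'',\quad P_{n_{\otimes}}.$$ 3) If $P_{n_{\otimes}}(\Omega_{\mathrm{sreg}})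 = 0$ and $n$ is even, then there are numbers $\{c_1,\ldots,c_{n_{\otimes}-1},c'\}\subset K^*$, $\{c'',c\}\subset K$ such that $I(\Omega_{\mathrm{sreg}})$ is generated by the elements $P_i-c_i$, $i=1,\ldots,n_{\otimes}-1$, together with the elements of the form a) or of the form b): a) $P_{n_{\otimes}}'-c',\ P_{n_{\otimes}}''-c'',\ P_{n_{\otimes}},\ Z_{n_{\otimes}}-c$; b) $P_{n_{\otimes}},\ P_{n_{\otimes}}',\ P_{n_0}'-c'',\ P_{n_{\otimes}}''-c'$.
   Context: $\mathrm{UT}(n,K)$ is the group of lower triangular $n\times n$ matrices with $1$'s on the diagonal, $\mathfrak g=\mathfrak{ut}(n,K)$ its Lie algebra of strictly lower triangular matrices with basis the matrix units $y_{ij}$, $i>j$. A regular orbit is a coadjoint orbit of maximal dimension; a subregular orbit is a coadjoint orbit of dimension $\dim\Omega_{\mathrm{reg}}-2$, where $\Omega_{\mathrm{reg}}$ is a regular orbit. Put $n_0=\left[\frac n2\right]$, $n_\otimes=\left[\frac{n-1}2\right]$. $\Phi$ is the formal $n\times n$ matrix with entry $y_{ij}$ at $(i,j)$ for $i>j$ and $0$ elsewhere; $\Phi(\tau)=\tau\Phi+E$ is the characteristic matrix ($E$ the identity). $M^{J}_{I}$ (resp. $M^J_I(\tau)$) denotes the minor of $\Phi$ (resp. of $\Phi(\tau)$) with columns $J$ (top indices) and rows $I$ (bottom indices). $P_j=M^{1,\dots,j}_{n-j+1,\dots,n}$ for $1\le j\le n_0$. For $1\le j\le n_\otimes$: $P_j'=M^{1,\dots,j}_{n-j,\,n-j+2,\dots,n}$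 and $P_j''=M^{1,\dots,j-1,j+1}_{n-j+1,\dots,n}$. For even $n$: $P_{n_0}'=M^{1,2,\dots,n_0-1}_{n_0,\,n_0+3,\,n_0+4,\dots,n}$. For $1\le j\le n-1$ let $P_j(\tau)=M^{1,\dots,j}_{n-j+1,\dots,n}(\tau)$; for $n_0<j\le n-1$, $Z_{n-j}$ is the coefficient of $\tau^{n-j+1}$ in $P_j(\tau)$ (this defines $Z_1,\dots,Z_{n_\otimes}$). *)

theory Defs
  imports
    "Jordan_Normal_Form.Determinant"
    "Jordan_Normal_Form.DL_Submatrix"
    "HOL-Algebra.Group_Action"
    "HOL-Algebra.Ideal"
    "HOL-Library.Poly_Mapping"
    "HOL-Library.Extended_Nat"
begin

hide_const (open) Polynomial.order

section \<open>The coadjoint action\<close>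

text \<open>Matrices are indexed from 0 in the library, while the indices \<open>i, j\<close> below run
  from 1 to \<open>n\<close>.\<close>

definition UT :: "nat \<Rightarrow> 'a::field mat monoid" where
  "UT n = \<lparr>carrier = {A \<in> carrier_mat n n.
             (\<forall>i<n. A $$ (i,i) = 1) \<and> (\<forall>i<n. \<forall>j<n. i < j \<longrightarrow> A $$ (i,j) = 0)},
           mult = (*), one = 1\<^sub>m n\<rparr>"

definition ut :: "nat \<Rightarrow> 'a::field mat set" where
  "ut n = {A \<in> carrier_mat n n. \<forall>i<n. \<forall>j<n. i \<le> j \<longrightarrow> A $$ (i,j) = 0}"

lemma group_UT: "group (UT n :: 'a::field mat monoid)"
proof (rule groupI)
  fix x y :: "'a mat" assume x: "x \<in> carrier (UT n)" and y: "y \<in> carrier (UT n)"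
  have xy: "x \<in> carrier_mat n n" "y \<in> carrier_mat n n" using x y by (auto simp: UT_def)
  have [simp]: "dim_row x = n" "dim_col x = n" "dim_row y = n" "dim_col y = n"
    using xy by (simp_all only: carrier_matD)
  have e: "(x * y) $$ (i,j) = (\<Sum>k<n. x $$ (i,k) * y $$ (k,j))" if "i < n" "j < n" for i j
    using that by (simp add: scalar_prod_def atLeast0LessThan)
  have "(x * y) $$ (i,i) = 1" if i: "i < n" for i
  proof -
    have "(\<Sum>k<n. x $$ (i,k) * y $$ (k,i)) = (\<Sum>k<n. if k = i then 1 else 0)"
    proof (intro sum.cong refl)
      fix k assume "k \<in> {..<n}"
      then show "x $$ (i,k) * y $$ (k,i) = (if k = i then 1 else 0)"
        using x y i by (cases k i rule: linorder_cases) (auto simp: UT_def)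
    qed
    then show ?thesis using e i by simp
  qed
  moreover have "(x * y) $$ (i,j) = 0" if "i < n" "j < n" "i < j" for i j
  proof -
    have "x $$ (i,k) * y $$ (k,j) = 0" if "k < n" for k
      using x y \<open>i < n\<close> \<open>j < n\<close> \<open>i < j\<close> that by (cases "k \<le> i") (auto simp: UT_def)
    then show ?thesis using e[OF that(1,2)] by (simp add: sum.neutral del: index_mult_mat)
  qed
  ultimately show "x \<otimes>\<^bsub>UT n\<^esub> y \<in> carrier (UT n)" by (auto simp: UT_def)
next
  fix x :: "'a mat" assume x: "x \<in> carrier (UT n)"
  have xc: "x \<in> carrier_mat n n" using x by (auto simp: UT_def)
  have "det x = prod_list (diag_mat x)"
    by (rule det_lower_triangular[of n]) (use x in \<open>auto simp: UT_def\<close>)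
  also have "diag_mat x = replicate n 1"
    by (rule nth_equalityI) (use x carrier_matD[OF xc] in \<open>auto simp: UT_def diag_mat_def\<close>)
  finally have "det x \<noteq> 0" by (simp add: prod_list_replicate)
  then have "x \<in> Units (ring_mat TYPE('a) n undefined)" by (rule det_non_zero_imp_unit[OF xc])
  then obtain b where b: "b \<in> carrier_mat n n" "b * x = 1\<^sub>m n" "x * b = 1\<^sub>m n"
    by (auto simp: Units_def ring_mat_def)
  have [simp]: "dim_row x = n" "dim_col x = n" "dim_row b = n" "dim_col b = n" using carrier_matD[OF xc] carrier_matD[OF b(1)] by auto
  have e: "(x * b) $$ (i,j) = (\<Sum>k<n. x $$ (i,k) * b $$ (k,j))" if "i < n" "j < n" for i j
    using that by (simp add: scalar_prod_def atLeast0LessThan)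
  have low: "b $$ (i,j) = (if i = j then 1 else 0)" if "i < n" "j < n" "i \<le> j" for i j
    using that
  proof (induction i rule: less_induct)
    case (less i)
    have "(\<Sum>k<n. x $$ (i,k) * b $$ (k,j)) = (\<Sum>k<n. if k = i then b $$ (i,j) else 0)"
    proof (intro sum.cong refl)
      fix k assume "k \<in> {..<n}"
      then show "x $$ (i,k) * b $$ (k,j) = (if k = i then b $$ (i,j) else 0)"
        using x less by (cases k i rule: linorder_cases) (auto simp: UT_def)
    qed
    then have "(x * b) $$ (i,j) = b $$ (i,j)" using e less.prems by simp
    then show ?case using b(3) less.prems by simp
  qed
  show "\<exists>y\<in>carrier (UT n). y \<otimes>\<^bsub>UT n\<^esub> x = \<one>\<^bsub>UT n\<^esub>"
    by (rule bexI[of _ b]) (use b low in \<open>auto simp: UT_def\<close>)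
qed (auto simp: UT_def)


lemma UT_conj:
  assumes g: "g \<in> carrier (UT n)" and h: "h \<in> carrier (UT n)" and x: "(x::'a::field mat) \<in> ut n"
  shows "h * x * g \<in> ut n"
proof -
  have xc: "x \<in> carrier_mat n n" and gc: "g \<in> carrier_mat n n" and hc: "h \<in> carrier_mat n n"
    using assms by (auto simp: ut_def UT_def)
  have hxc: "h * x \<in> carrier_mat n n" using hc xc by simp
  have m: "(A * B) $$ (i,j) = (\<Sum>k<n. A $$ (i,k) * B $$ (k,j))"
    if "A \<in> carrier_mat n n" "B \<in> carrier_mat n n" "i<n" "j<n" for A B :: "'a mat" and i j
    using that(3,4) carrier_matD[OF that(1)] carrier_matD[OF that(2)]
    by (simp add: scalar_prod_def atLeast0LessThan)
  have 1: "(h * x) $$ (i,j) = 0" if "i<n" "j<n" "i\<le>j" for i j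
  proof -
    have "h $$ (i,k) * x $$ (k,j) = 0" if "k<n" for k
      using that \<open>i<n\<close> \<open>j<n\<close> \<open>i\<le>j\<close> h x by (cases "k \<le> i") (auto simp: UT_def ut_def)
    then show ?thesis using m[OF hc xc that(1,2)] by (simp add: sum.neutral del: index_mult_mat)
  qed
  have "(h * x * g) $$ (i,j) = 0" if "i<n" "j<n" "i\<le>j" for i j
  proof -
    have "(h * x) $$ (i,k) * g $$ (k,j) = 0" if "k<n" for k
    proof (cases "i \<le> k")
      case True then show ?thesis using 1[of i k] that \<open>i<n\<close> by (simp del: index_mult_mat)
    next
      case False
      then have "g $$ (k,j) = 0" using g that \<open>i\<le>j\<close> \<open>j<n\<close> by (simp add: UT_def)
      then show ?thesis by (simp del: index_mult_mat)
    qed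
    then show ?thesis using m[OF hxc gc that(1,2)] by (simp add: sum.neutral del: index_mult_mat)
  qed
  then show ?thesis using mult_carrier_mat[OF hxc gc] by (simp add: ut_def del: index_mult_mat)
qed

definition y_unit :: "nat \<Rightarrow> nat \<Rightarrow> nat \<Rightarrow> 'a::field mat" where
  "y_unit n i j = mat n n (\<lambda>(r,c). if (Suc r, Suc c) = (i,j) then 1 else 0)"

definition ut_dual :: "nat \<Rightarrow> ('a::field mat \<Rightarrow> 'a) set" where
  "ut_dual n = {f \<in> extensional (ut n).
     (\<forall>x\<in>ut n. \<forall>z\<in>ut n. f (x + z) = f x + f z) \<and>
     (\<forall>a. \<forall>x\<in>ut n. f (a \<cdot>\<^sub>m x) = a * f x)}"

definition coadj :: "nat \<Rightarrow> 'a::field mat \<Rightarrow> ('a mat \<Rightarrow> 'a) \<Rightarrow> ('a mat \<Rightarrow> 'a)" where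
  "coadj n g = (\<lambda>f\<in>ut_dual n. \<lambda>x\<in>ut n. f (inv\<^bsub>UT n\<^esub> g * x * g))"

definition coadjoint_orbits :: "nat \<Rightarrow> ('a::field mat \<Rightarrow> 'a) set set" where
  "coadjoint_orbits n = orbits (UT n) (ut_dual n) (coadj n)"


section \<open>The symmetric algebra as a polynomial ring\<close>

text \<open>Polynomials over \<open>'a\<close> in variables from \<open>'v\<close>: a monomial is a finitely supported
  exponent function \<open>'v \<Rightarrow>\<^sub>0 nat\<close>.\<close>

type_synonym ('v, 'a) mpol = "('v \<Rightarrow>\<^sub>0 nat) \<Rightarrow>\<^sub>0 'a"

definition mpol_vars :: "('v, 'a::zero) mpol \<Rightarrow> 'v set" where
  "mpol_vars p = (\<Union>m\<in>Poly_Mapping.keys p. Poly_Mapping.keys m)"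

definition mpol_eval :: "('v \<Rightarrow> 'a) \<Rightarrow> ('v, 'a::comm_semiring_1) mpol \<Rightarrow> 'a" where
  "mpol_eval a p = (\<Sum>m\<in>Poly_Mapping.keys p. Poly_Mapping.lookup p m *
     (\<Prod>v\<in>Poly_Mapping.keys m. a v ^ Poly_Mapping.lookup m v))"

definition mpol_const :: "'a::zero \<Rightarrow> ('v, 'a) mpol" where
  "mpol_const c = Poly_Mapping.single 0 c"

definition mpol_var :: "'v \<Rightarrow> ('v, 'a::zero_neq_one) mpol" where
  "mpol_var v = Poly_Mapping.single (Poly_Mapping.single v 1) 1"

text \<open>The symmetric algebra of \<open>ut n\<close>: polynomials in the basis elements \<open>y\<^sub>i\<^sub>j\<close>, the variable
  \<open>y\<^sub>i\<^sub>j\<close> being named by the pair \<open>(i,j)\<close>.\<close>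

definition Sym :: "nat \<Rightarrow> (nat \<times> nat, 'a::field) mpol ring" where
  "Sym n = \<lparr>carrier = {p. mpol_vars p \<subseteq> {(i,j). 1 \<le> j \<and> j < i \<and> i \<le> n}},
            mult = (*), one = 1, zero = 0, add = (+)\<rparr>"

lemma mpol_vars_add: "mpol_vars (p + q :: ('v,'a::comm_ring_1) mpol) \<subseteq> mpol_vars p \<union> mpol_vars q"
  unfolding mpol_vars_def using Poly_Mapping.keys_add[of p q] by blast

lemma mpol_vars_mult: "mpol_vars (p * q :: ('v,'a::comm_ring_1) mpol) \<subseteq> mpol_vars p \<union> mpol_vars q"
proof
  fix v assume "v \<in> mpol_vars (p * q)"
  then obtain m where "m \<in> Poly_Mapping.keys (p*q)" "v \<in> Poly_Mapping.keys m" by (auto simp: mpol_vars_def)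
  then obtain a b where "a \<in> Poly_Mapping.keys p" "b \<in> Poly_Mapping.keys q" "m = a + b"
    using keys_mult[of p q] by blast
  with \<open>v \<in> Poly_Mapping.keys m\<close> show "v \<in> mpol_vars p \<union> mpol_vars q"
    using Poly_Mapping.keys_add[of a b] by (auto simp: mpol_vars_def)
qed

lemma cring_Sym: "cring (Sym n :: (nat \<times> nat, 'a::field) mpol ring)"
proof (intro cringI abelian_groupI comm_monoidI)
  fix x :: "(nat \<times> nat, 'a) mpol" assume "x \<in> carrier (Sym n)"
  then show "\<exists>y\<in>carrier (Sym n). y \<oplus>\<^bsub>Sym n\<^esub> x = \<zero>\<^bsub>Sym n\<^esub>"
    by (intro bexI[of _ "-x"]) (auto simp: Sym_def mpol_vars_def)
qed (use mpol_vars_add mpol_vars_mult in \<open>fastforce simp: Sym_def mpol_vars_def algebra_simps\<close>)+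

text \<open>Elements of the symmetric algebra as functions on the dual space:
  \<open>y\<^sub>i\<^sub>j\<close> takes the value \<open>f y\<^sub>i\<^sub>j\<close> at \<open>f\<close>.\<close>

definition eval_at :: "nat \<Rightarrow> ('a::field mat \<Rightarrow> 'a) \<Rightarrow> (nat \<times> nat, 'a) mpol \<Rightarrow> 'a" where
  "eval_at n f = mpol_eval (\<lambda>(i,j). f (y_unit n i j))"

definition vanishing_ideal ::
    "nat \<Rightarrow> ('a::field mat \<Rightarrow> 'a) set \<Rightarrow> (nat \<times> nat, 'a) mpol set" where
  "vanishing_ideal n \<Omega> = {p \<in> carrier (Sym n). \<forall>f\<in>\<Omega>. eval_at n f p = 0}"


section \<open>Regular and subregular orbits\<close>

text \<open>The dimension of \<open>\<Omega>\<close> is the transcendence degree over \<open>K\<close> of its coordinate ring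
  \<open>K[\<Omega>] = Sym n / vanishing_ideal n \<Omega>\<close>. The predicate says that the restrictions of
  \<open>p 0, \<dots>, p (k-1)\<close> to \<open>\<Omega>\<close> are algebraically independent elements of that ring.\<close>

definition alg_indep_on ::
    "nat \<Rightarrow> ('a::field mat \<Rightarrow> 'a) set \<Rightarrow> nat \<Rightarrow> (nat \<Rightarrow> (nat \<times> nat, 'a) mpol) \<Rightarrow> bool" where
  "alg_indep_on n \<Omega> k p \<longleftrightarrow>
     (\<forall>i<k. p i \<in> carrier (Sym n)) \<and>
     (\<forall>q :: (nat, 'a) mpol. mpol_vars q \<subseteq> {..<k} \<longrightarrow>
        (\<forall>f\<in>\<Omega>. mpol_eval (\<lambda>i. eval_at n f (p i)) q = 0) \<longrightarrow> q = 0)"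

definition variety_dim :: "nat \<Rightarrow> ('a::field mat \<Rightarrow> 'a) set \<Rightarrow> enat" where
  "variety_dim n \<Omega> = (SUP k \<in> {k. \<exists>p. alg_indep_on n \<Omega> k p}. enat k)"

definition regular_orbit :: "nat \<Rightarrow> ('a::field mat \<Rightarrow> 'a) set \<Rightarrow> bool" where
  "regular_orbit n \<Omega> \<longleftrightarrow> \<Omega> \<in> coadjoint_orbits n \<and>
     (\<forall>\<Omega>'\<in>(coadjoint_orbits n :: ('a mat \<Rightarrow> 'a) set set). variety_dim n \<Omega>' \<le> variety_dim n \<Omega>)"

definition subregular_orbit :: "nat \<Rightarrow> ('a::field mat \<Rightarrow> 'a) set \<Rightarrow> bool" where
  "subregular_orbit n \<Omega> \<longleftrightarrow> \<Omega> \<in> coadjoint_orbits n \<and>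
     (\<exists>\<Omega>reg :: ('a mat \<Rightarrow> 'a) set. regular_orbit n \<Omega>reg \<and> variety_dim n \<Omega> + 2 = variety_dim n \<Omega>reg)"


section \<open>Minors of the formal and the characteristic matrix\<close>

definition Phi :: "nat \<Rightarrow> (nat \<times> nat, 'a::field) mpol mat" where
  "Phi n = mat n n (\<lambda>(r,c). if c < r then mpol_var (Suc r, Suc c) else 0)"

text \<open>The indeterminate \<open>\<tau>\<close> is the variable of the univariate polynomials over the symmetric
  algebra.\<close>

definition Phi_tau :: "nat \<Rightarrow> (nat \<times> nat, 'a::field) mpol poly mat" where
  "Phi_tau n = [:0, 1:] \<cdot>\<^sub>m map_mat (\<lambda>p. [:p:]) (Phi n) + 1\<^sub>m n"

text \<open>Minor with rows \<open>I\<close> and columns \<open>J\<close>, where \<open>I\<close> and \<open>J\<close> are sets of indices counted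
  from 1.\<close>

definition minor :: "'b::comm_ring_1 mat \<Rightarrow> nat set \<Rightarrow> nat set \<Rightarrow> 'b" where
  "minor A I J = det (submatrix A ((\<lambda>i. i - 1) ` I) ((\<lambda>j. j - 1) ` J))"

definition n_zero :: "nat \<Rightarrow> nat" where
  "n_zero n = n div 2"

definition n_otimes :: "nat \<Rightarrow> nat" where
  "n_otimes n = (n - 1) div 2"

definition P :: "nat \<Rightarrow> nat \<Rightarrow> (nat \<times> nat, 'a::field) mpol" where
  "P n j = minor (Phi n) {n - j + 1..n} {1..j}"

definition P' :: "nat \<Rightarrow> nat \<Rightarrow> (nat \<times> nat, 'a::field) mpol" where
  "P' n j = minor (Phi n) (insert (n - j) {n - j + 2..n}) {1..j}"

definition P'' :: "nat \<Rightarrow> nat \<Rightarrow> (nat \<times> nat, 'a::field) mpol" where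
  "P'' n j = minor (Phi n) {n - j + 1..n} (insert (j + 1) {1..j - 1})"

text \<open>For even \<open>n\<close> the element \<open>P'\<close> with index \<open>n_zero n\<close> is not an instance of the formula
  for the other indices.\<close>

definition P'_mid :: "nat \<Rightarrow> (nat \<times> nat, 'a::field) mpol" where
  "P'_mid n = minor (Phi n) (insert (n_zero n) {n_zero n + 3..n}) {1..n_zero n - 1}"

definition P_tau :: "nat \<Rightarrow> nat \<Rightarrow> (nat \<times> nat, 'a::field) mpol poly" where
  "P_tau n j = minor (Phi_tau n) {n - j + 1..n} {1..j}"

text \<open>With \<open>k = n - j\<close>, the coefficient of \<open>\<tau>\<close> to the power \<open>n - j + 1\<close> in \<open>P_tau n j\<close>.\<close>

definition Z :: "nat \<Rightarrow> nat \<Rightarrow> (nat \<times> nat, 'a::field) mpol" where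
  "Z n k = coeff (P_tau n (n - k)) (k + 1)"

end

theory Submission imports Defs begin

text \<open>A linear form is encoded by its array of values on the basis \<open>y\<^sub>i\<^sub>j\<close>. If its corner entry \<open>P\<^sub>1\<close>
  does not vanish, pivoting on the corner (a Schur complement) deletes the first and the last index:
  the orbit is the product of an affine space of dimension \<open>2(n - 2)\<close> with the orbit of the
  smaller array, and the minors \<open>P, P', P'', Z\<close> of the two arrays agree up to sign and a factor
  \<open>P\<^sub>1\<close>, with their index raised by one. If the corner entry vanishes, pivoting on a neighbouring entry
  either leads to a generic smaller array, and then to one of the listed families of generators, or
  the orbit is parametrised by at most \<open>dim \<Omega>\<^sub>r\<^sub>e\<^sub>g - 3\<close> coordinates and is not subregular. In each case the
  generators allow one to express every coordinate as a polynomial in a set of coordinates that take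
  arbitrary values on the orbit, so they generate the whole vanishing ideal.\<close>

section \<open>Polynomial functions and their ideals\<close>

text \<open>Pivoting at (r,x) is clean when no index lies beyond r. Otherwise the moves change the
  Schur complement not only along its own orbit but also by a rank-one term
  \<open>w i * sg j\<close>, r < j < i, where \<open>w i\<close> is the (i,x) entry of N^2. The last
  \<open>w\<close> is constant on the orbit, so p > 0 indices beyond r contribute at most 2(p - 1)
  parameters instead of the 2p of the regular count: a zero corner always loses two dimensions. With
  a single index y beyond r the rank-one term is void, while \<open>w y\<close> survives as an
  invariant; up to sign it is Z_1. If P_1 = 0, then P_2 is the product of P'_1 and P''_1, and these
  two factors take its place; hence the gap between j_0 - 1 and j_0 + 2 in the list of generators.
  All computations use functions on arbitrary arrays, so that passing to a hyperplane or to a Schur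
  complement is a substitution; characteristic zero brings the result back to the polynomial ring.
  Dimensions are bounded from above by counting monomials and from below by free
  coordinates.\<close>

type_synonym 'a pt = "nat \<Rightarrow> nat \<Rightarrow> 'a"

inductive_set pf :: "(nat \<times> nat) set \<Rightarrow> ('a::comm_ring_1 pt \<Rightarrow> 'a) set" for V where
  const: "(\<lambda>_. c) \<in> pf V"
| coord: "(i,j) \<in> V \<Longrightarrow> (\<lambda>N. N i j) \<in> pf V"
| add: "f \<in> pf V \<Longrightarrow> g \<in> pf V \<Longrightarrow> (\<lambda>N. f N + g N) \<in> pf V"
| mult: "f \<in> pf V \<Longrightarrow> g \<in> pf V \<Longrightarrow> (\<lambda>N. f N * g N) \<in> pf V"

lemma pf_mono: assumes "V \<subseteq> W" "f \<in> pf V" shows "f \<in> pf W"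
  using assms(2) by induction (use assms(1) in \<open>auto intro: pf.intros\<close>)

lemma pf_uminus: "f \<in> pf V \<Longrightarrow> (\<lambda>N. - f N) \<in> pf V"
  using pf.mult[OF pf.const[of "-1"]] by fastforce

lemma pf_diff: "f \<in> pf V \<Longrightarrow> g \<in> pf V \<Longrightarrow> (\<lambda>N. f N - g N) \<in> pf V"
  using pf.add[OF _ pf_uminus] by fastforce

lemma pf_sum: "(\<And>a. a \<in> A \<Longrightarrow> f a \<in> pf V) \<Longrightarrow> (\<lambda>N. \<Sum>a\<in>A. f a N) \<in> pf V"
  by (induction A rule: infinite_finite_induct) (auto intro: pf.intros)

lemma pf_prod: "(\<And>a. a \<in> A \<Longrightarrow> f a \<in> pf V) \<Longrightarrow> (\<lambda>N. \<Prod>a\<in>A. f a N) \<in> pf V"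
  by (induction A rule: infinite_finite_induct) (auto intro: pf.intros)

lemma pf_divide: "f \<in> pf V \<Longrightarrow> (\<lambda>N. f N / c) \<in> pf V" for c :: "'a::field"
  using pf.mult[OF pf.const[of "inverse c"]] by (fastforce simp: divide_inverse mult.commute)

lemma pf_if: "(b \<Longrightarrow> f \<in> pf V) \<Longrightarrow> (\<not> b \<Longrightarrow> g \<in> pf V) \<Longrightarrow> (\<lambda>N. if b then f N else g N) \<in> pf V"
  by (cases b) auto

lemma pf_comp:
  assumes "f \<in> pf V" "\<And>i j. (i,j) \<in> V \<Longrightarrow> (\<lambda>N. T N i j) \<in> pf W"
  shows "(\<lambda>N. f (T N)) \<in> pf W"
  using assms(1) by induction (use assms(2) in \<open>auto intro: pf.intros\<close>)

lemma pf_cong: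
  assumes "f \<in> pf V" "\<And>i j. (i,j) \<in> V \<Longrightarrow> N i j = M i j" shows "f N = f M"
  using assms(1) by induction (use assms(2) in auto)

text \<open>The set V of variables allowed in the coefficients stays a parameter: it is
  \<open>UNIV\<close> throughout the elimination, but at the end the coefficients must involve only
  the strictly lower entries in order to come from \<open>Sym n\<close>.\<close>

inductive_set idl :: "(nat \<times> nat) set \<Rightarrow> ('a::comm_ring_1 pt \<Rightarrow> 'a) set \<Rightarrow> ('a pt \<Rightarrow> 'a) set" for V G where
  zero: "(\<lambda>_. 0) \<in> idl V G"
| step: "h \<in> idl V G \<Longrightarrow> r \<in> pf V \<Longrightarrow> g \<in> G \<Longrightarrow> (\<lambda>N. h N + r N * g N) \<in> idl V G"

definition pideal :: "('a::comm_ring_1 pt \<Rightarrow> 'a) set \<Rightarrow> bool" where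
  "pideal J \<longleftrightarrow> (\<lambda>_. 0) \<in> J \<and> (\<forall>f\<in>J. \<forall>g\<in>J. (\<lambda>N. f N + g N) \<in> J) \<and>
     (\<forall>f\<in>J. \<forall>r\<in>pf UNIV. (\<lambda>N. r N * f N) \<in> J)"

lemma idl_base: "g \<in> G \<Longrightarrow> g \<in> idl V G"
  using idl.step[OF idl.zero pf.const[of 1]] by fastforce

lemma idl_add: assumes "f \<in> idl V G" "g \<in> idl V G" shows "(\<lambda>N. f N + g N) \<in> idl V G"
  using assms(2)
proof induction
  case (step h r g')
  from idl.step[OF step(4,2,3)] show ?case by (simp add: add.assoc)
qed (use assms(1) in auto)

lemma idl_mult: assumes "f \<in> idl V G" "r \<in> pf V" shows "(\<lambda>N. r N * f N) \<in> idl V G"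
  using assms(1)
proof induction
  case (step h s g)
  from idl.step[OF step(4) pf.mult[OF assms(2) step(2)] step(3)]
  show ?case by (simp add: algebra_simps)
qed (auto intro: idl.zero)

lemma pideal_idl: "pideal (idl UNIV G)"
  unfolding pideal_def by (auto intro: idl.zero idl_add idl_mult)

lemma pideal_zero: "pideal J \<Longrightarrow> (\<lambda>_. 0) \<in> J"
  and pideal_add: "pideal J \<Longrightarrow> f \<in> J \<Longrightarrow> g \<in> J \<Longrightarrow> (\<lambda>N. f N + g N) \<in> J"
  and pideal_mult: "pideal J \<Longrightarrow> f \<in> J \<Longrightarrow> r \<in> pf UNIV \<Longrightarrow> (\<lambda>N. r N * f N) \<in> J"
  by (auto simp: pideal_def)

lemma pideal_uminus: "pideal J \<Longrightarrow> f \<in> J \<Longrightarrow> (\<lambda>N. - f N) \<in> J"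
  using pideal_mult[OF _ _ pf.const[of "-1"]] by fastforce

lemma pideal_diff: "pideal J \<Longrightarrow> f \<in> J \<Longrightarrow> g \<in> J \<Longrightarrow> (\<lambda>N. f N - g N) \<in> J"
  using pideal_add[OF _ _ pideal_uminus] by fastforce

lemma pideal_sum: "pideal J \<Longrightarrow> (\<And>a. a \<in> A \<Longrightarrow> f a \<in> J) \<Longrightarrow> (\<lambda>N. \<Sum>a\<in>A. f a N) \<in> J"
  by (induction A rule: infinite_finite_induct) (auto intro: pideal_zero pideal_add)

lemma idl_least: assumes "pideal J" "G \<subseteq> J" shows "idl UNIV G \<subseteq> J"
proof
  fix f assume "f \<in> idl UNIV G"
  then show "f \<in> J"
    by induction (use assms in \<open>auto intro!: pideal_zero pideal_add pideal_mult\<close>)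
qed

lemma idl_comp:
  assumes "f \<in> idl V G" "\<And>i j. (i,j) \<in> V \<Longrightarrow> (\<lambda>N. T N i j) \<in> pf W"
  shows "(\<lambda>N. f (T N)) \<in> idl W ((\<lambda>g N. g (T N)) ` G)"
  using assms(1)
proof induction
  case (step h r g)
  show ?case
    using idl.step[OF step(4) pf_comp[OF step(2) assms(2)], where g = "\<lambda>N. g (T N)"] step(3) by auto
qed (auto intro: idl.zero)

text \<open>Congruences modulo an ideal are compatible with sums and products, so every coordinate
  may be replaced by its normal form inside a polynomial.\<close>

lemma pf_subst_cong:
  assumes J: "pideal J" and f: "f \<in> pf V"
    and r: "\<And>i j. (i,j) \<in> V \<Longrightarrow> r i j \<in> pf UNIV \<and> (\<lambda>N. N i j - r i j N) \<in> J"
  shows "(\<lambda>N. f (\<lambda>i j. r i j N)) \<in> pf UNIV \<and> (\<lambda>N. f N - f (\<lambda>i j. r i j N)) \<in> J"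
  using f
proof induction
  case (add f g)
  then show ?case using pideal_add[OF J, of "\<lambda>N. f N - f (\<lambda>i j. r i j N)" "\<lambda>N. g N - g (\<lambda>i j. r i j N)"]
    by (auto intro: pf.add simp: algebra_simps)
next
  case (mult f g)
  let ?f = "\<lambda>N. f (\<lambda>i j. r i j N)" and ?g = "\<lambda>N. g (\<lambda>i j. r i j N)"
  have gu: "g \<in> pf UNIV" using mult pf_mono by blast
  have "(\<lambda>N. g N * (f N - ?f N) + ?f N * (g N - ?g N)) \<in> J"
    using mult gu by (intro pideal_add[OF J] pideal_mult[OF J]) auto
  moreover have "(\<lambda>N. g N * (f N - ?f N) + ?f N * (g N - ?g N)) = (\<lambda>N. f N * g N - ?f N * ?g N)"
    by (auto simp: algebra_simps)
  ultimately show ?case using mult by (auto intro: pf.mult)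
qed (use r J in \<open>auto intro: pf.const pideal_zero\<close>)

lemma hyperplane_ideal:
  assumes J: "pideal J" and f: "f \<in> pf UNIV" and c: "(\<lambda>N. N y x - c) \<in> J"
  shows "(\<lambda>N. f N - f (\<lambda>i j. if i = y \<and> j = x then c else N i j)) \<in> J"
proof -
  have "(\<lambda>N. f N - f (\<lambda>i j. (if i = y \<and> j = x then (\<lambda>_. c) else (\<lambda>N. N i j)) N)) \<in> J"
    by (rule conjunct2[OF pf_subst_cong[OF J f]])
      (use c pideal_zero[OF J] in \<open>auto intro: pf.const pf.coord\<close>)
  moreover have "(\<lambda>i j. (if i = y \<and> j = x then (\<lambda>_. c) else (\<lambda>N. N i j)) N)
      = (\<lambda>i j. if i = y \<and> j = x then c else N i j)" for N :: "'a pt" by (auto simp: fun_eq_iff)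
  ultimately show ?thesis by simp
qed

text \<open>The factor theorem. The identities between minors of an array and of its Schur
  complement hold only where the pivot has its prescribed value; this turns them into congruences
  modulo any ideal that contains the pivot generator.\<close>

lemma vanishing_on_hyperplane:
  assumes J: "pideal J" and f: "f \<in> pf UNIV" and c: "(\<lambda>N. N y x - c) \<in> J"
    and v: "\<And>N. N y x = c \<Longrightarrow> f N = 0"
  shows "f \<in> J"
  using hyperplane_ideal[OF J f c] v by simp

lemma vanishing_on_two_hyperplanes:
  assumes J: "pideal J" and f: "f \<in> pf UNIV" and c: "(\<lambda>N. N y x - c) \<in> J" and c': "(\<lambda>N. N y' x' - c') \<in> J"
    and v: "\<And>N. N y x = c \<Longrightarrow> N y' x' = c' \<Longrightarrow> f N = 0" and ne: "(y,x) \<noteq> (y',x')"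
  shows "f \<in> J"
proof -
  let ?T = "\<lambda>N i j. if i = y \<and> j = x then c else N i j"
  have "(\<lambda>N. f (?T N)) \<in> J"
    by (rule vanishing_on_hyperplane[OF J pf_comp[OF f] c'])
      (use v ne in \<open>auto intro!: pf.intros pf_if\<close>)
  from pideal_add[OF J hyperplane_ideal[OF J f c] this] show ?thesis by simp
qed

section \<open>Orbits on coordinate arrays\<close>

definition lowp :: "nat set \<Rightarrow> (nat \<times> nat) set" where
  "lowp I = {(i,j). i \<in> I \<and> j \<in> I \<and> j < i}"

text \<open>\<open>mv a b t\<close> is the coadjoint action of an elementary unitriangular matrix. It may spoil the entries
  on and above the diagonal, which carry no meaning and are ignored by \<open>agree\<close> below.\<close>

definition mv :: "nat \<Rightarrow> nat \<Rightarrow> 'a::comm_ring_1 \<Rightarrow> 'a pt \<Rightarrow> 'a pt" where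
  "mv a b t N i j = N i j - (if i = a then t * N b j else 0) + (if j = b then t * N i a else 0)"

definition agree :: "nat set \<Rightarrow> 'a pt \<Rightarrow> 'a pt \<Rightarrow> bool" where
  "agree I M N \<longleftrightarrow> (\<forall>i\<in>I. \<forall>j\<in>I. j < i \<longrightarrow> M i j = N i j)"

text \<open>Orbits are generated by elementary moves rather than by a group, which makes sense on
  every index set left over after deletions. Closure under \<open>agree\<close> forgets the
  meaningless entries.\<close>

inductive orb :: "nat set \<Rightarrow> 'a::comm_ring_1 pt \<Rightarrow> 'a pt \<Rightarrow> bool" for I M where
  refl: "agree I N M \<Longrightarrow> orb I M N"
| step: "orb I M N \<Longrightarrow> a \<in> I \<Longrightarrow> b \<in> I \<Longrightarrow> a < b \<Longrightarrow> agree I N' (mv a b t N) \<Longrightarrow> orb I M N'"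

lemma agree_sym: "agree I M N \<Longrightarrow> agree I N M" by (auto simp: agree_def)
lemma agree_trans: "agree I M N \<Longrightarrow> agree I N K \<Longrightarrow> agree I M K" by (auto simp: agree_def)
lemma agree_refl [simp]: "agree I M M" by (auto simp: agree_def)

lemma agree_mv: "agree I M N \<Longrightarrow> a \<in> I \<Longrightarrow> b \<in> I \<Longrightarrow> a < b \<Longrightarrow> agree I (mv a b t M) (mv a b t N)"
  by (auto simp: agree_def mv_def)

lemma orb_self [simp]: "orb I M M" by (rule orb.refl) simp

lemma orb_cong: "orb I M N \<Longrightarrow> agree I N' N \<Longrightarrow> orb I M N'"
  by (cases rule: orb.cases, assumption) (auto intro: orb.refl orb.step agree_trans)

lemma orb_trans: assumes "orb I M N" "orb I N K" shows "orb I M K"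
  using assms(2) by induction (use assms(1) in \<open>auto intro: orb.step orb_cong\<close>)

lemma orb_move: "orb I M N \<Longrightarrow> a \<in> I \<Longrightarrow> b \<in> I \<Longrightarrow> a < b \<Longrightarrow> orb I M (mv a b t N)"
  by (rule orb.step[of I M N a b _ t]) auto

text \<open>The moves share b and have d < b: row b and the entries of the columns d in rows beyond
  b, which are all that they read, are changed by none of them.\<close>

lemma orb_moves:
  assumes "orb I M N" "b \<in> I" "finite A" "A \<subseteq> {d\<in>I. d < b}"
  shows "orb I M (\<lambda>i j. N i j - (if i \<in> A then s i * N b j else 0) + (if j = b then \<Sum>d\<in>A. s d * N i d else 0))"
  using assms(3,4)
proof (induction A)
  case empty
  then show ?case using assms(1) by (simp cong: if_cong)
next
  case (insert d A)
  let ?N = "\<lambda>i j. N i j - (if i \<in> A then s i * N b j else 0) + (if j = b then \<Sum>d\<in>A. s d * N i d else 0)"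
  have o: "orb I M ?N" using insert by auto
  have d: "d \<in> I" "d < b" using insert by auto
  show ?case
  proof (rule orb.step[OF o d(1) assms(2) d(2), of _ "s d"])
    show "agree I (\<lambda>i j. N i j - (if i \<in> insert d A then s i * N b j else 0) +
        (if j = b then \<Sum>d\<in>insert d A. s d * N i d else 0)) (mv d b (s d) ?N)"
      using insert d by (auto simp: agree_def mv_def algebra_simps)
  qed
qed

text \<open>Only rows before the pivot row are corrected. In rows beyond it \<open>nrm\<close> makes
  column x zero, so the full Schur complement would not differ there.\<close>

definition schur :: "nat \<Rightarrow> nat \<Rightarrow> 'a::field \<Rightarrow> 'a pt \<Rightarrow> 'a pt" where
  "schur x r c N i j = N i j - (if i < r then N i x * N r j / c else 0)"

section \<open>Elementary moves, the Schur complement and a column of N^2\<close>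

locale pivot =
  fixes I :: "nat set" and x r :: nat and c :: "'a::field"
  assumes fin: "finite I" and x_in: "x \<in> I" and r_in: "r \<in> I" and xr: "x < r"
    and x_min: "\<And>i. i \<in> I \<Longrightarrow> i \<noteq> x \<Longrightarrow> x < i" and c0: "c \<noteq> 0"
begin

abbreviation "I' \<equiv> I - {x,r}"
abbreviation "S \<equiv> schur x r c"

definition "nrm N \<longleftrightarrow> N r x = c \<and> (\<forall>i\<in>I. r < i \<longrightarrow> N i x = 0)"
text \<open>Under \<open>nrm\<close> and for i > r this is the (i,x) entry of N^2, because column x
  vanishes beyond r.\<close>

definition "w N i = (\<Sum>d\<in>{d\<in>I. x < d \<and> d \<le> r}. N i d * N d x)"

lemma w_split: "nrm N \<Longrightarrow> w N i = c * N i r + (\<Sum>d\<in>{d\<in>I. x < d \<and> d < r}. N i d * N d x)"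
proof -
  assume "nrm N"
  have "{d\<in>I. x < d \<and> d \<le> r} = insert r {d\<in>I. x < d \<and> d < r}" using r_in xr by auto
  then show ?thesis using fin \<open>nrm N\<close> by (simp add: w_def nrm_def mult.commute)
qed

context
  fixes a b :: nat and t :: 'a and N N' :: "'a pt"
  assumes ab: "a \<in> I" "b \<in> I" "a < b" and N': "agree I N' (mv a b t N)" and N: "nrm N"
begin

lemma N'_eq: "i \<in> I \<Longrightarrow> j \<in> I \<Longrightarrow> j < i \<Longrightarrow> N' i j = mv a b t N i j"
  using N' by (auto simp: agree_def)

lemma N_col: "i \<in> I \<Longrightarrow> r < i \<Longrightarrow> N i x = 0" "N r x = c"
  using N by (auto simp: nrm_def)

lemma x_le: "i \<in> I \<Longrightarrow> x \<le> i" using x_min[of i] by (cases "i = x") auto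

lemma nrm_move: "nrm N'"
  unfolding nrm_def
proof safe
  have "b \<noteq> x" using ab x_le[of a] by auto
  then show "N' r x = c"
    using N'_eq[OF r_in x_in xr] N_col(1)[OF ab(2)] ab N_col(2) by (auto simp: mv_def)
  fix i assume i: "i \<in> I" "r < i"
  then show "N' i x = 0" using N'_eq[OF i(1) x_in] N_col(1)[OF ab(2)] N_col(1)[OF i] \<open>b \<noteq> x\<close> ab xr
    by (auto simp: mv_def)
qed

text \<open>The column of N^2 is transformed like column x of N, as for a genuine conjugation; the
  four cases check that truncation to the lower triangle does not disturb this.\<close>

lemma w_move:
  assumes i: "i \<in> I" "r < i"
  shows "w N' i = w N i - (if i = a then t * w N b else 0)"
proof -
  let ?D = "{d\<in>I. x < d \<and> d \<le> r}"
  have fD: "finite ?D" using fin by auto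
  have e1: "N' i d = mv a b t N i d" if "d \<in> ?D" for d using that i N'_eq by auto
  have e2: "N' d x = mv a b t N d x" if "d \<in> ?D" for d using that x_in N'_eq by auto
  have bx: "b \<noteq> x" using ab x_le[of a] by auto
  consider "r < a" | "a \<le> r" "r < b" | "a = x" | "x < a" "a \<le> r" "b \<le> r"
    using x_le[OF ab(1)] by linarith
  then show ?thesis
  proof cases
    case 1
    have "w N' i = (\<Sum>d\<in>?D. N i d * N d x - (if i = a then t * (N b d * N d x) else 0))"
      unfolding w_def by (rule sum.cong[OF HOL.refl], simp only: e1 e2) (use 1 ab bx in \<open>auto simp: mv_def algebra_simps\<close>)
    also have "\<dots> = w N i - (if i = a then t * w N b else 0)"
      by (simp add: w_def sum_subtractf sum_distrib_left)
    finally show ?thesis .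
  next
    case 2
    have "w N' i = (\<Sum>d\<in>?D. N i d * N d x)"
      unfolding w_def by (rule sum.cong[OF HOL.refl], simp only: e1 e2) (use 2 i bx N_col(1)[OF ab(2)] in \<open>auto simp: mv_def algebra_simps\<close>)
    then show ?thesis using 2 i by (simp add: w_def)
  next
    case 3
    have "w N' i = (\<Sum>d\<in>?D. N i d * N d x)"
      unfolding w_def by (rule sum.cong[OF HOL.refl], simp only: e1 e2) (use 3 i bx N_col(1)[OF i] xr in \<open>auto simp: mv_def algebra_simps\<close>)
    then show ?thesis using 3 i xr by (simp add: w_def)
  next
    case 4
    have D: "a \<in> ?D" "b \<in> ?D" using 4 ab by auto
    \<comment> \<open>Both a and b lie in the range of summation: what is gained at d = b through
      the new N i b is lost at d = a through the new N a x.\<close>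
    have "w N' i = (\<Sum>d\<in>?D. N i d * N d x + (if d = b then t * N i a * N b x else 0)
        - (if d = a then t * N i a * N b x else 0))"
      unfolding w_def by (rule sum.cong[OF HOL.refl], simp only: e1 e2) (use 4 i bx ab in \<open>auto simp: mv_def algebra_simps\<close>)
    also have "\<dots> = w N i" using D fD by (simp add: w_def sum.distrib sum_subtractf sum.delta)
    finally show ?thesis using 4 i by simp
  qed
qed

text \<open>Such a move adds a multiple of column x to a column, or of row r to a row, and a Schur
  complement is built to absorb exactly this. These moves later serve to give the pivot row and
  column arbitrary values.\<close>

lemma schur_move_unchanged:
  assumes "a = x \<or> b = r" shows "agree I' (S N') (S N)"
  unfolding agree_def
proof (intro ballI impI)
  fix i j assume ij: "i \<in> I'" "j \<in> I'" "j < i"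
  have xi: "x < i" "x < j" using ij x_min by auto
  have bx: "b \<noteq> x" using ab x_le[of a] by auto
  have e: "N' i j = mv a b t N i j" "N' i x = mv a b t N i x"
    using ij xi x_in N'_eq by auto
  have e3: "N' r j = mv a b t N r j" if "i < r" using ij that r_in N'_eq by auto
  have z: "N i x = 0" if "\<not> i < r" using that ij N_col(1)[of i] by (cases "i = r") auto
  have SN: "S N' i j = mv a b t N i j - (if i < r then mv a b t N i x * mv a b t N r j / c else 0)"
    using e e3 by (simp add: schur_def)
  show "S N' i j = S N i j" using assms
  proof
    assume "a = x" then show ?thesis
      unfolding SN using ij xi bx c0 xr z N_col(2)
      by (auto simp: schur_def mv_def field_simps)
  next
    assume "b = r" then show ?thesis
      unfolding SN using ij xi bx c0 xr ab z N_col(2)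
      by (auto simp: schur_def mv_def field_simps)
  qed
qed

lemma schur_move:
  assumes "x < a" "b \<noteq> r" "a \<noteq> r" shows "agree I' (S N') (mv a b t (S N))"
  unfolding agree_def
proof (intro ballI impI)
  fix i j assume ij: "i \<in> I'" "j \<in> I'" "j < i"
  have xi: "x < i" "x < j" using ij x_min by auto
  have bx: "b \<noteq> x" using ab x_le[of a] by auto
  have e: "N' i j = mv a b t N i j" "N' i x = mv a b t N i x"
    using ij xi x_in N'_eq by auto
  have e3: "N' r j = mv a b t N r j" if "i < r" using ij that r_in N'_eq by auto
  have z: "N i x = 0" if "\<not> i < r" using that ij N_col(1)[of i] by (cases "i = r") auto
  have zb: "N b x = 0" if "\<not> b < r" using that ab assms N_col(1)[of b] by (cases "b = r") auto
  have SN: "S N' i j = mv a b t N i j - (if i < r then mv a b t N i x * mv a b t N r j / c else 0)"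
    using e e3 by (simp add: schur_def)
  show "S N' i j = mv a b t (S N) i j" unfolding SN
    using ij xi bx c0 xr assms z zb ab
    by (auto simp: schur_def mv_def field_simps)
qed

end

lemma orb_nrm:
  assumes "orb I M N" "nrm M" shows "nrm N"
  using assms
proof induction
  case (refl N)
  then show ?case using x_in r_in xr by (auto simp: agree_def nrm_def)
next
  case (step N a b N' t)
  then show ?case using nrm_move by blast
qed

text \<open>The origin of the rank-one term. Subtracting a multiple of row b from row r adds
  multiples of row b to all rows d < r of the complement, which is imitated by moves of the
  complement with coefficients \<open>- t * N d x / c\<close>. In column b these yield the required
  multiple of N i r only up to a multiple of \<open>w N i\<close>, and this defect is added to
  \<open>sg\<close>.\<close>

lemma schur_move_row:
  assumes b: "b \<in> I" "r < b" and N': "agree I N' (mv r b t N)" and N: "nrm N"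
    and Nt: "orb I' K Nt" and eq: "\<And>i j. i \<in> I' \<Longrightarrow> j \<in> I' \<Longrightarrow> j < i \<Longrightarrow> S N i j = Nt i j + (if r < j then w N i * sg j else 0)"
  shows "\<exists>Nt'. orb I' K Nt' \<and> (\<forall>i\<in>I'. \<forall>j\<in>I'. j < i \<longrightarrow>
     S N' i j = Nt' i j + (if r < j then w N i * (sg j + (if j = b then t / c else 0)) else 0))"
proof -
  let ?A = "{d\<in>I'. d < r}" and ?s = "\<lambda>d. - t * N d x / c"
  let ?Nt = "\<lambda>i j. Nt i j - (if i \<in> ?A then ?s i * Nt b j else 0) + (if j = b then \<Sum>d\<in>?A. ?s d * Nt i d else 0)"
  have "orb I' K ?Nt"
    by (rule orb_moves[OF Nt]) (use b fin xr in auto)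
  moreover have "S N' i j = ?Nt i j + (if r < j then w N i * (sg j + (if j = b then t / c else 0)) else 0)"
    if ij: "i \<in> I'" "j \<in> I'" "j < i" for i j
  proof -
    have xi: "x < i" "x < j" using ij x_min by auto
    have zb: "N b x = 0" using N b by (auto simp: nrm_def)
    have z: "N i x = 0" if "\<not> i < r" using that ij N by (cases "i = r") (auto simp: nrm_def)
    have e: "N' i j = mv r b t N i j" "N' i x = mv r b t N i x"
      using ij xi x_in N' by (auto simp: agree_def)
    have e3: "N' r j = mv r b t N r j" if "i < r" using ij that r_in N' by (auto simp: agree_def)
    have ne: "i \<noteq> r" "j \<noteq> r" using ij by auto
    have bj: "S N b j = Nt b j" if "j < r" using eq[of b j] that b ij xr by auto
    have Sb: "S N b j = N b j" using b by (simp add: schur_def)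
    consider "i < r" | "r < i" "j = b" | "r < i" "j \<noteq> b" using ne by linarith
    then show ?thesis
    proof cases
      case 1
      have Nij: "N i j = Nt i j + N i x * N r j / c" using eq[OF ij] 1 ij by (auto simp: schur_def diff_eq_eq)
      have "S N' i j = N i j - N i x * (N r j - t * Nt b j) / c"
        using e e3 ij xi 1 b ne bj Sb by (auto simp: mv_def schur_def)
      also have "\<dots> = Nt i j + t * N i x / c * Nt b j" using c0 by (simp add: Nij field_simps)
      finally show ?thesis using 1 ij b by (auto simp: x_min)
    next
      case 2
      have "Nt i d = N i d" if "d \<in> ?A" for d using eq[of i d] that ij 2 xr b by (auto simp: schur_def)
      then have "(\<Sum>d\<in>?A. ?s d * Nt i d) = (\<Sum>d\<in>?A. - t / c * (N i d * N d x))"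
        by (intro sum.cong) auto
      also have "\<dots> = - t / c * (\<Sum>d\<in>?A. N i d * N d x)" by (simp add: sum_distrib_left)
      also have "(\<Sum>d\<in>?A. N i d * N d x) = (\<Sum>d\<in>{d\<in>I. x < d \<and> d < r}. N i d * N d x)"
        using x_min by (intro sum.cong) auto
      also have "\<dots> = w N i - c * N i r" using w_split[OF N] by simp
      finally have s: "(\<Sum>d\<in>?A. ?s d * Nt i d) = - t / c * (w N i - c * N i r)" .
      have iA: "(i \<in> ?A) = False" using 2 by auto
      have "?Nt i j = Nt i j - t / c * (w N i - c * N i r)"
        unfolding iA s using 2(2) by simp
      moreover have "S N' i j = N i j + t * N i r" using e(1) 2 ne b z by (auto simp: schur_def mv_def)
      moreover have "N i j = Nt i j + w N i * sg j" using eq[OF ij] 2 b by (auto simp: schur_def)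
      ultimately show ?thesis using 2 b c0 by (simp add: field_simps)
    next
      case 3
      then show ?thesis using e ij eq[OF ij] by (auto simp: mv_def schur_def)
    qed
  qed
  ultimately show ?thesis by blast
qed

end

context pivot
begin

lemma w_cong: assumes "agree I N M" "i \<in> I" "r < i" shows "w N i = w M i"
  unfolding w_def using assms x_in by (intro sum.cong) (auto simp: agree_def)

lemma schur_cong: assumes "agree I N M" shows "agree I' (S N) (S M)"
  using assms x_in r_in x_min by (auto simp: agree_def schur_def)

text \<open>The moves fall into three kinds: those absorbed by the complement, those with a = r,
  which feed the rank-one term, and those with both indices in \<open>I'\<close>, which act on the
  complement and on the rank-one term alike.\<close>

lemma orb_pivot:
  assumes "orb I M N" "nrm M"
  shows "\<exists>Nt sg. orb I' (S M) Nt \<and> (\<forall>i\<in>I'. \<forall>j\<in>I'. j < i \<longrightarrow>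
           S N i j = Nt i j + (if r < j then w N i * sg j else 0))"
  using assms
proof induction
  case (refl N)
  then show ?case
    by (intro exI[of _ "S N"] exI[of _ "\<lambda>_. 0"]) (auto intro: orb.refl schur_cong)
next
  case (step N a b N' t)
  have N: "nrm N" using step orb_nrm by blast
  obtain Nt sg where o: "orb I' (S M) Nt"
    and eq: "\<And>i j. i \<in> I' \<Longrightarrow> j \<in> I' \<Longrightarrow> j < i \<Longrightarrow> S N i j = Nt i j + (if r < j then w N i * sg j else 0)"
    using step(6)[OF step(7)] by metis
  have xa: "x \<le> a" using x_min[OF step(2)] by (cases "a = x") auto
  have wm: "w N' i = w N i - (if i = a then t * w N b else 0)" if "i \<in> I" "r < i" for i
    using w_move[OF step(2-5) N that] .
  consider "a = x \<or> b = r" | "a = r" | "x < a" "b \<noteq> r" "a \<noteq> r" using xa by linarith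
  then show ?case
  proof cases
    case 1
    have "w N' i = w N i" if "i \<in> I" "r < i" for i using wm[OF that] that 1 xr step(4) by auto
    then show ?thesis using o eq schur_move_unchanged[OF step(2-5) N 1]
      by (intro exI[of _ Nt] exI[of _ sg]) (auto simp: agree_def)
  next
    case 2
    have "w N' i = w N i" if "i \<in> I" "r < i" for i using wm[OF that] that 2 by auto
    moreover obtain Nt' where "orb I' (S M) Nt'" "\<forall>i\<in>I'. \<forall>j\<in>I'. j < i \<longrightarrow>
      S N' i j = Nt' i j + (if r < j then w N i * (sg j + (if j = b then t / c else 0)) else 0)"
      using schur_move_row[OF step(3) _ _ N o eq, of N' t] 2 step(4,5) by blast
    ultimately show ?thesis
      by (intro exI[of _ Nt'] exI[of _ "\<lambda>j. sg j + (if j = b then t / c else 0)"]) auto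
  next
    case 3
    \<comment> \<open>\<open>w\<close> moves as a column and \<open>sg\<close> as a row, so their
      product moves like an array. The guard r < a reflects that the rank-one term has no entries in
      columns up to r.\<close>
    let ?Nt = "mv a b t Nt" and ?sg = "\<lambda>j. sg j + (if r < a \<and> j = b then t * sg a else 0)"
    have ab: "a \<in> I'" "b \<in> I'" using 3 step by auto
    have "S N' i j = ?Nt i j + (if r < j then w N' i * ?sg j else 0)" if ij: "i \<in> I'" "j \<in> I'" "j < i" for i j
    proof -
      have m: "S N' i j = mv a b t (S N) i j"
        using schur_move[OF step(2-5) N 3] ij by (auto simp: agree_def)
      have bj: "S N b j = Nt b j + (if r < j then w N b * sg j else 0)" if "i = a"
        using eq[of b j] ij ab that step(4) by auto
      have ia: "S N i a = Nt i a + (if r < a then w N i * sg a else 0)" if "j = b"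
        using eq[of i a] ij ab that step(4) by auto
      have wi: "w N' i = w N i - (if i = a then t * w N b else 0)" if "r < i" using wm[of i] that ij by auto
      show ?thesis unfolding m using ij ab 3 step(4)
        by (auto simp: mv_def algebra_simps eq[OF ij] bj ia wi)
    qed
    then show ?thesis using orb_move[OF o ab step(4)]
      by (intro exI[of _ ?Nt] exI[of _ ?sg]) auto
  qed
qed

text \<open>By \<open>w_move\<close> an entry of \<open>w\<close> only receives multiples of entries
  with larger index, so trailing zeros persist and the entry just before them is fixed.\<close>

lemma w_invariant:
  assumes "orb I M N" "nrm M" and z: "\<And>e. e \<in> I \<Longrightarrow> e0 < e \<Longrightarrow> r < e \<Longrightarrow> w M e = 0"
  shows "(\<forall>e\<in>I. e0 < e \<longrightarrow> r < e \<longrightarrow> w N e = 0) \<and> (e0 \<in> I \<longrightarrow> r < e0 \<longrightarrow> w N e0 = w M e0)"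
  using assms(1,2)
proof induction
  case (refl N)
  then show ?case using z w_cong by auto
next
  case (step N a b N' t)
  have N: "nrm N" using step orb_nrm by blast
  have wm: "w N' i = w N i - (if i = a then t * w N b else 0)" if "i \<in> I" "r < i" for i
    using w_move[OF step(2-5) N that] .
  have IH: "(\<forall>e\<in>I. e0 < e \<longrightarrow> r < e \<longrightarrow> w N e = 0) \<and> (e0 \<in> I \<longrightarrow> r < e0 \<longrightarrow> w N e0 = w M e0)"
    using step(6)[OF step(7)] .
  have "w N' e = w N e" if e: "e \<in> I" "e0 \<le> e" "r < e" for e
  proof (cases "e = a")
    case True
    then have "w N b = 0" using IH step(3,4) e by auto
    then show ?thesis using wm[OF e(1,3)] by simp
  qed (use wm[OF e(1,3)] in simp)
  then show ?case using IH by simp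
qed

text \<open>The moves of the complement have indices in \<open>I'\<close> and can be carried out on
  the whole array, where \<open>schur_move\<close> keeps the complement in step.\<close>

lemma schur_lift:
  assumes "orb I' (S M) A" "nrm M"
  shows "\<exists>N. orb I M N \<and> agree I' (S N) A"
  using assms
proof induction
  case (refl N)
  then show ?case by (intro exI[of _ M]) (auto intro: agree_sym)
next
  case (step A a b A' t)
  then obtain N where N: "orb I M N" "agree I' (S N) A" by auto
  have ab: "a \<in> I" "b \<in> I" "x < a" "b \<noteq> r" "a \<noteq> r" using step x_min by auto
  have "agree I' (S (mv a b t N)) (mv a b t (S N))"
    by (rule schur_move) (use ab step N orb_nrm in auto)
  moreover have "agree I' (mv a b t (S N)) (mv a b t A)" using agree_mv[OF N(2)] step by blast
  moreover have "agree I' (mv a b t A) A'" using step agree_sym by blast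
  ultimately show ?case using orb_move[OF N(1) ab(1,2) step(4)] agree_trans by blast
qed

section \<open>Free coordinates in the pivot column and the pivot row\<close>

abbreviation "mid \<equiv> {d\<in>I. x < d \<and> d < r}"

lemma adjust_column:
  assumes N: "nrm N" and "finite A" "A \<subseteq> mid"
  shows "\<exists>N'. orb I N N' \<and> (\<forall>a\<in>A. N' a x = p a) \<and> agree I' (S N') (S N)"
  using assms(2,3)
proof (induction A)
  case empty
  then show ?case by (intro exI[of _ N]) auto
next
  case (insert a A)
  then obtain N' where N': "orb I N N'" "\<forall>a\<in>A. N' a x = p a" "agree I' (S N') (S N)" by auto
  have a: "a \<in> I" "a < r" "x < a" using insert by auto
  have n: "nrm N'" using orb_nrm[OF N'(1) N] .
  let ?N = "mv a r ((N' a x - p a) / c) N'"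
  have "agree I' (S ?N) (S N')" by (rule schur_move_unchanged[OF a(1) r_in a(2) agree_refl n]) simp
  moreover have "\<forall>a\<in>insert a A. ?N a x = p a"
    using N'(2) insert(2) a n c0 xr by (auto simp: mv_def nrm_def)
  ultimately show ?case using orb_move[OF N'(1) a(1) r_in a(2)] N'(3) agree_trans by blast
qed

lemma adjust_row:
  assumes N: "nrm N" and "finite B" "B \<subseteq> mid"
  shows "\<exists>N'. orb I N N' \<and> (\<forall>b\<in>B. N' r b = q b) \<and> (\<forall>a\<in>mid. N' a x = N a x) \<and> agree I' (S N') (S N)"
  using assms(2,3)
proof (induction B)
  case empty
  then show ?case by (intro exI[of _ N]) auto
next
  case (insert b B)
  then obtain N' where N': "orb I N N'" "\<forall>b\<in>B. N' r b = q b" "\<forall>a\<in>mid. N' a x = N a x" "agree I' (S N') (S N)" by auto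
  have b: "b \<in> I" "b < r" "x < b" using insert by auto
  have n: "nrm N'" using orb_nrm[OF N'(1) N] .
  let ?N = "mv x b ((q b - N' r b) / c) N'"
  have "agree I' (S ?N) (S N')" by (rule schur_move_unchanged[OF x_in b(1,3) agree_refl n]) simp
  moreover have "\<forall>b\<in>insert b B. ?N r b = q b"
    using N'(2) insert(2) b n c0 xr by (auto simp: mv_def nrm_def)
  moreover have "\<forall>a\<in>mid. ?N a x = N a x" using N'(3) b by (auto simp: mv_def)
  ultimately show ?case using orb_move[OF N'(1) x_in b(1,3)] N'(4) agree_trans by blast
qed

lemma orb_fill:
  assumes "orb I' (S M) A" "nrm M"
  shows "\<exists>N. orb I M N \<and> agree I' (S N) A \<and> (\<forall>a\<in>mid. N a x = p a) \<and> (\<forall>b\<in>mid. N r b = q b)"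
proof -
  obtain N1 where 1: "orb I M N1" "agree I' (S N1) A" using schur_lift[OF assms] by auto
  have f: "finite mid" using fin by auto
  obtain N2 where 2: "orb I N1 N2" "\<forall>a\<in>mid. N2 a x = p a" "agree I' (S N2) (S N1)"
    using adjust_column[OF orb_nrm[OF 1(1) assms(2)] f, of p] by blast
  have o: "orb I M N2" using orb_trans 1 2 by blast
  obtain N3 where 3: "orb I N2 N3" "\<forall>b\<in>mid. N3 r b = q b" "\<forall>a\<in>mid. N3 a x = N2 a x" "agree I' (S N3) (S N2)"
    using adjust_row[OF orb_nrm[OF o assms(2)] f, of q] by blast
  show ?thesis
    using orb_trans[OF o 3(1)] 3 2 agree_trans[OF agree_trans[OF 3(4) 2(3)] 1(2)] by auto
qed

end

section \<open>Upper bounds for orbits\<close>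

text \<open>A polynomial parametrisation of a set containing the orbit by at most m coordinates. The
  parameter point need not lie on the orbit; the elements of V merely name its coordinates.\<close>

definition UB :: "nat set \<Rightarrow> 'a::comm_ring_1 pt \<Rightarrow> nat \<Rightarrow> bool" where
  "UB I M m \<longleftrightarrow> (\<exists>V h. V \<subseteq> lowp I \<and> card V \<le> m \<and> (\<forall>i j. (i,j) \<in> lowp I \<longrightarrow> h i j \<in> pf V) \<and>
     (\<forall>N. orb I M N \<longrightarrow> (\<exists>\<theta>. \<forall>i j. (i,j) \<in> lowp I \<longrightarrow> N i j = h i j \<theta>)))"

text \<open>Besides the m parameters of the smaller orbit there are the entries of the pivot column
  and row between x and r, and one \<open>w\<close> and one \<open>sg\<close> for each index
  strictly between r and e0. At e0 the value of \<open>w\<close> is fixed and beyond it is zero, so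
  \<open>sg\<close> matters only before e0.\<close>

lemma (in pivot) UB_pivot:
  assumes M: "nrm M" and ub: "UB I' (S M) m" and z: "\<And>e. e \<in> I \<Longrightarrow> e0 < e \<Longrightarrow> r < e \<Longrightarrow> w M e = 0"
  shows "UB I M (m + 2 * card mid + 2 * card {e\<in>I. r < e \<and> e < e0})"
proof -
  let ?pst = "{e\<in>I. r < e \<and> e < e0}"
  obtain V' h' where V': "V' \<subseteq> lowp I'" "card V' \<le> m" and h': "\<And>i j. (i,j) \<in> lowp I' \<Longrightarrow> h' i j \<in> pf V'"
    and par: "\<And>N. orb I' (S M) N \<Longrightarrow> \<exists>\<theta>. \<forall>i j. (i,j) \<in> lowp I' \<longrightarrow> N i j = h' i j \<theta>"
    using ub unfolding UB_def by metis
  \<comment> \<open>The parameters \<open>sg e\<close> and \<open>w e\<close> are stored at the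
    positions (e,x) and (e,r): the first entry is zero on the orbit, the second is recovered from
    \<open>w\<close>.\<close>
  let ?V = "V' \<union> (\<lambda>d. (d,x)) ` mid \<union> (\<lambda>d. (r,d)) ` mid \<union> (\<lambda>e. (e,x)) ` ?pst \<union> (\<lambda>e. (e,r)) ` ?pst"
  let ?w = "\<lambda>i (\<theta>::'a pt). if i < e0 then \<theta> i r else if i = e0 then w M e0 else 0"
  let ?s = "\<lambda>j (\<theta>::'a pt). if j < e0 then \<theta> j x else 0"
  let ?h = "\<lambda>i j (\<theta>::'a pt).
     if j = x then (if i < r then \<theta> i x else if i = r then c else 0)
     else if i = r then \<theta> r j
     else if j = r then (?w i \<theta> - (\<Sum>d\<in>mid. h' i d \<theta> * \<theta> d x)) / c
     else h' i j \<theta> + (if i < r then \<theta> i x * \<theta> r j / c else 0) + (if r < j then ?w i \<theta> * ?s j \<theta> else 0)"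
  have sub: "?V \<subseteq> lowp I" using V'(1) x_in r_in xr by (auto simp: lowp_def)
  have "card ?V \<le> card V' + card mid + card mid + card ?pst + card ?pst"
    using fin by (intro order_trans[OF card_Un_le] add_mono card_image_le) auto
  then have cardV: "card ?V \<le> m + 2 * card mid + 2 * card ?pst" using V'(2) by simp
  have V'V: "pf V' \<subseteq> pf ?V" using pf_mono[of V' ?V] by auto
  have h: "?h i j \<in> pf ?V" if ij: "(i,j) \<in> lowp I" for i j
  proof -
    have xi: "x < i" using ij x_min[of i] x_min[of j] by (cases "i = x") (auto simp: lowp_def)
    have xj: "x < j" if "j \<noteq> x" using ij x_min[of j] that by (auto simp: lowp_def)
    have hV: "h' i d \<in> pf ?V" if "i \<noteq> r" "d \<in> I'" "d < i" for d
      using h'[of i d] that V'V ij xi by (auto simp: lowp_def)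
    have wV: "?w i \<in> pf ?V" if "r < i"
      using ij that by (auto intro!: pf_if pf.const pf.coord simp: lowp_def)
    have sV: "?s j \<in> pf ?V" if "r < j"
      using ij that by (auto intro!: pf_if pf.const pf.coord simp: lowp_def)
    show ?thesis using ij xi xj
      by (intro pf_if pf_divide pf_diff pf_sum pf.mult pf.const pf.add hV wV sV pf.coord) (auto simp: lowp_def)
  qed
  have "\<exists>\<theta>. \<forall>i j. (i,j) \<in> lowp I \<longrightarrow> N i j = ?h i j \<theta>" if o: "orb I M N" for N
  proof -
    have n: "nrm N" using orb_nrm[OF o M] .
    obtain Nt sg where Nt: "orb I' (S M) Nt" and eq: "\<And>i j. i \<in> I' \<Longrightarrow> j \<in> I' \<Longrightarrow> j < i \<Longrightarrow>
           S N i j = Nt i j + (if r < j then w N i * sg j else 0)"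
      using orb_pivot[OF o M] by metis
    obtain \<theta>' where th': "\<And>i j. (i,j) \<in> lowp I' \<Longrightarrow> Nt i j = h' i j \<theta>'" using par[OF Nt] by auto
    define \<theta> where "\<theta> i j = (if (i,j) \<in> V' then \<theta>' i j else if i = r then N r j
       else if j = r then w N i else if i < r then N i x else sg i)" for i j
    have t: "\<theta> i r = w N i" "\<theta> r j = N r j" "i < r \<Longrightarrow> \<theta> i x = N i x" "r < i \<Longrightarrow> \<theta> i x = sg i" if "i \<noteq> r" for i j
      using that V'(1) xr by (auto simp: \<theta>_def lowp_def)
    have hh: "h' i j \<theta> = Nt i j" if "(i,j) \<in> lowp I'" for i j
      using pf_cong[OF h'[OF that], of \<theta> \<theta>'] th'[OF that] by (auto simp: \<theta>_def)
    have inv: "(\<forall>e\<in>I. e0 < e \<longrightarrow> r < e \<longrightarrow> w N e = 0) \<and> (e0 \<in> I \<longrightarrow> r < e0 \<longrightarrow> w N e0 = w M e0)"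
      by (rule w_invariant[OF o M]) (use z in auto)
    have wi: "?w i \<theta> = w N i" if "i \<in> I" "r < i" for i
      using inv t(1)[of i] that by (cases i e0 rule: linorder_cases) auto
    have "N i j = ?h i j \<theta>" if ij: "(i,j) \<in> lowp I" for i j
    proof -
      have ij': "i \<in> I" "j \<in> I" "j < i" using ij by (auto simp: lowp_def)
      have xi: "x < i" using ij' x_min[of i] x_min[of j] by (cases "i = x") auto
      consider "j = x" | "j \<noteq> x" "i = r" | "j = r" | "j \<noteq> x" "i \<noteq> r" "j \<noteq> r" by blast
      then show ?thesis
      proof cases
        case 1
        then show ?thesis using t n ij' by (auto simp: nrm_def)
      next
        case 2
        then show ?thesis using V'(1) by (auto simp: \<theta>_def lowp_def)
      next
        case 3
        have "(\<Sum>d\<in>mid. h' i d \<theta> * \<theta> d x) = (\<Sum>d\<in>mid. N i d * N d x)"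
        proof (rule sum.cong[OF HOL.refl])
          fix d assume d: "d \<in> mid"
          have "h' i d \<theta> = Nt i d" using hh[of i d] d 3 ij' xi by (auto simp: lowp_def)
          also have "\<dots> = N i d" using eq[of i d] d 3 ij' xi by (auto simp: schur_def)
          finally show "h' i d \<theta> * \<theta> d x = N i d * N d x" using t(3)[of d] d by auto
        qed
        then have "?h i j \<theta> = (w N i - (\<Sum>d\<in>mid. N i d * N d x)) / c"
          using 3 ij' xr wi[of i] by simp
        then show ?thesis using w_split[OF n, of i] 3 c0 by simp
      next
        case 4
        have "h' i j \<theta> = Nt i j" using hh[of i j] 4 ij' xi by (auto simp: lowp_def)
        then have e: "S N i j = h' i j \<theta> + (if r < j then w N i * sg j else 0)" using eq[of i j] 4 ij' xi by auto
        consider "i < r" | "r < i" "j < r" | "r < j" using 4 by linarith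
        then show ?thesis
        proof cases
          case 1
          then show ?thesis using e t[of i] t(2)[of i j] 4 ij' by (simp add: schur_def diff_eq_eq)
        next
          case 2
          then show ?thesis using e 4 by (simp add: schur_def)
        next
          case 3
          have "?w i \<theta> * ?s j \<theta> = w N i * sg j"
            using inv t(4)[of j] t(1)[of i] 3 ij' by (cases i e0 rule: linorder_cases) auto
          then show ?thesis using e 4 3 ij' by (simp add: schur_def)
        qed
      qed
    qed
    then show ?thesis by blast
  qed
  then show ?thesis unfolding UB_def using sub cardV h
    by (intro exI[of _ ?V] exI[of _ ?h]) blast
qed

section \<open>Elimination of coordinates and the ideal of an orbit\<close>

definition elim :: "nat set \<Rightarrow> (nat \<times> nat) set \<Rightarrow> ('a::comm_ring_1 pt \<Rightarrow> 'a) set \<Rightarrow> bool" where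
  "elim I V J \<longleftrightarrow> V \<subseteq> lowp I \<and> (\<forall>i j. (i,j) \<in> lowp I \<longrightarrow> (\<exists>h\<in>pf V. (\<lambda>N. N i j - h N) \<in> J))"

text \<open>Since \<open>V\<close> is a set of free coordinates on the orbit of \<open>M\<close>, the elimination property forces \<open>G\<close> to
  generate the ideal of all polynomial functions vanishing on the orbit.\<close>

definition good :: "nat set \<Rightarrow> 'a::comm_ring_1 pt \<Rightarrow> ('a pt \<Rightarrow> 'a) set \<Rightarrow> (nat \<times> nat) set \<Rightarrow> bool" where
  "good I M G V \<longleftrightarrow> elim I V (idl UNIV G) \<and>
     (\<forall>\<phi>. \<exists>N. orb I M N \<and> (\<forall>i j. (i,j) \<in> V \<longrightarrow> N i j = \<phi> i j)) \<and>
     G \<subseteq> pf UNIV \<and> (\<forall>g\<in>G. \<forall>N. orb I M N \<longrightarrow> g N = 0)"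

lemma elimE:
  assumes "elim I V J"
  obtains h where "\<And>i j. (i,j) \<in> lowp I \<Longrightarrow> h i j \<in> pf V"
    and "\<And>i j. (i,j) \<in> lowp I \<Longrightarrow> (\<lambda>N. N i j - h i j N) \<in> J"
proof -
  define h where "h i j = (SOME h. h \<in> pf V \<and> (\<lambda>N. N i j - h N) \<in> J)" for i j
  have "h i j \<in> pf V \<and> (\<lambda>N. N i j - h i j N) \<in> J" if "(i,j) \<in> lowp I" for i j
  proof -
    have "\<exists>h. h \<in> pf V \<and> (\<lambda>N. N i j - h N) \<in> J" using assms that unfolding elim_def by blast
    then show ?thesis unfolding h_def by (rule someI_ex)
  qed
  then show ?thesis using that by blast
qed

lemma idl_vanishing: assumes "f \<in> idl V G" "\<And>g. g \<in> G \<Longrightarrow> g N = 0" shows "f N = 0"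
  using assms(1) by induction (simp_all add: assms(2))

lemma idl_mono: "G \<subseteq> G2 \<Longrightarrow> idl UNIV G \<subseteq> idl UNIV G2"
  by (intro idl_least pideal_idl) (auto intro: idl_base)

text \<open>Modulo G, f becomes a polynomial in the coordinates V. Any values of these occur at a
  point of the orbit, and there the normal forms h give back the point itself; hence that polynomial
  is identically zero.\<close>

lemma good_ideal:
  assumes g: "good I M G V" and f: "f \<in> pf (lowp I)" and v: "\<And>N. orb I M N \<Longrightarrow> f N = 0"
  shows "f \<in> idl UNIV G"
proof -
  have e: "elim I V (idl UNIV G)" using g unfolding good_def by blast
  then have V: "V \<subseteq> lowp I" unfolding elim_def by blast
  obtain h where h: "\<And>i j. (i,j) \<in> lowp I \<Longrightarrow> h i j \<in> pf V"
    "\<And>i j. (i,j) \<in> lowp I \<Longrightarrow> (\<lambda>N. N i j - h i j N) \<in> idl UNIV G"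
    using elimE[OF e] by blast
  have z: "f (\<lambda>i j. h i j N) = 0" for N
  proof -
    obtain K where K: "orb I M K" "\<And>i j. (i,j) \<in> V \<Longrightarrow> K i j = N i j"
    proof -
      have "\<forall>\<phi>. \<exists>K. orb I M K \<and> (\<forall>i j. (i,j) \<in> V \<longrightarrow> K i j = \<phi> i j)" using g unfolding good_def by blast
      from this[rule_format, of N] that show ?thesis by blast
    qed
    have "h i j N = K i j" if "(i,j) \<in> lowp I" for i j
    proof -
      have "h i j N = h i j K" by (rule pf_cong[OF h(1)[OF that]]) (simp add: K(2))
      moreover have "K i j - h i j K = 0"
        by (rule idl_vanishing[OF h(2)[OF that]]) (use g K(1) in \<open>auto simp: good_def\<close>)
      ultimately show ?thesis by simp
    qed
    then have "f (\<lambda>i j. h i j N) = f K" by (intro pf_cong[OF f])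
    then show ?thesis using v K by simp
  qed
  have "(\<lambda>N. f N - f (\<lambda>i j. h i j N)) \<in> idl UNIV G"
    by (rule conjunct2[OF pf_subst_cong[OF pideal_idl f]]) (use h pf_mono[OF subset_UNIV] in blast)
  then show ?thesis by (simp add: z)
qed

lemma elim_mono: "elim I V J \<Longrightarrow> J \<subseteq> J2 \<Longrightarrow> elim I V J2"
  unfolding elim_def by (meson subsetD)

lemma good_change:
  assumes "good I M G V" and "\<And>g. g \<in> G \<Longrightarrow> g \<in> idl UNIV G2" and "G2 \<subseteq> pf UNIV"
    and "\<And>g N. g \<in> G2 \<Longrightarrow> orb I M N \<Longrightarrow> g N = 0"
  shows "good I M G2 V"
proof -
  have sub: "idl UNIV G \<subseteq> idl UNIV G2" by (intro idl_least pideal_idl subsetI assms(2))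
  have "elim I V (idl UNIV G)" using assms(1) by (simp add: good_def)
  then have "elim I V (idl UNIV G2)" by (rule elim_mono[OF _ sub])
  then show ?thesis using assms(1,3,4) by (simp add: good_def)
qed

section \<open>Elimination and generators along a pivot\<close>

context pivot
begin

lemma w_raw: "w N i = N i r * N r x + (\<Sum>d\<in>mid. N i d * N d x)"
proof -
  have "{d\<in>I. x < d \<and> d \<le> r} = insert r mid" using r_in xr by auto
  then show ?thesis using fin by (simp add: w_def)
qed

lemma pf_schur: "(\<lambda>N. S N i j) \<in> pf UNIV"
  unfolding schur_def by (intro pf_diff pf_if pf_divide pf.mult pf.coord pf.const) auto

lemma pf_w: "(\<lambda>N. w N i) \<in> pf UNIV"
  unfolding w_def by (intro pf_sum pf.mult pf.coord) auto

text \<open>The entry N i r with i > r is recovered from \<open>w N i\<close>, in which its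
  coefficient is the pivot, congruent to the unit c. The entries of the smaller array come from its
  own elimination by adding back the Schur correction.\<close>

lemma elim_pivot:
  assumes e: "elim I' V' J'" and J: "pideal J" and J'J: "\<And>f. f \<in> J' \<Longrightarrow> (\<lambda>N. f (S N)) \<in> J"
    and c: "(\<lambda>N. N r x - c) \<in> J" and zc: "\<And>i. i \<in> I \<Longrightarrow> r < i \<Longrightarrow> (\<lambda>N. N i x) \<in> J"
    and wz: "\<And>i. i \<in> I \<Longrightarrow> r < i \<Longrightarrow> (\<lambda>N. w N i - z i) \<in> J"
  shows "elim I (V' \<union> (\<lambda>d. (d,x)) ` mid \<union> (\<lambda>d. (r,d)) ` mid) J"
proof -
  let ?V = "V' \<union> (\<lambda>d. (d,x)) ` mid \<union> (\<lambda>d. (r,d)) ` mid"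
  have V': "V' \<subseteq> lowp I'" and ex: "\<And>i j. (i,j) \<in> lowp I' \<Longrightarrow> \<exists>h\<in>pf V'. (\<lambda>N. N i j - h N) \<in> J'"
    using e unfolding elim_def by blast+
  have sub: "?V \<subseteq> lowp I" using V' x_in r_in xr by (auto simp: lowp_def)
  have A: "\<exists>h\<in>pf ?V. (\<lambda>N. N i j - h N) \<in> J" if ij: "(i,j) \<in> lowp I'" for i j
  proof -
    obtain h' where h': "h' \<in> pf V'" "(\<lambda>N. N i j - h' N) \<in> J'" using ex[OF ij] by auto
    have SV: "(\<lambda>N. S N k l) \<in> pf ?V" if "(k,l) \<in> V'" for k l
      using that V' x_min unfolding schur_def
      by (intro pf_diff pf_if pf_divide pf.mult pf.coord pf.const) (auto simp: lowp_def)
    let ?h = "\<lambda>N. h' (S N) + (if i < r then N i x * N r j / c else 0)"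
    have "?h \<in> pf ?V"
      by (intro pf.add pf_if pf_divide pf.mult pf_comp[OF h'(1)] SV pf.coord pf.const)
        (use ij x_min in \<open>auto simp: lowp_def\<close>)
    moreover have "(\<lambda>N. S N i j - h' (S N)) \<in> J" using J'J[OF h'(2)] .
    then have "(\<lambda>N. N i j - ?h N) \<in> J"
      unfolding schur_def by (elim back_subst[of "\<lambda>f. f \<in> J"]) (auto simp: fun_eq_iff)
    ultimately show ?thesis by (intro bexI[of _ ?h])
  qed
  have B: "\<exists>h\<in>pf ?V. (\<lambda>N. N i r - h N) \<in> J" if i: "i \<in> I" "r < i" for i
  proof -
    have "\<exists>h\<in>pf ?V. (\<lambda>N. N i d - h N) \<in> J" if "d \<in> mid" for d
      by (rule A) (use that i xr in \<open>auto simp: lowp_def\<close>)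
    then have "\<forall>d\<in>mid. \<exists>h. h \<in> pf ?V \<and> (\<lambda>N. N i d - h N) \<in> J" by blast
    from bchoice[OF this] obtain h where h: "\<And>d. d \<in> mid \<Longrightarrow> h d \<in> pf ?V \<and> (\<lambda>N. N i d - h d N) \<in> J"
      by blast
    let ?h = "\<lambda>N. (z i - (\<Sum>d\<in>mid. h d N * N d x)) / c"
    have "?h \<in> pf ?V" by (intro pf_divide pf_diff pf_sum pf.mult pf.coord pf.const) (use h in auto)
    moreover have "(\<lambda>N. N i r - ?h N) \<in> J"
    proof -
      let ?e = "\<lambda>N. \<Sum>d\<in>mid. N d x * (N i d - h d N)"
      have "?e \<in> J"
        by (rule pideal_sum[OF J], rule pideal_mult[OF J]) (use h in \<open>auto intro: pf.coord\<close>)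
      from pideal_diff[OF J pideal_diff[OF J wz[OF i] pideal_mult[OF J c pf.coord[of i r]]] this]
      have "(\<lambda>N. inverse c * (w N i - z i - N i r * (N r x - c) - ?e N)) \<in> J"
        by (intro pideal_mult[OF J] pf.const) simp_all
      moreover have "inverse c * (w N i - z i - N i r * (N r x - c) - ?e N) = N i r - ?h N" for N
      proof -
        have "?e N = (\<Sum>d\<in>mid. N i d * N d x) - (\<Sum>d\<in>mid. h d N * N d x)"
          by (simp add: sum_subtractf[symmetric] algebra_simps)
        then show ?thesis using c0 by (simp add: w_raw field_simps)
      qed
      ultimately show ?thesis by simp
    qed
    ultimately show ?thesis by (intro bexI[of _ ?h]) simp_all
  qed
  have "\<exists>h\<in>pf ?V. (\<lambda>N. N i j - h N) \<in> J" if ij: "(i,j) \<in> lowp I" for i j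
  proof -
    have ij': "i \<in> I" "j \<in> I" "j < i" using ij by (auto simp: lowp_def)
    have xi: "x < i" using ij' x_min[of i] x_min[of j] by (cases "i = x") auto
    consider "(i,j) \<in> ?V" | "j = x" "i = r" | "j = x" "r < i" | "j = r" | "(i,j) \<in> lowp I'"
    proof -
      have "(i,j) \<in> (\<lambda>d. (d,x)) ` mid" if "j = x" "i < r" using that ij' xi by auto
      moreover have "(i,j) \<in> (\<lambda>d. (r,d)) ` mid" if "j \<noteq> x" "i = r" using that ij' x_min[of j] by auto
      moreover have "(i,j) \<in> lowp I'" if "j \<noteq> x" "i \<noteq> r" "j \<noteq> r" using that ij' xi by (auto simp: lowp_def)
      ultimately show ?thesis using that by (meson UnCI linorder_neqE_nat)
    qed
    then show ?thesis
    proof cases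
      case 1 then show ?thesis
        using pf.coord[OF 1] pideal_zero[OF J] by (intro bexI[of _ "\<lambda>N. N i j"]) auto
    next
      case 2 then show ?thesis using c by (intro bexI[of _ "\<lambda>_. c"]) (auto intro: pf.const)
    next
      case 3 then show ?thesis using zc[OF ij'(1)] by (intro bexI[of _ "\<lambda>_. 0"]) (auto intro: pf.const)
    next
      case 4 then show ?thesis using B ij' by auto
    next
      case 5 then show ?thesis using A by auto
    qed
  qed
  then show ?thesis unfolding elim_def using sub by blast
qed

text \<open>The rank-one term lives at places with r < j < i and so needs two indices beyond
  r.\<close>

lemma orb_pivot_few:
  assumes "orb I M N" "nrm M" and few: "\<And>i i'. i \<in> I \<Longrightarrow> i' \<in> I \<Longrightarrow> r < i \<Longrightarrow> r < i' \<Longrightarrow> i = i'"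
  shows "orb I' (S M) (S N)" "\<And>i. i \<in> I \<Longrightarrow> r < i \<Longrightarrow> w N i = w M i"
proof -
  obtain Nt sg where Nt: "orb I' (S M) Nt" and eq: "\<And>i j. i \<in> I' \<Longrightarrow> j \<in> I' \<Longrightarrow> j < i \<Longrightarrow>
         S N i j = Nt i j + (if r < j then w N i * sg j else 0)"
    using orb_pivot[OF assms(1,2)] by metis
  have "agree I' (S N) Nt" unfolding agree_def using eq few by force
  then show "orb I' (S M) (S N)" using orb_cong[OF Nt] by simp
  fix i assume "i \<in> I" "r < i"
  then show "w N i = w M i" using w_invariant[OF assms(1,2), of i] few by blast
qed

definition "pivot_gens M G' = insert (\<lambda>N. N r x - c)
   ((\<lambda>i N. N i x) ` {i\<in>I. r < i} \<union> (\<lambda>i N. w N i - w M i) ` {i\<in>I. r < i} \<union> (\<lambda>g N. g (S N)) ` G')"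

lemma good_pivot:
  assumes M: "nrm M" and g: "good I' (S M) G' V'"
    and few: "\<And>i i'. i \<in> I \<Longrightarrow> i' \<in> I \<Longrightarrow> r < i \<Longrightarrow> r < i' \<Longrightarrow> i = i'"
  shows "good I M (pivot_gens M G') (V' \<union> (\<lambda>d. (d,x)) ` mid \<union> (\<lambda>d. (r,d)) ` mid)"
proof -
  let ?G = "pivot_gens M G'" and ?V = "V' \<union> (\<lambda>d. (d,x)) ` mid \<union> (\<lambda>d. (r,d)) ` mid"
  have V': "V' \<subseteq> lowp I'" using g unfolding good_def elim_def by blast
  have "elim I ?V (idl UNIV ?G)"
  proof (rule elim_pivot[OF _ pideal_idl])
    show "elim I' V' (idl UNIV G')" using g unfolding good_def by blast
    show "(\<lambda>N. f (S N)) \<in> idl UNIV ?G" if "f \<in> idl UNIV G'" for f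
    proof -
      have "(\<lambda>N. f (S N)) \<in> idl UNIV ((\<lambda>g N. g (S N)) ` G')"
        by (rule idl_comp[OF that]) (rule pf_schur)
      moreover have "(\<lambda>g N. g (S N)) ` G' \<subseteq> ?G" by (auto simp: pivot_gens_def)
      ultimately show ?thesis using idl_mono by blast
    qed
  qed (auto simp: pivot_gens_def intro: idl_base)
  moreover have "\<exists>N. orb I M N \<and> (\<forall>i j. (i,j) \<in> ?V \<longrightarrow> N i j = \<phi> i j)" for \<phi>
  proof -
    \<comment> \<open>The values are prescribed for N, not for its complement; the latter must have
      them corrected by the prescribed pivot column and row.\<close>
    obtain A where A: "orb I' (S M) A" "\<And>i j. (i,j) \<in> V' \<Longrightarrow> A i j = \<phi> i j - (if i < r then \<phi> i x * \<phi> r j / c else 0)"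
    proof -
      have "\<forall>\<phi>. \<exists>N. orb I' (S M) N \<and> (\<forall>i j. (i,j) \<in> V' \<longrightarrow> N i j = \<phi> i j)" using g unfolding good_def by blast
      from this[rule_format, of "\<lambda>i j. \<phi> i j - (if i < r then \<phi> i x * \<phi> r j / c else 0)"] that
      show ?thesis by blast
    qed
    obtain N where N: "orb I M N" "agree I' (S N) A" "\<forall>a\<in>mid. N a x = \<phi> a x" "\<forall>b\<in>mid. N r b = \<phi> r b"
      using orb_fill[OF A(1) M, of "\<lambda>a. \<phi> a x" "\<lambda>b. \<phi> r b"] by auto
    have "N i j = \<phi> i j" if "(i,j) \<in> V'" for i j
    proof -
      have ij: "i \<in> I'" "j \<in> I'" "j < i" using that V' by (auto simp: lowp_def)
      then have "S N i j = \<phi> i j - (if i < r then \<phi> i x * \<phi> r j / c else 0)"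
        using A(2)[OF that] N(2) by (auto simp: agree_def)
      then show ?thesis using N(3,4) ij x_min[of i] x_min[of j] by (auto simp: schur_def split: if_splits)
    qed
    then show ?thesis using N by auto
  qed
  moreover have "?G \<subseteq> pf UNIV"
  proof -
    have "(\<lambda>N. g (S N)) \<in> pf UNIV" if "g \<in> G'" for g
      by (rule pf_comp[of g UNIV]) (use g that pf_schur in \<open>auto simp: good_def\<close>)
    then show ?thesis unfolding pivot_gens_def
      by (intro insert_subsetI Un_least image_subsetI pf_diff pf_w pf.coord pf.const) auto
  qed
  moreover have "g N = 0" if "g \<in> ?G" "orb I M N" for g N
  proof -
    have n: "nrm N" using orb_nrm[OF that(2) M] .
    have w: "w N i = w M i" if "i \<in> I" "r < i" for i
      using orb_pivot_few(2)[OF \<open>orb I M N\<close> M few that] by blast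
    have "orb I' (S M) (S N)" using orb_pivot_few(1)[OF that(2) M few] by blast
    then have "h (S N) = 0" if "h \<in> G'" for h using g that unfolding good_def by blast
    then show ?thesis using \<open>g \<in> ?G\<close> n w unfolding pivot_gens_def nrm_def by fastforce
  qed
  ultimately show ?thesis unfolding good_def by blast
qed

end

section \<open>Regular dimension and generic arrays\<close>

fun reg :: "nat \<Rightarrow> nat" where
  "reg 0 = 0"
| "reg (Suc 0) = 0"
| "reg (Suc (Suc n)) = reg n + 2 * n"

text \<open>Deleting an index with zero column contributes no parameters, so it loses at least two
  dimensions when two or more indices remain.\<close>

lemma reg_Suc: "2 \<le> n \<Longrightarrow> reg n + 2 \<le> reg (Suc n)"
proof (induction n rule: reg.induct)
  case (3 n)
  then show ?case by (cases "n < 2") (auto simp: less_2_cases_iff)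
qed auto

text \<open>By \<open>qf_shift\<close> this means that P_1, ..., P_k are nonzero for k = (n - 1) div
  2. The recursion stops at two indices because for even n the last corner may vanish on a regular
  orbit.\<close>

function generic :: "nat list \<Rightarrow> 'a::field pt \<Rightarrow> bool" where
  "generic L M = (if length L \<le> 2 then True else M (last L) (hd L) \<noteq> 0 \<and>
     generic (butlast (tl L)) (schur (hd L) (last L) (M (last L) (hd L)) M))"
  by auto
termination by (relation "measure (\<lambda>(L,_). length L)") auto
declare generic.simps [simp del]

lemma generic_short: "length L \<le> 2 \<Longrightarrow> generic L M"
  by (simp add: generic.simps[of L])

lemma generic_Cons_snoc:
  "generic (x # mid @ [y]) M \<longleftrightarrow> mid = [] \<or> M y x \<noteq> 0 \<and> generic mid (schur x y (M y x) M)"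
  by (subst generic.simps) (cases mid, auto)

lemma not_generic_corner: "3 \<le> length L \<Longrightarrow> M (last L) (hd L) = 0 \<Longrightarrow> \<not> generic L M"
  by (simp add: generic.simps[of L])

lemma pivot_list:
  assumes "sorted_wrt (<) (x # mid @ r # post)" "(c::'a::field) \<noteq> 0"
  shows "pivot (set (x # mid @ r # post)) x r c"
    "set (x # mid @ r # post) - {x,r} = set (mid @ post)"
    "{d \<in> set (x # mid @ r # post). x < d \<and> d < r} = set mid"
    "{e \<in> set (x # mid @ r # post). r < e} = set post"
    "card (set mid) = length mid" "sorted_wrt (<) (mid @ post)"
  using assms by (auto simp: sorted_wrt_append pivot_def distinct_card strict_sorted_iff)

text \<open>The zero column stays zero under all moves, and a move with a = x adds only multiples of
  it.\<close>

lemma UB_zero_column: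
  assumes x: "\<And>i. i \<in> K \<Longrightarrow> x < i" and z: "\<And>i. i \<in> K \<Longrightarrow> M i x = 0" and ub: "UB K M m"
  shows "UB (insert x K) M m"
proof -
  have orb_K: "orb K M N \<and> (\<forall>i\<in>K. N i x = 0)" if "orb (insert x K) M N" for N
    using that
  proof induction
    case (refl N)
    then have "agree K N M" by (simp add: agree_def)
    moreover have "N i x = 0" if "i \<in> K" for i
      using refl z[OF that] x[OF that] that by (simp add: agree_def)
    ultimately show ?case by (auto intro: orb.refl)
  next
    case (step N a b N' t)
    have IH: "orb K M N" "\<And>i. i \<in> K \<Longrightarrow> N i x = 0" using step(6) by auto
    have "b \<noteq> x" using step(2,4) x[of a] by auto
    then have b: "b \<in> K" using step(3) by simp
    have ag: "N' i j = mv a b t N i j" if "i \<in> insert x K" "j \<in> insert x K" "j < i" for i j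
      using step(5) that by (auto simp: agree_def)
    have z': "\<forall>i\<in>K. N' i x = 0"
      using ag[of _ x] x IH(2) b \<open>b \<noteq> x\<close> by (simp add: mv_def)
    show ?case
    proof (cases "a = x")
      case True
      have "N' i j = N i j" if "i \<in> K" "j \<in> K" "j < i" for i j
        using ag[of i j] that True x[OF that(1)] IH(2)[OF that(1)] by (simp add: mv_def)
      then have "agree K N' N" by (simp add: agree_def)
      then show ?thesis using IH z' orb_cong by blast
    next
      case False
      then have "a \<in> K" using step(2) by simp
      moreover have "agree K N' (mv a b t N)" using ag by (simp add: agree_def)
      ultimately show ?thesis using orb.step[OF IH(1) _ b step(4)] z' by blast
    qed
  qed
  obtain V h where V: "V \<subseteq> lowp K" "card V \<le> m" and h: "\<And>i j. (i,j) \<in> lowp K \<Longrightarrow> h i j \<in> pf V"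
    and par: "\<And>N. orb K M N \<Longrightarrow> \<exists>\<theta>. \<forall>i j. (i,j) \<in> lowp K \<longrightarrow> N i j = h i j \<theta>"
    using ub unfolding UB_def by metis
  let ?h = "\<lambda>i j (\<theta>::'a pt). if j = x then 0 else h i j \<theta>"
  have low: "(i,j) \<in> lowp (insert x K) \<Longrightarrow> j = x \<and> i \<in> K \<or> j \<noteq> x \<and> (i,j) \<in> lowp K" for i j
    using x by (auto simp: lowp_def dest: less_asym)
  have "\<exists>\<theta>. \<forall>i j. (i,j) \<in> lowp (insert x K) \<longrightarrow> N i j = ?h i j \<theta>" if "orb (insert x K) M N" for N
    using orb_K[OF that] par[of N] low by metis
  moreover have "?h i j \<in> pf V" if "(i,j) \<in> lowp (insert x K)" for i j
    using low[OF that] h by (auto intro!: pf_if pf.const)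
  moreover have "V \<subseteq> lowp (insert x K)" using V(1) by (auto simp: lowp_def)
  ultimately show ?thesis unfolding UB_def using V(2) by (intro exI[of _ V] exI[of _ ?h]) blast
qed

text \<open>\<open>UB_pivot\<close> with e0 the last index of \<open>post\<close>. In the second
  part the last \<open>w\<close> is M y r * M r x = 0 for y the last index, so the index before it
  can serve as e0.\<close>

lemma UB_pivot_list:
  assumes L: "sorted_wrt (<) (x # mid @ r # post)" and r: "M r x \<noteq> 0" and post: "\<And>i. i \<in> set post \<Longrightarrow> M i x = 0"
    and ub: "UB (set (mid @ post)) (schur x r (M r x) M) m"
  shows "UB (set (x # mid @ r # post)) M (m + 2 * length mid + 2 * (length post - 1))"
    and "mid = [] \<Longrightarrow> 2 \<le> length post \<Longrightarrow> M (last post) r = 0 \<Longrightarrow>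
      UB (set (x # mid @ r # post)) M (m + 2 * (length post - 2))"
proof -
  note pl = pivot_list[OF L r]
  let ?I = "set (x # mid @ r # post)"
  interpret pivot ?I x r "M r x" by (rule pl(1))
  have n: "nrm M" unfolding nrm_def using pl(4) post by auto
  have d: "distinct post" and sp: "sorted_wrt (<) post" using L by (auto simp: sorted_wrt_append strict_sorted_iff)
  show "UB ?I M (m + 2 * length mid + 2 * (length post - 1))"
  proof (cases "post = []")
    case True
    have "{e\<in>?I. r < e \<and> e < 0} = {}" by auto
    then show ?thesis using UB_pivot[OF n, of m 0] ub pl True by auto
  next
    case False
    then obtain q y where q: "post = q @ [y]" by (cases post rule: rev_cases) auto
    have s: "e < y" if "e \<in> set q" for e using sp that unfolding q by (auto simp: sorted_wrt_append)
    have "{e\<in>?I. r < e \<and> e < y} = {e\<in>{e\<in>?I. r < e}. e < y}" by blast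
    also have "\<dots> = set q" using s unfolding pl(4) unfolding q by auto
    finally have "card {e\<in>?I. r < e \<and> e < y} = length q" using d q by (simp add: distinct_card)
    moreover have "w M e = 0" if "e \<in> ?I" "y < e" "r < e" for e
    proof -
      have "e \<in> set post" using that pl(4) by blast
      then have "e \<in> set q \<or> e = y" unfolding q by auto
      then show ?thesis using s[of e] that by (auto dest: less_asym)
    qed
    ultimately show ?thesis using UB_pivot[OF n _, of m y] ub pl q by simp
  qed
  assume m: "mid = []" "2 \<le> length post" "M (last post) r = 0"
  obtain q y' y where q: "post = q @ [y',y]"
  proof -
    obtain p y where p: "post = p @ [y]" using m(2) by (cases post rule: rev_cases) auto
    moreover obtain q y' where "p = q @ [y']" using m(2) p by (cases p rule: rev_cases) auto
    ultimately show ?thesis using that by simp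
  qed
  have s: "e < y'" if "e \<in> set q" for e using sp that unfolding q by (auto simp: sorted_wrt_append)
  have "y' < y" using sp unfolding q by (auto simp: sorted_wrt_append)
  have "{e\<in>?I. r < e \<and> e < y'} = {e\<in>{e\<in>?I. r < e}. e < y'}" by blast
  also have "\<dots> = set q" using s \<open>y' < y\<close> unfolding pl(4) unfolding q by auto
  finally have c: "card {e\<in>?I. r < e \<and> e < y'} = length post - 2" using d q by (simp add: distinct_card)
  have z: "w M e = 0" if "e \<in> ?I" "y' < e" "r < e" for e
  proof -
    have "e \<in> set post" using that pl(4) by blast
    then have "e \<in> set q \<or> e = y' \<or> e = y" unfolding q by auto
    then have "e = y" using s[of e] that by (auto dest: less_asym)
    moreover have "w M y = 0" unfolding w_raw pl(3) using m q by simp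
    ultimately show ?thesis by simp
  qed
  have "UB ?I M (m + 2 * card {d\<in>?I. x < d \<and> d < r} + 2 * card {e\<in>?I. r < e \<and> e < y'})"
    by (rule UB_pivot[OF n _ z]) (use ub in \<open>simp only: pl(2)\<close>)
  then show "UB ?I M (m + 2 * (length post - 2))" unfolding pl(3) c using m(1) by simp
qed

text \<open>The pivot is the last nonzero entry of the first column. If indices remain beyond it,
  the last of them contributes no parameters, a loss of two; a zero column loses two by
  \<open>reg_Suc\<close>; a corner pivot passes the question to the smaller array.\<close>

lemma UB_reg:
  assumes "sorted_wrt (<) L"
  shows "\<exists>m. UB (set L) M m \<and> m \<le> reg (length L) \<and> (\<not> generic L M \<longrightarrow> m + 2 \<le> reg (length L))"
  using assms
proof (induction "length L" arbitrary: L M rule: less_induct)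
  case less
  show ?case
  proof (cases L)
    case Nil
    have "UB {} M 0" unfolding UB_def lowp_def by (intro exI[of _ "{}"]) auto
    then show ?thesis using Nil generic_short[of L M] by (intro exI[of _ 0]) auto
  next
    case (Cons x K)
    show ?thesis
    proof (cases "\<exists>i\<in>set K. M i x \<noteq> 0")
      case False
      obtain m where m: "UB (set K) M m" "m \<le> reg (length K)"
        using less(1)[of K M] less(2) Cons by auto
      have ub: "UB (set L) M m"
        using UB_zero_column[of "set K" x M m] less(2) Cons m(1) False by auto
      show ?thesis
      proof (cases "length L \<le> 2")
        case True
        then have "reg (length K) = 0" using Cons by (cases "length K") auto
        then show ?thesis using ub m(2) generic_short[OF True] by (intro exI[of _ m]) auto
      next
        case False
        then have "m + 2 \<le> reg (length L)" using reg_Suc[of "length K"] m(2) Cons by auto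
        then show ?thesis using ub by (intro exI[of _ m]) auto
      qed
    next
      case True
      then obtain mid r post where K: "K = mid @ r # post" and r: "M r x \<noteq> 0"
        and post: "\<And>i. i \<in> set post \<Longrightarrow> M i x = 0"
        using split_list_last_prop[of K "\<lambda>i. M i x \<noteq> 0"] by blast
      have L: "L = x # mid @ r # post" using Cons K by simp
      have s: "sorted_wrt (<) (x # mid @ r # post)" using less(2) L by simp
      obtain m where m: "UB (set (mid @ post)) (schur x r (M r x) M) m" "m \<le> reg (length (mid @ post))"
        "\<not> generic (mid @ post) (schur x r (M r x) M) \<longrightarrow> m + 2 \<le> reg (length (mid @ post))"
        using less(1)[of "mid @ post"] pivot_list(6)[OF s r] L by auto
      have len: "length L = Suc (Suc (length (mid @ post)))" using L by simp
      have ub: "UB (set L) M (m + 2 * length mid + 2 * (length post - 1))"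
        using UB_pivot_list(1)[OF s r post m(1)] L by simp
      show ?thesis
      proof (cases "post = []")
        case True
        then show ?thesis using ub m len L r generic_Cons_snoc[of x mid r M] generic_short[of mid]
          by (intro exI[of _ "m + 2 * length mid"]) auto
      next
        case False
        then obtain p where "length post = Suc p" by (cases post) auto
        then have "m + 2 * length mid + 2 * (length post - 1) + 2 \<le> reg (length L)"
          using m(2) unfolding len by simp
        then show ?thesis using ub by (intro exI[of _ "m + 2 * length mid + 2 * (length post - 1)"]) auto
      qed
    qed
  qed
qed

section \<open>Orbits too small to be subregular\<close>

lemma UB_nongeneric:
  assumes "sorted_wrt (<) L" "\<not> generic L M"
  obtains m where "UB (set L) M m" "m + 2 \<le> reg (length L)"
  using UB_reg[OF assms(1), of M] assms(2) by blast

text \<open>Two losses of two dimensions add up. If column x is zero, the rest has corner M y x2 =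
  0. Otherwise y' and y both lie beyond the pivot r: if x2 comes before r, the complement has corner
  M y x2 = 0; if x2 = r, the last \<open>w\<close> vanishes. A loss of three is recorded, which is
  enough to exclude a loss of exactly two.\<close>

lemma UB_two_corners:
  fixes M :: "'a::field pt"
  assumes L: "L = x # x2 # K @ [y',y]" "sorted_wrt (<) L" and z: "M y x = 0" "M y' x = 0" "M y x2 = 0"
  shows "\<exists>m. UB (set L) M m \<and> m + 3 \<le> reg (length L)"
proof (cases "\<exists>i\<in>set (x2 # K @ [y',y]). M i x \<noteq> 0")
  case False
  have "\<not> generic (x2 # K @ [y',y]) M" by (rule not_generic_corner) (use z in auto)
  then obtain m where m: "UB (set (x2 # K @ [y',y])) M m" "m + 2 \<le> reg (length (x2 # K @ [y',y]))"
    using UB_nongeneric L by (metis sorted_wrt.simps(2))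
  have "UB (set L) M m"
    using UB_zero_column[of "set (x2 # K @ [y',y])" x M m] L m(1) False by auto
  then show ?thesis using m(2) reg_Suc[of "length (x2 # K @ [y',y])"] L by (intro exI[of _ m]) auto
next
  case True
  then obtain mid r post where K: "x2 # K @ [y',y] = mid @ r # post" and r: "M r x \<noteq> 0"
    and post: "\<And>i. i \<in> set post \<Longrightarrow> M i x = 0"
    using split_list_last_prop[of "x2 # K @ [y',y]" "\<lambda>i. M i x \<noteq> 0"] by blast
  have L': "L = x # mid @ r # post" using L K by simp
  have s: "sorted_wrt (<) (x # mid @ r # post)" using L L' by simp
  have len: "length L = Suc (Suc (length (mid @ post)))" using L' by simp
  have "\<exists>q. post = q @ [y',y]"
  proof -
    have "post \<noteq> []" using K r z by (cases post rule: rev_cases) (auto simp flip: append_Cons)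
    moreover have "butlast post \<noteq> []"
    proof
      assume "butlast post = []"
      then obtain u where "post = [u]" using \<open>post \<noteq> []\<close> by (cases post) (auto split: if_splits)
      then have "x2 # K @ [y',y] = (mid @ [r]) @ [u]" using K by simp
      then have "(x2 # K @ [y']) @ [y] = (mid @ [r]) @ [u]" by simp
      then have "x2 # K @ [y'] = mid @ [r]" by blast
      then have "(x2 # K) @ [y'] = mid @ [r]" by simp
      then show False using r z by blast
    qed
    ultimately obtain q u v where q: "post = q @ [u,v]"
      by (metis append.assoc append_Cons append_Nil append_butlast_last_id)
    have "(x2 # K) @ [y',y] = (mid @ r # q) @ [u,v]" using K q by simp
    then have "[y',y] = [u,v]" by (metis append_eq_append_conv length_Cons list.size(3))
    then show ?thesis using q by auto
  qed
  then obtain q where q: "post = q @ [y',y]" by blast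
  let ?S = "schur x r (M r x) M"
  show ?thesis
  proof (cases mid)
    case Nil
    then have r2: "r = x2" using K by simp
    obtain m where m: "UB (set (mid @ post)) ?S m" "m \<le> reg (length (mid @ post))"
      using UB_reg[OF pivot_list(6)[OF s r], of ?S] by blast
    have "UB (set L) M (m + 2 * (length post - 2))"
      using UB_pivot_list(2)[OF s r post m(1)] Nil q r2 z L' by simp
    then show ?thesis using m(2) q Nil unfolding len
      by (intro exI[of _ "m + 2 * (length post - 2)"]) auto
  next
    case (Cons u mid')
    then have "u = x2" using K by simp
    have yr: "\<not> y < r" using s q by (auto simp: sorted_wrt_append)
    have "\<not> generic (mid @ post) ?S"
      by (rule not_generic_corner) (use Cons q \<open>u = x2\<close> z yr in \<open>auto simp: schur_def\<close>)
    then obtain m where m: "UB (set (mid @ post)) ?S m" "m + 2 \<le> reg (length (mid @ post))"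
      using UB_nongeneric pivot_list(6)[OF s r] by blast
    have "UB (set L) M (m + 2 * length mid + 2 * (length post - 1))"
      using UB_pivot_list(1)[OF s r post m(1)] L' by simp
    then show ?thesis using m(2) q unfolding len
      by (intro exI[of _ "m + 2 * length mid + 2 * (length post - 1)"]) auto
  qed
qed

text \<open>The single index beyond r loses two dimensions and the nongeneric complement two
  more.\<close>

lemma UB_next_corner:
  assumes L: "L = x # mid @ [r,y]" "sorted_wrt (<) L" and r: "M r x \<noteq> 0" and z: "M y x = 0"
    and ng: "\<not> generic (mid @ [y]) (schur x r (M r x) M)"
  shows "\<exists>m. UB (set L) M m \<and> m + 3 \<le> reg (length L)"
proof -
  have s: "sorted_wrt (<) (x # mid @ r # [y])" using L by simp
  obtain m where m: "UB (set (mid @ [y])) (schur x r (M r x) M) m" "m + 2 \<le> reg (length (mid @ [y]))"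
    using UB_nongeneric[OF pivot_list(6)[OF s r] ng] by blast
  have "UB (set L) M (m + 2 * length mid + 2 * (length [y] - 1))"
    using UB_pivot_list(1)[OF s r _ m(1)] z L(1) by simp
  then show ?thesis using m(2) L(1) by (intro exI[of _ "m + 2 * length mid"]) auto
qed

text \<open>Reflection in the antidiagonal: it exchanges the first column with the last row. B is
  any bound for the indices, so that the truncated subtraction is an order-reversing
  involution.\<close>

definition tr :: "nat \<Rightarrow> 'a pt \<Rightarrow> 'a pt" where
  "tr B M i j = M (B - j) (B - i)"

lemma orb_tr:
  assumes B: "\<And>i. i \<in> I \<Longrightarrow> i \<le> B" and o: "orb I M N"
  shows "orb ((\<lambda>i. B - i) ` I) (tr B M) (tr B N)"
  using o
proof induction
  case (refl N)
  show ?case by (rule orb.refl) (use refl B in \<open>auto simp: agree_def tr_def\<close>)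
next
  case (step N a b N' t)
  have ab: "a \<le> B" "b \<le> B" using step B by auto
  show ?case
  proof (rule orb.step[OF step(6), of "B - b" "B - a" _ "- t"])
    show "agree ((\<lambda>i. B - i) ` I) (tr B N') (mv (B - b) (B - a) (- t) (tr B N))"
      unfolding agree_def
    proof (intro ballI impI)
      fix i j assume "i \<in> (\<lambda>i. B - i) ` I" "j \<in> (\<lambda>i. B - i) ` I" "j < i"
      then obtain i' j' where ij: "i = B - i'" "j = B - j'" "i' \<in> I" "j' \<in> I" by auto
      have le: "i' \<le> B" "j' \<le> B" using ij B by auto
      have "N' j' i' = mv a b t N j' i'" using step(5) ij le \<open>j < i\<close> by (auto simp: agree_def)
      moreover have "i = B - b \<longleftrightarrow> i' = b" "j = B - a \<longleftrightarrow> j' = a" using ij le ab by auto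
      ultimately show "tr B N' i j = mv (B - b) (B - a) (- t) (tr B N) i j"
        using ij le ab by (auto simp: tr_def mv_def)
    qed
  qed (use step ab in auto)
qed

lemma UB_tr:
  assumes B: "\<And>i. i \<in> I \<Longrightarrow> i \<le> B" and ub: "UB ((\<lambda>i. B - i) ` I) (tr B M) m"
  shows "UB I M m"
proof -
  let ?I = "(\<lambda>i. B - i) ` I" and ?t = "\<lambda>(i,j). (B - j, B - i)"
  obtain V h where V: "V \<subseteq> lowp ?I" "card V \<le> m" and h: "\<And>i j. (i,j) \<in> lowp ?I \<Longrightarrow> h i j \<in> pf V"
    and par: "\<And>N. orb ?I (tr B M) N \<Longrightarrow> \<exists>\<theta>. \<forall>i j. (i,j) \<in> lowp ?I \<longrightarrow> N i j = h i j \<theta>"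
    using ub unfolding UB_def by metis
  let ?h = "\<lambda>i j \<theta>. h (B - j) (B - i) (tr B \<theta>)"
  have low: "(B - j, B - i) \<in> lowp ?I" if "(i,j) \<in> lowp I" for i j
    using that B by (fastforce simp: lowp_def)
  have inv: "\<exists>i' j'. (i',j') \<in> lowp I \<and> i = B - j' \<and> j = B - i'" if "(i,j) \<in> lowp ?I" for i j
  proof -
    have "i \<in> ?I" "j \<in> ?I" "j < i" using that by (simp_all add: lowp_def)
    then obtain i' j' where e: "i = B - i'" "j = B - j'" "i' \<in> I" "j' \<in> I" "j < i" by (elim imageE)
    then have "(j',i') \<in> lowp I" using B[of i'] B[of j'] by (auto simp: lowp_def)
    then show ?thesis using e by blast
  qed
  have "finite V \<or> card V = 0" by (cases "finite V") auto
  have sub: "?t ` V \<subseteq> lowp I"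
  proof (clarify)
    fix i j assume "(i,j) \<in> V"
    then obtain i' j' where e: "(i',j') \<in> lowp I" "i = B - j'" "j = B - i'" using V(1) inv by blast
    then have "i' \<le> B" "j' \<le> B" using B by (auto simp: lowp_def)
    then show "(B - j, B - i) \<in> lowp I" using e by simp
  qed
  have le: "i \<le> B" "j \<le> B" if "(i,j) \<in> V" for i j
    using subsetD[OF V(1) that] by (auto simp: lowp_def)
  have fin: "card (?t ` V) \<le> m"
  proof (cases "finite V")
    case True then show ?thesis using card_image_le[of V ?t] V(2) by simp
  next
    \<comment> \<open>V is not assumed finite: an infinite V has \<open>card V = 0\<close>, and
      injectivity keeps its image infinite.\<close>
    case False
    have "inj_on ?t V" by (rule inj_on_inverseI[of _ ?t]) (auto dest: le)
    then have "infinite (?t ` V)" using False finite_imageD by blast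
    then show ?thesis by simp
  qed
  have "?h i j \<in> pf (?t ` V)" if "(i,j) \<in> lowp I" for i j
    by (rule pf_comp[OF h[OF low[OF that]]]) (force simp: tr_def intro: pf.coord)
  moreover have "\<exists>\<theta>. \<forall>i j. (i,j) \<in> lowp I \<longrightarrow> N i j = ?h i j \<theta>" if o: "orb I M N" for N
  proof -
    obtain \<theta> where th: "\<And>i j. (i,j) \<in> lowp ?I \<Longrightarrow> tr B N i j = h i j \<theta>"
      using par[OF orb_tr[OF B o]] by blast
    have "N i j = ?h i j (tr B \<theta>)" if ij: "(i,j) \<in> lowp I" for i j
    proof -
      have "N i j = tr B N (B - j) (B - i)" using ij B by (auto simp: tr_def lowp_def)
      also have "\<dots> = h (B - j) (B - i) \<theta>" using th[OF low[OF ij]] .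
      also have "\<dots> = ?h i j (tr B \<theta>)"
        by (rule pf_cong[OF h[OF low[OF ij]]]) (use le in \<open>simp add: tr_def\<close>)
      finally show ?thesis .
    qed
    then show ?thesis by blast
  qed
  ultimately show ?thesis unfolding UB_def using sub fin
    by (intro exI[of _ "?t ` V"] exI[of _ ?h]) blast
qed

text \<open>The first column alone does not show the loss, as its last nonzero entry may be far from
  the corner. After reflection the entry (y,x2) becomes the pivot next to the corner, and the corner
  of the resulting complement is M y' x = 0. Nonempty K leaves at least three indices, so that a
  zero corner does contradict genericity.\<close>

lemma UB_next_corner_row:
  fixes M :: "'a::field pt"
  assumes L: "L = x # x2 # K @ [y',y]" "sorted_wrt (<) L" "K \<noteq> []"
    and z: "M y x = 0" "M y' x = 0" and r: "M y x2 \<noteq> 0"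
  shows "\<exists>m. UB (set L) M m \<and> m + 3 \<le> reg (length L)"
proof -
  let ?L = "map (\<lambda>i. y - i) (rev L)" and ?M = "tr y M" and ?mid = "map (\<lambda>i. y - i) (y' # rev K)"
  have le: "i \<le> y" if "i \<in> set L" for i using L(1,2) that by (auto simp: sorted_wrt_append less_imp_le)
  have eq: "?L = (y - y) # ?mid @ [y - x2, y - x]" using L(1) by simp
  have "sorted_wrt (\<lambda>i j. y - i < y - j) (rev L)"
    unfolding sorted_wrt_rev by (rule sorted_wrt_mono_rel[OF _ L(2)]) (use le in \<open>auto simp: diff_less_mono2 intro: diff_less_mono2 order_less_le_trans\<close>)
  then have s: "sorted_wrt (<) ?L" by (simp add: sorted_wrt_map)
  have yx: "x \<le> y" "x2 \<le> y" "y' \<le> y" using le L(1) by auto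
  have "\<not> generic (?mid @ [y - x]) (schur (y - y) (y - x2) (?M (y - x2) (y - y)) ?M)"
  proof (rule not_generic_corner)
    show "3 \<le> length (?mid @ [y - x])" using L(3) by (cases K) auto
    have "\<not> y - x < y - x2" using L(1,2) by auto
    then show "schur (y - y) (y - x2) (?M (y - x2) (y - y)) ?M (last (?mid @ [y - x])) (hd (?mid @ [y - x])) = 0"
      using z yx by (simp add: schur_def tr_def)
  qed
  then obtain m where "UB (set ?L) ?M m" "m + 3 \<le> reg (length ?L)"
    using UB_next_corner[OF eq s, of ?M] r z yx by (auto simp: tr_def)
  then show ?thesis using UB_tr[of "set L" y M m] le by (intro exI[of _ m]) auto
qed

section \<open>Minors\<close>

definition mnr :: "(nat \<Rightarrow> nat \<Rightarrow> 'b::comm_ring_1) \<Rightarrow> nat list \<Rightarrow> nat list \<Rightarrow> 'b" where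
  "mnr N rs cs = det (mat (length rs) (length rs) (\<lambda>(a,b). N (rs ! a) (cs ! b)))"

lemma mnr_Nil [simp]: "mnr N [] [] = 1" by (simp add: mnr_def)

text \<open>The matrix is a unipotent matrix times one whose column x has the single entry N r x,
  along which the determinant is expanded. The multipliers u replace quotients, so the lemma holds
  over any commutative ring and covers matrices of polynomials.\<close>

lemma mnr_pivot:
  fixes N S :: "nat \<Rightarrow> nat \<Rightarrow> 'b::comm_ring_1"
  assumes len: "length cs = length rs1 + length rs2"
    and u: "\<And>i j. i \<in> set rs1 \<Longrightarrow> j \<in> set cs \<Longrightarrow> N i j = S i j + u i * N r j"
    and ux: "\<And>i. i \<in> set rs1 \<Longrightarrow> N i x = u i * N r x"
    and l: "\<And>i j. i \<in> set rs2 \<Longrightarrow> j \<in> set cs \<Longrightarrow> N i j = S i j"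
    and lx: "\<And>i. i \<in> set rs2 \<Longrightarrow> N i x = 0"
  shows "mnr N (rs1 @ r # rs2) (x # cs) = (-1) ^ length rs1 * N r x * mnr S (rs1 @ rs2) cs"
proof -
  let ?p = "length rs1" and ?m = "Suc (length rs1 + length rs2)" and ?rs = "rs1 @ r # rs2"
  let ?A = "mat ?m ?m (\<lambda>(a,b). N (?rs ! a) ((x # cs) ! b))"
  let ?U = "mat ?m ?m (\<lambda>(a,b). if a = b then 1 else if b = ?p \<and> a < ?p then u (rs1 ! a) else 0)"
  let ?B = "mat ?m ?m (\<lambda>(a,b). if a = ?p then N r ((x # cs) ! b) else if b = 0 then 0 else S (?rs ! a) (cs ! (b - 1)))"
  have UB: "?A = ?U * ?B"
  proof (rule eq_matI)
    fix a b assume "a < dim_row (?U * ?B)" "b < dim_col (?U * ?B)"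
    then have ab: "a < ?m" "b < ?m" by auto
    have two: "(\<Sum>k<?m. (if k = a then v else 0) + (if k = ?p then v' else 0)) = v + v'" for v v' :: 'b
    proof -
      have "a \<in> {..<?m}" "?p \<in> {..<?m}" using ab by auto
      then show ?thesis by (simp only: sum.distrib sum.delta finite_lessThan if_True)
    qed
    have "(?U * ?B) $$ (a,b) = (\<Sum>k<?m. ?U $$ (a,k) * ?B $$ (k,b))"
      using ab by (simp add: scalar_prod_def atLeast0LessThan)
    also have "\<dots> = (\<Sum>k<?m. (if k = a then ?B $$ (a,b) else 0) +
        (if k = ?p then (if a < ?p then u (rs1 ! a) * ?B $$ (?p,b) else 0) else 0))"
      by (rule sum.cong) (use ab in auto)
    also have "\<dots> = ?B $$ (a,b) + (if a < ?p then u (rs1 ! a) * ?B $$ (?p,b) else 0)"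
      by (rule two)
    also have "\<dots> = ?A $$ (a,b)"
    proof (cases a ?p rule: linorder_cases)
      case less
      then have "rs1 ! a \<in> set rs1" by simp
      moreover have "b \<noteq> 0 \<Longrightarrow> cs ! (b - 1) \<in> set cs" using ab len by simp
      ultimately show ?thesis using less ab u ux by (cases b) (auto simp: nth_append)
    next
      case equal
      then show ?thesis using ab by auto
    next
      case greater
      then obtain d where d: "a = Suc (?p + d)" by (metis less_iff_Suc_add)
      then have rd: "rs2 ! d \<in> set rs2" "?rs ! a = rs2 ! d" using ab by (auto simp: nth_append)
      moreover have "b \<noteq> 0 \<Longrightarrow> cs ! (b - 1) \<in> set cs" using ab len by simp
      ultimately show ?thesis using greater ab l lx by (cases b) auto
    qed
    finally show "?A $$ (a,b) = (?U * ?B) $$ (a,b)" ..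
  qed auto
  have "det ?U = prod_list (diag_mat ?U)"
    by (rule det_upper_triangular[of _ ?m]) (auto simp: upper_triangular_def)
  also have "diag_mat ?U = replicate ?m 1" by (rule nth_equalityI) (auto simp: diag_mat_def simp del: upt_Suc replicate_Suc)
  finally have detU: "det ?U = 1" by (simp add: prod_list_replicate)
  have "det ?A = det ?B" unfolding UB by (subst det_mult[of _ ?m]) (use detU in auto)
  also have "\<dots> = (\<Sum>i<?m. ?B $$ (i,0) * cofactor ?B i 0)"
    by (rule laplace_expansion_column[of _ ?m]) auto
  also have "\<dots> = (\<Sum>i<?m. if i = ?p then N r x * cofactor ?B ?p 0 else 0)"
    by (rule sum.cong) auto
  also have "\<dots> = N r x * cofactor ?B ?p 0" by (simp add: sum.delta)
  also have "mat_delete ?B ?p 0 = mat (length (rs1 @ rs2)) (length (rs1 @ rs2)) (\<lambda>(a,b). S ((rs1 @ rs2) ! a) (cs ! b))"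
    by (rule eq_matI) (auto simp: mat_delete_def nth_append Suc_diff_le)
  then have "cofactor ?B ?p 0 = (-1) ^ ?p * mnr S (rs1 @ rs2) cs" by (simp add: cofactor_def mnr_def)
  finally show ?thesis by (simp add: mnr_def ac_simps)
qed

lemma mnr_single: "mnr N [r] [x] = N r x"
  using mnr_pivot[of "[]" "[]" "[]" N N _ r x] by simp

lemma mnr_expand:
  assumes "length cs = length rs"
  shows "mnr N rs cs = (\<Sum>p\<in>{p. p permutes {0..<length rs}}. signof p * (\<Prod>i\<in>{0..<length rs}. N (rs ! i) (cs ! p i)))"
proof -
  have "(\<Prod>i\<in>{0..<length rs}. mat (length rs) (length rs) (\<lambda>(a,b). N (rs ! a) (cs ! b)) $$ (i, p i))
    = (\<Prod>i\<in>{0..<length rs}. N (rs ! i) (cs ! p i))" if "p permutes {0..<length rs}" for p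
    by (rule prod.cong) (use permutes_in_image[OF that] in auto)
  then show ?thesis
    unfolding mnr_def by (subst det_def'[of _ "length rs"]) auto
qed

lemma mnr_pf: "length cs = length rs \<Longrightarrow> (\<lambda>N. mnr N rs cs) \<in> pf UNIV"
  unfolding mnr_expand by (intro pf_sum pf.mult pf_prod pf.const pf.coord) auto

section \<open>Coefficients of minors of the characteristic matrix\<close>

definition charm :: "'a::comm_ring_1 pt \<Rightarrow> nat \<Rightarrow> nat \<Rightarrow> 'a poly" where
  "charm N i j = [:if i = j then 1 else 0, N i j:]"

lemma coeff_sum_pf:
  "(\<And>a k. a \<in> A \<Longrightarrow> (\<lambda>N. coeff (F a N) k) \<in> pf UNIV) \<Longrightarrow> (\<lambda>N. coeff (\<Sum>a\<in>A. F a N) k) \<in> pf UNIV"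
  by (simp add: coeff_sum pf_sum)

lemma coeff_mult_pf:
  "(\<And>k. (\<lambda>N. coeff (F N) k) \<in> pf UNIV) \<Longrightarrow> (\<And>k. (\<lambda>N. coeff (G N) k) \<in> pf UNIV) \<Longrightarrow>
    (\<lambda>N. coeff (F N * G N) k) \<in> pf UNIV"
  unfolding coeff_mult by (intro pf_sum pf.mult)

lemma coeff_prod_pf:
  "(\<And>a k. a \<in> A \<Longrightarrow> (\<lambda>N. coeff (F a N) k) \<in> pf UNIV) \<Longrightarrow> (\<lambda>N. coeff (\<Prod>a\<in>A. F a N) k) \<in> pf UNIV"
  by (induction A arbitrary: k rule: infinite_finite_induct) (auto intro: coeff_mult_pf pf.const)

lemma coeff_charm_pf: "(\<lambda>N. coeff (charm N i j) k) \<in> pf UNIV"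
  by (cases k; cases "k - 1") (auto simp: charm_def intro: pf.const pf.coord)

lemma coeff_mnr_pf: "length cs = length rs \<Longrightarrow> (\<lambda>N. coeff (mnr (charm N) rs cs) k) \<in> pf UNIV"
  unfolding mnr_expand by (intro coeff_sum_pf coeff_mult_pf coeff_prod_pf coeff_charm_pf pf.const)

text \<open>The elements \<open>P, P', P'', Z\<close> and \<open>P'\<close> with the middle index (for even \<open>n\<close>), for an arbitrary
  increasing list of indices in place of \<open>1, \<dots>, n\<close>, as the induction removes indices.\<close>

datatype lab = LP nat | LP1 nat | LP2 nat | LZ nat | LM

fun qf :: "nat list \<Rightarrow> lab \<Rightarrow> 'a::comm_ring_1 pt \<Rightarrow> 'a" where
  "qf L (LP j) N = mnr N (drop (length L - j) L) (take j L)"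
| "qf L (LP1 j) N = mnr N (L ! (length L - j - 1) # drop (length L - j + 1) L) (take j L)"
| "qf L (LP2 j) N = mnr N (drop (length L - j) L) (take (j - 1) L @ [L ! j])"
| "qf L (LZ k) N = coeff (mnr (charm N) (drop k L) (take (length L - k) L)) (k + 1)"
| "qf L LM N = mnr N (L ! (length L div 2 - 1) # drop (length L div 2 + 2) L) (take (length L div 2 - 1) L)"

fun shift :: "lab \<Rightarrow> lab" where
  "shift (LP j) = LP (Suc j)" | "shift (LP1 j) = LP1 (Suc j)" | "shift (LP2 j) = LP2 (Suc j)"
| "shift (LZ j) = LZ (Suc j)" | "shift LM = LM"

fun valid :: "nat \<Rightarrow> lab \<Rightarrow> bool" where
  "valid m (LP j) \<longleftrightarrow> 1 \<le> j \<and> j \<le> m"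
| "valid m (LP1 j) \<longleftrightarrow> 1 \<le> j \<and> j < m"
| "valid m (LP2 j) \<longleftrightarrow> 1 \<le> j \<and> j < m"
| "valid m (LZ j) \<longleftrightarrow> 1 \<le> j \<and> j \<le> m"
| "valid m LM \<longleftrightarrow> 4 \<le> m \<and> even m"

fun minor_size :: "nat \<Rightarrow> lab \<Rightarrow> nat" where
  "minor_size m (LP j) = j" | "minor_size m (LP1 j) = j" | "minor_size m (LP2 j) = j"
| "minor_size m (LZ j) = m - j" | "minor_size m LM = m div 2 - 1"

lemma qf_pf: "valid (length L) t \<Longrightarrow> qf L t \<in> pf UNIV"
proof -
  assume v: "valid (length L) t"
  have "qf L t = (\<lambda>N. qf L t N)" by simp
  also have "\<dots> \<in> pf UNIV" using v
    by (cases t) (auto intro!: mnr_pf coeff_mnr_pf[where k = "Suc _", simplified])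
  finally show ?thesis .
qed

section \<open>Minors under pivoting\<close>

lemma mnr_schur:
  assumes "length cs = length rs" "N y x = c" "c \<noteq> 0" "\<And>i. i \<in> set rs \<Longrightarrow> i < y"
  shows "mnr N (rs @ [y]) (x # cs) = (-1) ^ length rs * c * mnr (schur x y c N) rs cs"
  using mnr_pivot[of cs rs "[]" N "schur x y c N" "\<lambda>i. N i x / c" y x] assms
  by (simp add: schur_def)

text \<open>Since x is not among the remaining rows and y not among the columns, the pivot row and
  column of E + tau N have no constant terms. The multipliers N i x / c are therefore free of tau
  and the same as for N.\<close>

lemma mnr_charm_schur:
  assumes "length cs = length rs" "N y x = c" "c \<noteq> 0" "\<And>i. i \<in> set rs \<Longrightarrow> i < y \<and> i \<noteq> x"
    "y \<noteq> x" "y \<notin> set cs"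
  shows "mnr (charm N) (rs @ [y]) (x # cs) = (-1) ^ length rs * [:0, c:] * mnr (charm (schur x y c N)) rs cs"
proof -
  have "mnr (charm N) (rs @ [y]) (x # cs) = (-1) ^ length rs * charm N y x * mnr (charm (schur x y c N)) (rs @ []) cs"
    by (rule mnr_pivot[of _ _ _ _ _ "\<lambda>i. [:N i x / c:]"])
      (use assms in \<open>auto simp: charm_def schur_def\<close>)
  then show ?thesis using assms by (simp add: charm_def)
qed

text \<open>Every minor in question contains the last row and the first column, so the corner can be
  pivoted away. For Z the corner entry is c tau, which accounts for the exponent k + 1 growing along
  with k.\<close>

lemma qf_shift:
  assumes L: "L = x # mid @ [y]" "sorted_wrt (<) L" and v: "valid (length mid) t" and c: "N y x = c" "c \<noteq> 0"
  shows "qf L (shift t) N = (-1) ^ minor_size (length mid) t * c * qf mid t (schur x y c N)"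
proof -
  let ?m = "length mid"
  have s: "i < y \<and> i \<noteq> x" if "i \<in> set mid" for i using L that by (auto simp: sorted_wrt_append)
  have yx: "y \<noteq> x" "y \<notin> set mid" using L by (auto simp: sorted_wrt_append)
  have n: "length L = Suc (Suc ?m)" using L by simp
  have ms: "mnr N (rs @ [y]) (x # cs) = (-1) ^ length rs * c * mnr (schur x y c N) rs cs"
    if "length cs = length rs" "set rs \<subseteq> set mid" for rs cs
    using mnr_schur[of cs rs N y x c] c s that by blast
  note d = set_drop_subset[of _ mid]
  show ?thesis
  proof (cases t)
    case (LP j)
    have j: "1 \<le> j" "j \<le> ?m" using v LP by auto
    have "drop (length L - Suc j) L = drop (?m - j) mid @ [y]" "take (Suc j) L = x # take j mid"
      using L j by (auto simp: Suc_diff_le)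
    then show ?thesis using LP j ms[of "take j mid" "drop (?m - j) mid"] d by auto
  next
    case (LP1 j)
    have j: "1 \<le> j" "j < ?m" using v LP1 by auto
    have "L ! (length L - Suc j - 1) = mid ! (?m - j - 1)"
    proof -
      have "length L - Suc j - 1 = Suc (?m - j - 1)" using n j by simp
      moreover have "?m - j - 1 < ?m" using j by simp
      ultimately show ?thesis using L by (simp add: nth_append)
    qed
    moreover have "drop (length L - Suc j + 1) L = drop (?m - j + 1) mid @ [y]" "take (Suc j) L = x # take j mid"
      using L j by (auto simp: Suc_diff_le)
    moreover have "mid ! (?m - j - 1) \<in> set mid" using j by auto
    ultimately show ?thesis
      using LP1 j ms[of "take j mid" "mid ! (?m - j - 1) # drop (?m - j + 1) mid"] d[of "?m - j + 1"]
      by (simp add: Suc_diff_Suc)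
  next
    case (LP2 j)
    have j: "1 \<le> j" "j < ?m" using v LP2 by auto
    have "drop (length L - Suc j) L = drop (?m - j) mid @ [y]"
      "take (Suc j - 1) L @ [L ! Suc j] = x # take (j - 1) mid @ [mid ! j]"
      using L j by (auto simp: Suc_diff_le nth_append take_Cons' )
    then show ?thesis using LP2 j ms[of "take (j - 1) mid @ [mid ! j]" "drop (?m - j) mid"] d by auto
  next
    case (LZ k)
    have k: "1 \<le> k" "k \<le> ?m" using v LZ by auto
    have "drop (Suc k) L = drop k mid @ [y]" "take (length L - Suc k) L = x # take (?m - k) mid"
      using L k by (auto simp: Suc_diff_le)
    moreover have "mnr (charm N) (drop k mid @ [y]) (x # take (?m - k) mid)
        = (-1) ^ (?m - k) * [:0, c:] * mnr (charm (schur x y c N)) (drop k mid) (take (?m - k) mid)"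
      using mnr_charm_schur[of "take (?m - k) mid" "drop k mid" N y x c] c s d yx by (auto dest: in_set_takeD)
    moreover have "coeff ((-1) ^ p * [:0, c:] * q) (Suc (Suc i)) = (-1) ^ p * c * coeff q (Suc i)" for p i and q :: "'a poly"
      by (cases "even p") auto
    ultimately show ?thesis using LZ by simp
  next
    case LM
    have m: "4 \<le> ?m" "even ?m" using v LM by auto
    obtain h where h: "?m = 2 * h" using m by auto
    have h2: "2 \<le> h" using h m by simp
    have e1: "L ! (length L div 2 - 1) = mid ! (?m div 2 - 1)"
      using L h h2 by (simp add: nth_append nth_Cons split: nat.splits)
    have e2: "drop (length L div 2 + 2) L = drop (?m div 2 + 2) mid @ [y]"
      "take (length L div 2 - 1) L = x # take (?m div 2 - 1) mid"
      using L h h2 by (auto simp: take_Cons')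
    have "mid ! (?m div 2 - 1) \<in> set mid" using h h2 by simp
    moreover have "length mid - (?m div 2 + 2) + 1 = ?m div 2 - 1" using h h2 by simp
    ultimately show ?thesis unfolding LM shift.simps qf.simps e1 e2
      using h h2 ms[of "take (?m div 2 - 1) mid" "mid ! (?m div 2 - 1) # drop (?m div 2 + 2) mid"] d[of "?m div 2 + 2"]
      by (simp del: nth_mem)
  qed
qed

lemma qf_corner: "L = x # mid @ [y] \<Longrightarrow> qf L (LP 1) N = N y x"
  by (simp add: mnr_single)

text \<open>The pivot (r,x) sits in the last row but one, below i - 1 others, whence the sign; row y
  has a zero in column x and passes unchanged to the complement.\<close>

lemma qf_next:
  assumes L: "L = x # mid @ [r,y]" "sorted_wrt (<) L" and i: "1 \<le> i" "i \<le> length mid"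
    and c: "N r x = c" "c \<noteq> 0" "N y x = 0"
  shows "qf L (LP (Suc i)) N = (-1) ^ (i - 1) * c * qf (mid @ [y]) (LP i) (schur x r c N)"
proof -
  let ?m = "length mid" and ?S = "schur x r c N"
  have s: "j < r" if "j \<in> set mid" for j using L that by (auto simp: sorted_wrt_append)
  have ry: "\<not> y < r" using L by (auto simp: sorted_wrt_append)
  have e: "drop (length L - Suc i) L = drop (Suc ?m - i) mid @ r # [y]" "take (Suc i) L = x # take i mid"
    "drop (length (mid @ [y]) - i) (mid @ [y]) = drop (Suc ?m - i) mid @ [y]" "take i (mid @ [y]) = take i mid"
    using L i by (auto simp: Suc_diff_le)
  have "mnr N (drop (Suc ?m - i) mid @ r # [y]) (x # take i mid)
     = (-1) ^ length (drop (Suc ?m - i) mid) * N r x * mnr ?S (drop (Suc ?m - i) mid @ [y]) (take i mid)"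
    by (rule mnr_pivot[of _ _ _ _ _ "\<lambda>i. N i x / c"])
      (use i c s ry in \<open>auto simp: schur_def dest!: in_set_dropD\<close>)
  then show ?thesis unfolding qf.simps e using i c by (simp add: Suc_diff_le)
qed

lemma sum_nth: "distinct L \<Longrightarrow> (\<Sum>k<length L. f (L ! k)) = (\<Sum>d\<in>set L. f d)"
  by (rule sum.reindex_bij_betw[OF bij_betw_nth]) auto

lemma coeff_0_det_charm:
  assumes "distinct L" shows "coeff (mnr (charm N) L L) 0 = 1"
proof -
  have "coeff (mnr (charm N) L L) 0 = poly (mnr (charm N) L L) 0" by (simp add: poly_0_coeff_0)
  also have "\<dots> = mnr (\<lambda>i j. if i = j then 1 else 0) L L"
    unfolding mnr_expand[OF HOL.refl] by (simp add: poly_sum poly_prod charm_def)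
  also have "\<dots> = det (1\<^sub>m (length L))"
    unfolding mnr_def by (rule arg_cong[of _ _ det], rule eq_matI) (use assms in \<open>auto simp: nth_eq_iff_index_eq\<close>)
  finally show ?thesis by simp
qed

text \<open>Comparing coefficients in \<open>adj (E + \<tau>N) (E + \<tau>N) = det (E + \<tau>N) E\<close> shows that the
  coefficient of \<open>\<tau>\<^sup>2\<close> in the corner of the adjugate is that of \<open>N\<^sup>2\<close>.\<close>

lemma qf_LZ_1:
  assumes L: "L = x # mid @ [y]" "distinct L" and z: "N y x = 0"
  shows "qf L (LZ 1) N = (-1) ^ (length L - 1) * (\<Sum>d\<in>set mid. N y d * N d x)"
proof -
  let ?n = "length L" and ?l = "Suc (length mid)"
  let ?B = "mat ?n ?n (\<lambda>(a,b). charm N (L ! a) (L ! b))"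
  have B: "?B \<in> carrier_mat ?n ?n" by simp
  define D where "D = mnr (charm N) L L"
  define Q where "Q i j = adj_mat ?B $$ (i,j)" for i j
  have nl: "?n = Suc ?l" using L by simp
  have Leq: "L ! a = L ! b \<longleftrightarrow> a = b" if "a < ?n" "b < ?n" for a b
    using L(2) that by (simp add: nth_eq_iff_index_eq)
  have E: "Q i j + (\<Sum>k<?n. Q i k * [:0, N (L ! k) (L ! j):]) = (if i = j then D else 0)" if ij: "i < ?n" "j < ?n" for i j
  proof -
    have "(adj_mat ?B * ?B) $$ (i,j) = (det ?B \<cdot>\<^sub>m 1\<^sub>m ?n) $$ (i,j)" using adj_mat(3)[OF B] by simp
    also have "\<dots> = (if i = j then D else 0)" using ij by (simp add: D_def mnr_def)
    also have "(adj_mat ?B * ?B) $$ (i,j) = (\<Sum>k<?n. Q i k * charm N (L ! k) (L ! j))"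
      using ij adj_mat(1)[OF B] by (simp add: scalar_prod_def Q_def atLeast0LessThan)
    also have "\<dots> = (\<Sum>k<?n. (if k = j then Q i j else 0) + Q i k * [:0, N (L ! k) (L ! j):])"
    proof (rule sum.cong[OF HOL.refl])
      fix k assume "k \<in> {..<?n}"
      then have "charm N (L ! k) (L ! j) = [:if k = j then 1 else 0:] + [:0, N (L ! k) (L ! j):]"
        using Leq[of k j] ij by (simp add: charm_def)
      then show "Q i k * charm N (L ! k) (L ! j) = (if k = j then Q i j else 0) + Q i k * [:0, N (L ! k) (L ! j):]"
        by (simp only: distrib_left) simp
    qed
    also have "\<dots> = Q i j + (\<Sum>k<?n. Q i k * [:0, N (L ! k) (L ! j):])"
      using ij by (simp add: sum.distrib)
    finally show ?thesis .
  qed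
  \<comment> \<open>With Q the adjugate and D the determinant of E + tau N, the coefficients satisfy
    Q_0 = E, Q_1 = D_1 E - N and Q_2 = D_2 E - Q_1 N.\<close>
  have c0: "coeff (Q i j) 0 = (if i = j then 1 else 0)" if "i < ?n" "j < ?n" for i j
    using arg_cong[OF E[OF that], of "\<lambda>p. coeff p 0"] coeff_0_det_charm[OF L(2), of N] unfolding D_def[symmetric]
    by (simp add: coeff_sum coeff_mult split: if_splits)
  have cS: "coeff (Q i j) (Suc m) = (if i = j then coeff D (Suc m) else 0) - (\<Sum>k<?n. coeff (Q i k) m * N (L ! k) (L ! j))"
    if "i < ?n" "j < ?n" for i j m
  proof -
    have "coeff (p * [:0, a:]) (Suc m) = coeff p m * a" for p :: "'a poly" and a
      by (simp add: mult.commute[of p])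
    then have "coeff (Q i j) (Suc m) + (\<Sum>k<?n. coeff (Q i k) m * N (L ! k) (L ! j)) = (if i = j then coeff D (Suc m) else 0)"
      using arg_cong[OF E[OF that], of "\<lambda>p. coeff p (Suc m)"] by (simp add: coeff_sum mult.commute[of "N _ _"] split: if_splits)
    then show ?thesis by (simp add: eq_diff_eq)
  qed
  have Ly: "L ! ?l = y" "L ! 0 = x" using L by (auto simp: nth_append)
  have c1: "coeff (Q ?l k) 1 = (if k = ?l then coeff D 1 else 0) - N y (L ! k)" if "k < ?n" for k
  proof -
    have "(\<Sum>i<?n. coeff (Q ?l i) 0 * N (L ! i) (L ! k)) = (\<Sum>i<?n. if i = ?l then N y (L ! k) else 0)"
      by (rule sum.cong) (use c0 nl Ly in auto)
    then show ?thesis using cS[of ?l k 0] that nl by auto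
  qed
  have "coeff (Q ?l 0) 2 = - (\<Sum>k<?n. coeff (Q ?l k) 1 * N (L ! k) x)"
    using cS[of ?l 0 1] nl Ly by (simp add: numeral_2_eq_2)
  \<comment> \<open>The coefficient D_1 enters only at k = \<open>?l\<close>, with the factor N y x
    = 0. The same factor later removes the terms d = x and d = y, so nothing is assumed about
    entries on or above the diagonal.\<close>
  also have "(\<Sum>k<?n. coeff (Q ?l k) 1 * N (L ! k) x) = (\<Sum>k<?n. - (N y (L ! k) * N (L ! k) x))"
  proof (rule sum.cong[OF HOL.refl])
    fix k assume "k \<in> {..<?n}"
    then show "coeff (Q ?l k) 1 * N (L ! k) x = - (N y (L ! k) * N (L ! k) x)"
      using c1[of k] Ly z by (cases "k = ?l") simp_all
  qed
  also have "\<dots> = - (\<Sum>d\<in>set L. N y d * N d x)" using sum_nth[OF L(2), of "\<lambda>d. N y d * N d x"] by (simp add: sum_negf)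
  also have "(\<Sum>d\<in>set L. N y d * N d x) = (\<Sum>d\<in>set mid. N y d * N d x)"
    using L z by auto
  finally have c2: "coeff (Q ?l 0) 2 = (\<Sum>d\<in>set mid. N y d * N d x)" by simp
  have "Q ?l 0 = cofactor ?B 0 ?l" unfolding Q_def adj_mat_def using nl by simp
  also have "\<dots> = (-1) ^ ?l * det (mat_delete ?B 0 ?l)" by (simp add: cofactor_def)
  also have "mat_delete ?B 0 ?l = mat ?l ?l (\<lambda>(a,b). charm N (drop 1 L ! a) (take ?l L ! b))"
    by (rule eq_matI) (use nl in \<open>auto simp: mat_delete_def\<close>)
  also have "det \<dots> = mnr (charm N) (drop 1 L) (take ?l L)" using nl by (simp add: mnr_def)
  finally have "mnr (charm N) (drop 1 L) (take ?l L) = (-1) ^ ?l * Q ?l 0"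
    by (simp add: mult.assoc[symmetric] power_mult_distrib[symmetric])
  moreover have "coeff ((-1) ^ p * q) i = (-1) ^ p * coeff q i" for p i and q :: "'a poly" by (cases "even p") auto
  ultimately show ?thesis using c2 nl by (simp add: numeral_2_eq_2)
qed

section \<open>Transfer of generators along a pivot\<close>

definition gens :: "nat list \<Rightarrow> lab set \<Rightarrow> (lab \<Rightarrow> 'a::comm_ring_1) \<Rightarrow> ('a pt \<Rightarrow> 'a) set" where
  "gens L T d = (\<lambda>t N. qf L t N - d t) ` T"

lemma pideal_rescale:
  fixes k :: "'a::field"
  assumes J: "pideal J" and "(\<lambda>N. F N - k * e) \<in> J" "(\<lambda>N. F N - k * G N) \<in> J" "k \<noteq> 0"
  shows "(\<lambda>N. G N - e) \<in> J"
proof -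
  have "(\<lambda>N. inverse k * ((F N - k * e) - (F N - k * G N))) \<in> J"
    by (intro pideal_mult[OF J] pideal_diff[OF J] pf.const assms)
  moreover have "inverse k * ((F N - k * e) - (F N - k * G N)) = G N - e" for N
    using assms(4) by (simp add: field_simps)
  ultimately show ?thesis by simp
qed

lemma valid_shift: "valid m t \<Longrightarrow> valid (Suc (Suc m)) (shift t)"
  by (cases t) auto

lemma gens_pf: "(\<And>t. t \<in> T \<Longrightarrow> valid (length L) t) \<Longrightarrow> gens L T d \<subseteq> pf UNIV"
  unfolding gens_def by (intro image_subsetI pf_diff pf.const qf_pf) auto

lemma qf_schur_pf:
  fixes c :: "'a::field"
  assumes "valid (length L) t" shows "(\<lambda>N. qf L t (schur x r c N)) \<in> pf UNIV"
  by (rule pf_comp[OF qf_pf[OF assms]])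
    (auto simp: schur_def intro!: pf_diff pf_if pf_divide pf.mult pf.coord pf.const)

lemma good_gens: "good I M (gens L T d) V \<Longrightarrow> t \<in> T \<Longrightarrow> orb I M N \<Longrightarrow> qf L t N = d t"
  unfolding good_def gens_def by auto

text \<open>No index lies beyond y, so the pivot adds the corner as its only generator. Each
  remaining generator of the smaller array is compared with a minor of the large one by
  \<open>qf_shift\<close>, valid on the hyperplane N y x = c and hence modulo the ideal.\<close>

lemma good_shift:
  assumes L: "L = x # mid @ [y]" "sorted_wrt (<) L" and c: "M y x = c" "c \<noteq> 0"
    and g: "good (set mid) (schur x y c M) (gens mid T d) V'" and v: "\<And>t. t \<in> T \<Longrightarrow> valid (length mid) t"
    and d1: "d' (LP 1) = c" and d': "\<And>t. t \<in> T \<Longrightarrow> d' (shift t) = (-1) ^ minor_size (length mid) t * c * d t"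
  shows "good (set L) M (gens L (insert (LP 1) (shift ` T)) d') (V' \<union> (\<lambda>d. (d,x)) ` set mid \<union> (\<lambda>d. (y,d)) ` set mid)"
proof -
  let ?T = "insert (LP 1) (shift ` T)" and ?V = "V' \<union> (\<lambda>d. (d,x)) ` set mid \<union> (\<lambda>d. (y,d)) ` set mid"
  have s: "sorted_wrt (<) (x # mid @ y # [])" using L by simp
  note pl = pivot_list[OF s c(2)]
  have LI: "set (x # mid @ y # []) = set L" using L by simp
  interpret pivot "set L" x y c using pl(1) unfolding LI .
  have I': "set L - {x,y} = set mid" "{d \<in> set L. x < d \<and> d < y} = set mid" "{e \<in> set L. y < e} = {}"
    using pl unfolding LI by simp_all
  have n: "nrm M" unfolding nrm_def using c I'(3) by auto
  have few: "i = i'" if "i \<in> set L" "i' \<in> set L" "y < i" "y < i'" for i i' using that I'(3) by blast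
  have gp: "good (set L) M (pivot_gens M (gens mid T d)) ?V"
    using good_pivot[OF n _ few, of "gens mid T d" V'] g unfolding I' by blast
  have vT: "valid (length L) t" if "t \<in> ?T" for t
    using that v valid_shift L by auto
  let ?J = "idl UNIV (gens L ?T d')"
  have base: "(\<lambda>N. qf L t N - d' t) \<in> ?J" if "t \<in> ?T" for t
    by (rule idl_base) (use that in \<open>auto simp: gens_def\<close>)
  have corner: "(\<lambda>N. N y x - c) \<in> ?J" using base[of "LP 1"] by (simp add: qf_corner[OF L(1), simplified] d1[simplified])
  show ?thesis
  proof (rule good_change[OF gp])
    fix g assume "g \<in> pivot_gens M (gens mid T d)"
    then consider "g = (\<lambda>N. N y x - c)" | t where "t \<in> T" "g = (\<lambda>N. qf mid t (S N) - d t)"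
      unfolding pivot_gens_def I'(3) gens_def image_empty Un_empty_left by blast
    then show "g \<in> ?J"
    proof cases
      case 2
      let ?k = "(-1) ^ minor_size (length mid) t * c"
      have B: "(\<lambda>N. qf L (shift t) N - ?k * qf mid t (S N)) \<in> ?J"
      proof (rule vanishing_on_hyperplane[OF pideal_idl _ corner])
        show "(\<lambda>N. qf L (shift t) N - ?k * qf mid t (S N)) \<in> pf UNIV"
          using 2 v valid_shift L qf_pf[of L "shift t"]
          by (intro pf_diff pf.mult pf.const qf_schur_pf) auto
        show "qf L (shift t) N - ?k * qf mid t (S N) = 0" if "N y x = c" for N
          using qf_shift[where N = N and c = c, OF L v[OF 2(1)] that c(2)] by simp
      qed
      have A: "(\<lambda>N. qf L (shift t) N - ?k * d t) \<in> ?J"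
        using base[of "shift t"] 2(1) unfolding d'[OF 2(1)] by blast
      have "?k \<noteq> 0" using c(2) by simp
      from pideal_rescale[OF pideal_idl A B this] show ?thesis unfolding 2(2) .
    qed (use corner in simp)
  next
    show "gens L ?T d' \<subseteq> pf UNIV" using gens_pf vT by blast
    fix g N assume g': "g \<in> gens L ?T d'" and o: "orb (set L) M N"
    have N: "N y x = c" using orb_nrm[OF o n] by (simp add: nrm_def)
    have "orb (set mid) (S M) (S N)" using orb_pivot_few(1)[OF o n few] unfolding I' by blast
    then have "qf mid t (S N) = d t" if "t \<in> T" for t using good_gens[OF g that] by blast
    then have "qf L (shift t) N = d' (shift t)" if "t \<in> T" for t
      using qf_shift[where N = N and c = c, OF L v[OF that] N c(2)] d'[OF that] that by simp
    then show "g N = 0" using g' N qf_corner[OF L(1), of N] d1 unfolding gens_def by auto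
  qed
qed

text \<open>One index y lies beyond r, and the generators added by the pivot are P'_1 (the pivot),
  P_1 (the zero corner) and, up to sign, Z_1 (the entry of N^2). In the complement P_1 is the entry
  of row y at the second index, which is P''_1 of the whole array, and P_i with i at least 2 yields
  P_{i+1}.\<close>

lemma good_next:
  assumes L: "L = x # mid @ [r,y]" "sorted_wrt (<) L" and c: "M r x = c" "c \<noteq> 0" and z: "M y x = 0"
    and h: "1 \<le> h" "h \<le> length mid"
    and g: "good (set (mid @ [y])) (schur x r c M) (gens (mid @ [y]) (LP ` {1..h}) d) V'"
    and d': "d' (LP 1) = 0" "d' (LP1 1) = c" "d' (LP2 1) = d (LP 1)"
      "d' (LZ 1) = (-1) ^ (length L - 1) * (\<Sum>k\<in>set (mid @ [r]). M y k * M k x)"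
      "\<And>i. 2 \<le> i \<Longrightarrow> d' (LP (Suc i)) = (-1) ^ (i - 1) * c * d (LP i)"
  shows "\<exists>V. good (set L) M (gens L (LP ` {3..Suc h} \<union> {LP1 1, LP2 1, LP 1, LZ 1}) d') V"
proof -
  let ?T = "LP ` {3..Suc h} \<union> {LP1 1, LP2 1, LP 1, LZ 1}" and ?m = "mid @ [y]"
  have s: "sorted_wrt (<) (x # mid @ r # [y])" using L by simp
  note pl = pivot_list[OF s c(2)]
  have LI: "set (x # mid @ r # [y]) = set L" using L by simp
  interpret pivot "set L" x r c using pl(1) unfolding LI .
  have I': "set L - {x,r} = set ?m" "{d \<in> set L. x < d \<and> d < r} = set mid" "{e \<in> set L. r < e} = {y}"
    using pl unfolding LI by simp_all
  have post: "i \<in> set L \<Longrightarrow> r < i \<Longrightarrow> i = y" for i using I'(3) by blast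
  have y: "y \<in> set L" "r < y" using I'(3) by blast+
  have n: "nrm M" unfolding nrm_def using c z post by auto
  have few: "i = i'" if "i \<in> set L" "i' \<in> set L" "r < i" "r < i'" for i i' using that post by blast
  have wy: "w N y = (\<Sum>k\<in>set (mid @ [r]). N y k * N k x)" for N
  proof -
    have "r \<notin> set mid" using L by (auto simp: sorted_wrt_append)
    then show ?thesis unfolding w_raw I' by simp
  qed
  have dL: "distinct L" using L(2) strict_sorted_iff by blast
  have L': "L = x # (mid @ [r]) @ [y]" using L by simp
  obtain a mid' where mid: "mid = a # mid'" using h by (cases mid) auto
  have q1: "qf L (LP 1) N = N y x" for N using qf_corner[OF L'] .
  have q2: "qf L (LP1 1) N = N r x" for N using L(1) by (simp add: mnr_single nth_append)
  have q3: "qf L (LP2 1) N = N y a" for N using L(1) mid by (simp add: mnr_single)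
  have qS: "qf ?m (LP 1) (S N) = N y a" for N using mid y by (simp add: mnr_single schur_def)
  have gp: "good (set L) M (pivot_gens M (gens ?m (LP ` {1..h}) d)) (V' \<union> (\<lambda>d. (d,x)) ` set mid \<union> (\<lambda>d. (r,d)) ` set mid)"
    using good_pivot[OF n _ few, of "gens ?m (LP ` {1..h}) d" V'] g unfolding I' by blast
  have vT: "valid (length L) t" if "t \<in> ?T" for t using that h L by auto
  let ?J = "idl UNIV (gens L ?T d')"
  have base: "(\<lambda>N. qf L t N - d' t) \<in> ?J" if "t \<in> ?T" for t
    by (rule idl_base) (use that in \<open>auto simp: gens_def\<close>)
  have corner: "(\<lambda>N. N y x - 0) \<in> ?J" using base[of "LP 1"] unfolding q1 d'(1) by simp
  have piv: "(\<lambda>N. N r x - c) \<in> ?J" using base[of "LP1 1"] unfolding q2 d'(2) by simp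
  have LZ: "(\<lambda>N. w N y - w M y) \<in> ?J"
  proof (rule pideal_rescale[OF pideal_idl, where k = "(-1) ^ (length L - 1)" and F = "qf L (LZ 1)"])
    show "(\<lambda>N. qf L (LZ 1) N - (-1) ^ (length L - 1) * w M y) \<in> ?J"
      using base[of "LZ 1"] unfolding d'(4) wy[symmetric] by simp
    show "(\<lambda>N. qf L (LZ 1) N - (-1) ^ (length L - 1) * w N y) \<in> ?J"
    proof (rule vanishing_on_hyperplane[OF pideal_idl _ corner])
      show "(\<lambda>N. qf L (LZ 1) N - (-1) ^ (length L - 1) * w N y) \<in> pf UNIV"
        using qf_pf[OF vT[of "LZ 1"]] by (intro pf_diff pf.mult pf.const pf_w) (simp_all del: qf.simps)
      show "qf L (LZ 1) N - (-1) ^ (length L - 1) * w N y = 0" if "N y x = 0" for N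
        using qf_LZ_1[where N = N, OF L' dL that] unfolding wy by simp
    qed
  qed simp
  show ?thesis
  proof (intro exI, rule good_change[OF gp])
    fix g assume "g \<in> pivot_gens M (gens ?m (LP ` {1..h}) d)"
    then consider "g = (\<lambda>N. N r x - c)" | "g = (\<lambda>N. N y x)" | "g = (\<lambda>N. w N y - w M y)"
      | i where "i \<in> {1..h}" "g = (\<lambda>N. qf ?m (LP i) (S N) - d (LP i))"
      unfolding pivot_gens_def I'(3) gens_def image_insert image_empty by blast
    then show "g \<in> ?J"
    proof cases
      case (4 i)
      show ?thesis
      proof (cases "i = 1")
        case True
        have "g = (\<lambda>N. qf L (LP2 1) N - d' (LP2 1))" unfolding 4(2) True qS q3 d' ..
        then show ?thesis using base[of "LP2 1"] by simp
      next
        case False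
        then have i: "2 \<le> i" "i \<le> h" using 4(1) by auto
        let ?k = "(-1) ^ (i - 1) * c"
        have v: "valid (length L) (LP (Suc i))" "valid (length ?m) (LP i)" using i h L by auto
        have B: "(\<lambda>N. qf L (LP (Suc i)) N - ?k * qf ?m (LP i) (S N)) \<in> ?J"
        proof (rule vanishing_on_two_hyperplanes[OF pideal_idl _ piv corner])
          show "(\<lambda>N. qf L (LP (Suc i)) N - ?k * qf ?m (LP i) (S N)) \<in> pf UNIV"
            using qf_pf[OF v(1)] by (intro pf_diff pf.mult pf.const qf_schur_pf v) (simp only: eta_contract_eq)
          show "qf L (LP (Suc i)) N - ?k * qf ?m (LP i) (S N) = 0" if "N r x = c" "N y x = 0" for N
            using qf_next[OF L, of i N c] i h that c(2) by (simp del: qf.simps)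
          show "(r, x) \<noteq> (y, x)" using y by simp
        qed
        have "LP (Suc i) \<in> ?T" using i by auto
        from base[OF this] have A: "(\<lambda>N. qf L (LP (Suc i)) N - ?k * d (LP i)) \<in> ?J"
          unfolding d'(5)[OF i(1)] .
        have "?k \<noteq> 0" using c(2) by simp
        from pideal_rescale[OF pideal_idl A B this] show ?thesis unfolding 4(2) .
      qed
    qed (use corner piv LZ in simp_all)
  next
    show "gens L ?T d' \<subseteq> pf UNIV" using gens_pf vT by blast
    fix g N assume g': "g \<in> gens L ?T d'" and o: "orb (set L) M N"
    have N: "N r x = c" "N y x = 0" using orb_nrm[OF o n] y by (auto simp: nrm_def)
    have wN: "w N y = w M y" using orb_pivot_few(2)[OF o n few y] .
    have "orb (set ?m) (S M) (S N)" using orb_pivot_few(1)[OF o n few] unfolding I' by blast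
    then have S: "qf ?m (LP i) (S N) = d (LP i)" if "i \<in> {1..h}" for i using good_gens[OF g] that by blast
    have "qf L (LP (Suc i)) N = d' (LP (Suc i))" if "2 \<le> i" "i \<le> h" for i
      using qf_next[OF L, of i N c] d'(5) that h N c(2) S[of i] by (simp del: qf.simps)
    then have "qf L (LP i) N = d' (LP i)" if "3 \<le> i" "i \<le> Suc h" for i
      using that by (cases i) auto
    moreover have "qf L (LZ 1) N = d' (LZ 1)"
      using qf_LZ_1[where N = N, OF L' dL N(2)] wN unfolding d'(4) wy by simp
    moreover have "qf L (LP2 1) N = d' (LP2 1)" unfolding q3 d'(3) using S[of 1] qS[of N] h by simp
    ultimately show "g N = 0" using g' N unfolding gens_def by (auto simp: q1 q2 d' simp del: qf.simps One_nat_def)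
  qed
qed

text \<open>The values forced by \<open>qf_shift\<close>: \<open>s\<close> undoes
  \<open>shift\<close>, and P_1 gets the corner c.\<close>

definition lift_const :: "nat \<Rightarrow> 'a::comm_ring_1 \<Rightarrow> (lab \<Rightarrow> 'a) \<Rightarrow> lab \<Rightarrow> 'a" where
  "lift_const m c d t = (if t = LP 1 then c else
     (let s = (case t of LP i \<Rightarrow> LP (i - 1) | LP1 i \<Rightarrow> LP1 (i - 1) | LP2 i \<Rightarrow> LP2 (i - 1) | LZ i \<Rightarrow> LZ (i - 1) | LM \<Rightarrow> LM)
      in (-1) ^ minor_size m s * c * d s))"

lemma lift_const_LP1 [simp]: "lift_const m c d (LP (Suc 0)) = c" by (simp add: lift_const_def)

lemma lift_const_shift:
  "valid m t \<Longrightarrow> lift_const m c d (shift t) = (-1) ^ minor_size m t * c * d t"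
  by (cases t) (auto simp: lift_const_def)

lemma lift_const_nz:
  fixes c :: "'a::field"
  shows "valid m t \<Longrightarrow> c \<noteq> 0 \<Longrightarrow> lift_const m c d (shift t) = 0 \<longleftrightarrow> d t = 0"
  by (simp add: lift_const_shift)

lemma LP_shift_image: "insert (LP (Suc 0)) (LP ` Suc ` {1..k}) = LP ` {1..Suc k}"
proof -
  have "{1..Suc k} = insert (Suc 0) (Suc ` {1..k})" by (simp only: image_Suc_atLeastAtMost) auto
  then show ?thesis by simp
qed

lemma shift_LP_image: "shift ` LP ` A = LP ` Suc ` A" by (force simp: image_image)

section \<open>Generators for generic arrays\<close>

lemma good_empty:
  assumes "V = {}" "\<And>i j. (i,j) \<in> lowp I \<Longrightarrow> (\<lambda>N. N i j - M i j) \<in> idl UNIV G"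
    and "G \<subseteq> pf UNIV" "\<And>g N. g \<in> G \<Longrightarrow> orb I M N \<Longrightarrow> g N = 0"
  shows "good I M G V"
  using assms unfolding good_def elim_def
  by (auto intro!: bexI[of _ "\<lambda>_. M _ _"] pf.const intro: orb_self)

text \<open>With two indices the orbit is a point whose only coordinate P_1 is arbitrary, possibly
  zero. This is why the constants are claimed to be nonzero only up to (n - 1) div 2.\<close>

lemma generic_good:
  fixes M :: "'a::field pt"
  assumes "sorted_wrt (<) L" "generic L M"
  shows "\<exists>V d. good (set L) M (gens L (LP ` {1..length L div 2}) d) V \<and> card V = reg (length L) \<and> finite V \<and>
           (\<forall>i\<in>{1..(length L - 1) div 2}. d (LP i) \<noteq> 0)"
  using assms
proof (induction "length L" arbitrary: L M rule: less_induct)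
  case less
  consider "length L \<le> 1" | "length L = 2" | "3 \<le> length L" by linarith
  then show ?case
  proof cases
    case 1
    then have "lowp (set L) = {}" by (cases L) (auto simp: lowp_def)
    then have "good (set L) M (gens L (LP ` {1..length L div 2}) d) {}" for d :: "lab \<Rightarrow> 'a"
      using 1 by (intro good_empty) (auto simp: gens_def)
    moreover have "reg (length L) = 0" using 1 by (cases "length L") auto
    ultimately show ?thesis using 1 by (intro exI[of _ "{}"] exI[of _ "\<lambda>_. 0"]) auto
  next
    case 2
    then obtain x y where L: "L = [x,y]" by (cases L; cases "tl L") auto
    have xy: "x < y" using less(2) L by simp
    have low: "lowp (set L) = {(y,x)}" using L xy by (auto simp: lowp_def)
    have G: "gens L (LP ` {1..length L div 2}) (\<lambda>_. M y x) = {\<lambda>N. N y x - M y x}"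
    proof -
      have "qf L (LP 1) N = N y x" for N :: "'a pt" using qf_corner[of L x "[]" y N] L by (simp del: qf.simps)
      then show ?thesis using L by (simp add: gens_def del: qf.simps)
    qed
    have "N y x = M y x" if "orb (set L) M N" for N
      using that by induction (use L xy in \<open>auto simp: agree_def mv_def\<close>)
    then have "good (set L) M (gens L (LP ` {1..length L div 2}) (\<lambda>_. M y x)) {}"
      unfolding G by (intro good_empty) (auto simp: low intro!: idl_base pf_diff pf.coord pf.const)
    then show ?thesis using L by (intro exI[of _ "{}"] exI[of _ "\<lambda>_. M y x"]) (auto simp: numeral_2_eq_2)
  next
    case 3
    then obtain x K where LK: "L = x # K" by (cases L) auto
    then have "K \<noteq> []" using 3 by auto
    then obtain mid y where L: "L = x # mid @ [y]" using LK by (metis append_butlast_last_id)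
    let ?m = "length mid"
    have len: "length L = Suc (Suc ?m)" and m: "1 \<le> ?m" using L 3 by auto
    have s: "sorted_wrt (<) mid" using less(2) L by (auto simp: sorted_wrt_append)
    have c: "M y x \<noteq> 0" and gm: "generic mid (schur x y (M y x) M)"
      using less(3) m unfolding L generic_Cons_snoc by auto
    obtain V d where g: "good (set mid) (schur x y (M y x) M) (gens mid (LP ` {1..?m div 2}) d) V"
      and V: "card V = reg ?m" "finite V" and d: "\<And>i. i \<in> {1..(?m - 1) div 2} \<Longrightarrow> d (LP i) \<noteq> 0"
      using less(1)[OF _ s gm] len by auto
    let ?d = "lift_const ?m (M y x) d" and ?V = "V \<union> (\<lambda>d. (d,x)) ` set mid \<union> (\<lambda>d. (y,d)) ` set mid"
    have v: "valid ?m t" if "t \<in> LP ` {1..?m div 2}" for t using that by auto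
    have "good (set L) M (gens L (insert (LP 1) (shift ` LP ` {1..?m div 2})) ?d) ?V"
      by (rule good_shift[OF L less(2) HOL.refl c g v])
        (assumption, rule lift_const_LP1[folded One_nat_def], rule lift_const_shift, rule v)
    also have "insert (LP 1) (shift ` LP ` {1..?m div 2}) = LP ` {1..length L div 2}"
      using LP_shift_image[of "?m div 2"] len by (simp add: shift_LP_image)
    finally have "good (set L) M (gens L (LP ` {1..length L div 2}) ?d) ?V" .
    moreover have "?d (LP i) \<noteq> 0" if i: "i \<in> {1..(length L - 1) div 2}" for i
    proof (cases "i = 1")
      case False
      then obtain k where k: "i = Suc k" "1 \<le> k" using i by (cases i) auto
      then have "k \<in> {1..(?m - 1) div 2}" using i k len by auto
      then show ?thesis using lift_const_nz[of ?m "LP k" "M y x" d] k d c by auto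
    qed (use c in auto)
    moreover have "card ?V = reg (length L)"
    proof -
      have Vl: "V \<subseteq> lowp (set mid)" using g unfolding good_def elim_def by blast
      have nx: "x \<notin> set mid" "y \<notin> set mid" "distinct mid" using less(2) L by (auto simp: sorted_wrt_append strict_sorted_iff)
      have "card ?V = card (V \<union> (\<lambda>d. (d,x)) ` set mid) + card ((\<lambda>d. (y,d)) ` set mid)"
        using V(2) Vl nx by (intro card_Un_disjoint) (auto simp: lowp_def)
      also have "card (V \<union> (\<lambda>d. (d,x)) ` set mid) = card V + card ((\<lambda>d. (d,x)) ` set mid)"
        using V(2) Vl nx by (intro card_Un_disjoint) (auto simp: lowp_def)
      also have "card ((\<lambda>d. (d,x)) ` set mid) = ?m" using nx by (simp add: card_image inj_on_def distinct_card)
      also have "card ((\<lambda>d. (y,d)) ` set mid) = ?m" using nx by (simp add: card_image inj_on_def distinct_card)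
      finally show ?thesis using V len by simp
    qed
    ultimately show ?thesis using V(2) by (intro exI[of _ ?V] exI[of _ ?d]) auto
  qed
qed

section \<open>Classification of orbits\<close>

text \<open>The minor with index (n - 1) div 2 is evaluated at M itself because for j + 1 equal to
  that index it is not among the generators.\<close>

definition type1 :: "nat list \<Rightarrow> 'a::field pt \<Rightarrow> bool" where
  "type1 L M \<longleftrightarrow> (\<exists>j d V. 1 \<le> j \<and> j < (length L - 1) div 2 \<and>
     good (set L) M (gens L (LP ` ({1..j - 1} \<union> {j + 2..length L div 2}) \<union> {LP1 j, LP2 j, LP j, LZ j}) d) V \<and>
     (\<forall>i\<in>{1..j - 1} \<union> {j + 2..(length L - 1) div 2}. d (LP i) \<noteq> 0) \<and> d (LP1 j) \<noteq> 0 \<and> d (LP2 j) \<noteq> 0 \<and> d (LP j) = 0 \<and>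
     qf L (LP ((length L - 1) div 2)) M \<noteq> 0)"

text \<open>The common frame of the families in which the vanishing P has the last possible index; T
  lists the generators that distinguish them.\<close>

definition last_type :: "nat list \<Rightarrow> 'a::field pt \<Rightarrow> lab set \<Rightarrow> (lab \<Rightarrow> 'a) \<Rightarrow> bool" where
  "last_type L M T d \<longleftrightarrow> (\<exists>V. good (set L) M (gens L (LP ` {1..(length L - 1) div 2 - 1} \<union> T) d) V) \<and>
     (\<forall>i\<in>{1..(length L - 1) div 2 - 1}. d (LP i) \<noteq> 0) \<and> d (LP ((length L - 1) div 2)) = 0"

definition type2 :: "nat list \<Rightarrow> 'a::field pt \<Rightarrow> bool" where
  "type2 L M \<longleftrightarrow> odd (length L) \<and> (\<exists>d. let j = (length L - 1) div 2 in
     last_type L M {LP1 j, LP2 j, LP j} d)"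

definition type3a :: "nat list \<Rightarrow> 'a::field pt \<Rightarrow> bool" where
  "type3a L M \<longleftrightarrow> even (length L) \<and> (\<exists>d. let j = (length L - 1) div 2 in
     last_type L M {LP1 j, LP2 j, LP j, LZ j} d \<and> d (LP1 j) \<noteq> 0)"

definition type3b :: "nat list \<Rightarrow> 'a::field pt \<Rightarrow> bool" where
  "type3b L M \<longleftrightarrow> even (length L) \<and> (\<exists>d. let j = (length L - 1) div 2 in
     last_type L M {LP j, LP1 j, LM, LP2 j} d \<and> d (LP1 j) = 0 \<and> d (LP2 j) \<noteq> 0)"

section \<open>Passing through a nonzero corner\<close>

lemma type1_step:
  assumes L: "L = x # mid @ [y]" "sorted_wrt (<) L" and c: "M y x \<noteq> 0" and t: "type1 mid (schur x y (M y x) M)"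
  shows "type1 L M"
proof -
  let ?m = "length mid" and ?S = "schur x y (M y x) M"
  obtain j d V where j: "1 \<le> j" "j < (?m - 1) div 2"
    and g: "good (set mid) ?S (gens mid (LP ` ({1..j - 1} \<union> {j + 2..?m div 2}) \<union> {LP1 j, LP2 j, LP j, LZ j}) d) V"
    and nz: "\<And>i. i \<in> {1..j - 1} \<union> {j + 2..(?m - 1) div 2} \<Longrightarrow> d (LP i) \<noteq> 0"
    and d: "d (LP1 j) \<noteq> 0" "d (LP2 j) \<noteq> 0" "d (LP j) = 0" and q: "qf mid (LP ((?m - 1) div 2)) ?S \<noteq> 0"
    using t unfolding type1_def by blast
  let ?T = "LP ` ({1..j - 1} \<union> {j + 2..?m div 2}) \<union> {LP1 j, LP2 j, LP j, LZ j}" and ?d = "lift_const ?m (M y x) d"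
  have len: "length L = Suc (Suc ?m)" using L by simp
  have v: "valid ?m t" if "t \<in> ?T" for t using that j by auto
  obtain V' where g': "good (set L) M (gens L (insert (LP 1) (shift ` ?T)) ?d) V'"
    using good_shift[OF L HOL.refl c g v] lift_const_shift v by (metis One_nat_def lift_const_LP1)
  have s: "Suc j - 1 = j" "{1..j} = insert 1 (Suc ` {1..j - 1})" "{Suc j + 2..length L div 2} = Suc ` {j + 2..?m div 2}"
    using j len by (auto simp: image_Suc_atLeastAtMost simp del: image_Suc_atLeastAtMost)
      (simp_all only: image_Suc_atLeastAtMost, auto)
  have T: "insert (LP 1) (shift ` ?T) = LP ` ({1..Suc j - 1} \<union> {Suc j + 2..length L div 2}) \<union> {LP1 (Suc j), LP2 (Suc j), LP (Suc j), LZ (Suc j)}"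
    unfolding s by (simp add: image_Un shift_LP_image insert_commute)
  have "?d (LP i) \<noteq> 0" if i: "i \<in> {1..Suc j - 1} \<union> {Suc j + 2..(length L - 1) div 2}" for i
  proof (cases "i = 1")
    case False
    then obtain k where k: "i = Suc k" "1 \<le> k" using i by (cases i) auto
    then have k': "k \<in> {1..j - 1} \<union> {j + 2..(?m - 1) div 2}" using i k len j by auto
    then have "valid ?m (LP k)" using k j by auto
    then show ?thesis using lift_const_nz[of ?m "LP k" "M y x" d] k nz[OF k'] c by auto
  qed (use c in auto)
  moreover have "valid ?m (LP1 j)" "valid ?m (LP2 j)" "valid ?m (LP j)" using j by auto
  then have "?d (LP1 (Suc j)) \<noteq> 0" "?d (LP2 (Suc j)) \<noteq> 0" "?d (LP (Suc j)) = 0"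
    using lift_const_nz[of ?m _ "M y x" d] c d by (metis shift.simps)+
  moreover have "qf L (LP ((length L - 1) div 2)) M \<noteq> 0"
  proof -
    have "valid ?m (LP ((?m - 1) div 2))" using j by auto
    moreover have "shift (LP ((?m - 1) div 2)) = LP ((length L - 1) div 2)" using len j by simp
    ultimately show ?thesis using qf_shift[OF L, of "LP ((?m - 1) div 2)" M] c q by (simp del: qf.simps)
  qed
  moreover have "1 \<le> Suc j" "Suc j < (length L - 1) div 2" using j len by auto
  ultimately show ?thesis unfolding type1_def using g' unfolding T by blast
qed

lemma last_type_step:
  assumes L: "L = x # mid @ [y]" "sorted_wrt (<) L" "3 \<le> length mid" and c: "M y x \<noteq> 0"
    and t: "last_type mid (schur x y (M y x) M) T d" and v: "\<And>t. t \<in> T \<Longrightarrow> valid (length mid) t"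
  shows "last_type L M (shift ` T) (lift_const (length mid) (M y x) d)"
proof -
  let ?m = "length mid" and ?S = "schur x y (M y x) M"
  let ?k = "(?m - 1) div 2" and ?d = "lift_const ?m (M y x) d"
  obtain V where g: "good (set mid) ?S (gens mid (LP ` {1..?k - 1} \<union> T) d) V"
    and nz: "\<And>i. i \<in> {1..?k - 1} \<Longrightarrow> d (LP i) \<noteq> 0" and z: "d (LP ?k) = 0"
    using t unfolding last_type_def by blast
  have len: "length L = Suc (Suc ?m)" using L by simp
  have k: "(length L - 1) div 2 = Suc ?k" "1 \<le> ?k" "?k < ?m" using len L(3) by auto
  have v': "valid ?m t" if t: "t \<in> LP ` {1..?k - 1} \<union> T" for t
  proof (cases "t \<in> T")
    case False
    then obtain i where "t = LP i" "1 \<le> i" "i \<le> ?k - 1" using t by auto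
    then show ?thesis using k(3) by simp
  qed (use v in simp)
  obtain V' where g': "good (set L) M (gens L (insert (LP 1) (shift ` (LP ` {1..?k - 1} \<union> T))) ?d) V'"
    using good_shift[OF L(1,2) HOL.refl c g v'] lift_const_shift v' by (metis One_nat_def lift_const_LP1)
  have "insert (LP 1) (shift ` (LP ` {1..?k - 1} \<union> T)) = LP ` {1..Suc ?k - 1} \<union> shift ` T"
  proof -
    have e: "insert (LP 1) (shift ` LP ` {1..?k - 1}) = LP ` {1..Suc ?k - 1}"
      using LP_shift_image[of "?k - 1"] k(2) by (simp add: shift_LP_image)
    show ?thesis by (simp only: image_Un Un_insert_left[symmetric] e)
  qed
  moreover have "?d (LP i) \<noteq> 0" if i: "i \<in> {1..Suc ?k - 1}" for i
  proof (cases "i = 1")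
    case False
    then obtain l where l: "i = Suc l" "1 \<le> l" using i by (cases i) auto
    then have l': "l \<in> {1..?k - 1}" using i unfolding atLeastAtMost_iff by linarith
    then have "l \<le> ?m" using k unfolding atLeastAtMost_iff by linarith
    then have "valid ?m (LP l)" using l by simp
    then show ?thesis using lift_const_nz[of ?m "LP l" "M y x" d] l nz[OF l'] c by auto
  qed (use c in auto)
  moreover have "?d (LP (Suc ?k)) = 0"
    using lift_const_nz[of ?m "LP ?k" "M y x" d] k z c by simp
  ultimately show ?thesis unfolding last_type_def k(1) using g' by auto
qed

lemma types_step:
  assumes L: "L = x # mid @ [y]" "sorted_wrt (<) L" "3 \<le> length mid" and c: "M y x \<noteq> 0"
  defines "S \<equiv> schur x y (M y x) M"
  shows "type2 mid S \<Longrightarrow> type2 L M" "type3a mid S \<Longrightarrow> type3a L M" "type3b mid S \<Longrightarrow> type3b L M"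
proof -
  let ?m = "length mid"
  let ?k = "(?m - 1) div 2"
  have len: "length L = Suc (Suc ?m)" using L by simp
  have k: "(length L - 1) div 2 = Suc ?k" "1 \<le> ?k" "?k < ?m" using len L(3) by auto
  have v: "valid ?m (LP ?k)" "valid ?m (LP1 ?k)" "valid ?m (LP2 ?k)" "valid ?m (LZ ?k)" using k by auto
  have vM: "valid ?m LM" if "even ?m" using that L(3) by (auto elim!: evenE)
  note nz = lift_const_nz[of ?m _ "M y x", OF v(2) c, simplified] lift_const_nz[of ?m _ "M y x", OF v(3) c, simplified]
  {
    assume "type2 mid S"
    then obtain d where o: "odd ?m" and t: "last_type mid S {LP1 ?k, LP2 ?k, LP ?k} d"
      unfolding type2_def Let_def by blast
    have "last_type L M (shift ` {LP1 ?k, LP2 ?k, LP ?k}) (lift_const ?m (M y x) d)"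
      by (rule last_type_step[OF L c t[unfolded S_def]]) (use v in auto)
    then show "type2 L M" unfolding type2_def Let_def k(1) using o len by auto
  next
    assume "type3a mid S"
    then obtain d where o: "even ?m" and t: "last_type mid S {LP1 ?k, LP2 ?k, LP ?k, LZ ?k} d" and d: "d (LP1 ?k) \<noteq> 0"
      unfolding type3a_def Let_def by blast
    have "last_type L M (shift ` {LP1 ?k, LP2 ?k, LP ?k, LZ ?k}) (lift_const ?m (M y x) d)"
      by (rule last_type_step[OF L c t[unfolded S_def]]) (use v in auto)
    then show "type3a L M" unfolding type3a_def Let_def k(1) using o len d nz
      by (intro conjI exI[of _ "lift_const ?m (M y x) d"]) auto
  next
    assume "type3b mid S"
    then obtain d where o: "even ?m" and t: "last_type mid S {LP ?k, LP1 ?k, LM, LP2 ?k} d"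
      and d: "d (LP1 ?k) = 0" "d (LP2 ?k) \<noteq> 0"
      unfolding type3b_def Let_def by blast
    have "last_type L M (shift ` {LP ?k, LP1 ?k, LM, LP2 ?k}) (lift_const ?m (M y x) d)"
      by (rule last_type_step[OF L c t[unfolded S_def]]) (use v vM[OF o] in auto)
    then show "type3b L M" unfolding type3b_def Let_def k(1) using o len d nz
      by (intro conjI exI[of _ "lift_const ?m (M y x) d"]) auto
  }
qed

text \<open>With three indices and zero corner the orbit is a single point: a move changes an entry
  only by a multiple of the corner.\<close>

lemma type2_base:
  assumes L: "L = [x,r,y]" "sorted_wrt (<) L" and z: "M y x = 0"
  shows "type2 L M"
proof -
  define d where "d t = (if t = LP1 1 then M r x else if t = LP2 1 then M y r else 0)" for t
  have xy: "x < r" "r < y" using L by auto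
  have low: "lowp (set L) = {(r,x), (y,r), (y,x)}" using L xy by (auto simp: lowp_def)
  have G: "gens L {LP1 1, LP2 1, LP 1} d = {\<lambda>N. N r x - M r x, \<lambda>N. N y r - M y r, \<lambda>N. N y x - 0}"
    using L by (simp add: gens_def d_def mnr_single)
  have inv: "N r x = M r x \<and> N y r = M y r \<and> N y x = 0" if "orb (set L) M N" for N
    using that
  proof induction
    case (step N a b N' t)
    have "N' i j = mv a b t N i j" if "(i,j) \<in> lowp (set L)" for i j
      using step(5) that by (auto simp: agree_def lowp_def)
    then show ?case using step(2-4,6) low L xy by (auto simp: mv_def)
  qed (use L xy z in \<open>auto simp: agree_def\<close>)
  have "good (set L) M (gens L {LP1 1, LP2 1, LP 1} d) {}"
    unfolding G
  proof (rule good_empty[OF HOL.refl])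
    show "(\<lambda>N. N i j - M i j) \<in> idl UNIV {\<lambda>N. N r x - M r x, \<lambda>N. N y r - M y r, \<lambda>N. N y x - 0}" if "(i,j) \<in> lowp (set L)" for i j
      using that low z by (auto intro!: idl_base)
    show "{\<lambda>N. N r x - M r x, \<lambda>N. N y r - M y r, \<lambda>N. N y x - 0} \<subseteq> pf UNIV"
      by (intro insert_subsetI pf_diff pf.coord pf.const) auto
  qed (use inv in auto)
  then show ?thesis unfolding type2_def last_type_def Let_def
    using L by (auto simp: d_def intro!: exI[of _ d])
qed

text \<open>Four entries are fixed. The other two are free: the moves with (a,b) = (y',y) and
  (x2,y') change the entries (y',x2) and (y,y') by multiples of M y x2, which is nonzero.\<close>

lemma type3b_base:
  assumes L: "L = [x,x2,y',y]" "sorted_wrt (<) L" and z: "M y x = 0" "M y' x = 0" and c: "M y x2 \<noteq> 0"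
  shows "type3b L M"
proof -
  define d where "d t = (if t = LM then M x2 x else if t = LP2 1 then M y x2 else 0)" for t
  have xy: "x < x2" "x2 < y'" "y' < y" "x < y'" "x < y" "x2 < y" using L by auto
  note ne = xy[THEN less_not_sym] xy[THEN less_imp_neq] xy[THEN less_imp_neq, symmetric]
  have lowpE: "(i,j) \<in> lowp (set L) \<longleftrightarrow> i = x2 \<and> j = x \<or> i = y' \<and> (j = x \<or> j = x2) \<or> i = y \<and> (j = x \<or> j = x2 \<or> j = y')" for i j
    unfolding lowp_def L using xy ne by (simp, safe)
  have low: "lowp (set L) = {(x2,x), (y',x), (y',x2), (y,x), (y,x2), (y,y')}"
    by (auto simp: lowpE)
  let ?G = "{\<lambda>N. N y x - 0, \<lambda>N. N y' x - 0, \<lambda>N. N x2 x - M x2 x, \<lambda>N. N y x2 - M y x2}" and ?V = "{(y',x2), (y,y')}"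
  have G: "gens L {LP 1, LP1 1, LM, LP2 1} d = ?G"
    using L by (simp add: gens_def d_def mnr_single)
  have inv: "N y x = 0 \<and> N y' x = 0 \<and> N x2 x = M x2 x \<and> N y x2 = M y x2" if "orb (set L) M N" for N
    using that
  proof induction
    case (step N a b N' t)
    have "N' i j = mv a b t N i j" if "(i,j) \<in> lowp (set L)" for i j
      using step(5) that by (auto simp: agree_def lowp_def)
    then have e: "N' y x = mv a b t N y x" "N' y' x = mv a b t N y' x" "N' x2 x = mv a b t N x2 x"
      "N' y x2 = mv a b t N y x2" unfolding low by auto
    have ab: "a \<noteq> y" "b \<noteq> x" "a = y' \<Longrightarrow> b = y" "a = x2 \<Longrightarrow> b = y' \<or> b = y" "b = x2 \<Longrightarrow> a = x"
      using step(2-4) L xy by auto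
    have z: "N y x = 0" "N y' x = 0" "N x2 x = M x2 x" "N y x2 = M y x2" using step(6) by auto
    have "N' y x = 0" using e(1) ab(1,2) z by (simp add: mv_def)
    moreover have "N' y' x = 0" using e(2) ab(2,3) z by (cases "a = y'") (simp_all add: mv_def)
    moreover have "N' x2 x = M x2 x" using e(3) ab(2,4) z by (cases "a = x2") (auto simp: mv_def)
    moreover have "N' y x2 = M y x2" using e(4) ab(1,5) z by (cases "b = x2") (simp_all add: mv_def)
    ultimately show ?case by blast
  qed (use L xy z in \<open>auto simp: agree_def\<close>)
  have "good (set L) M ?G ?V"
    unfolding good_def
  proof (intro conjI allI ballI impI)
    show "elim (set L) ?V (idl UNIV ?G)"
      unfolding elim_def
    proof (intro conjI allI impI)
      show "?V \<subseteq> lowp (set L)" using low by auto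
      fix i j assume "(i,j) \<in> lowp (set L)"
      then consider "(i,j) \<in> ?V" | "(\<lambda>N. N i j - 0) \<in> ?G" | "(\<lambda>N. N i j - M i j) \<in> ?G"
        unfolding low by auto
      then show "\<exists>h\<in>pf ?V. (\<lambda>N. N i j - h N) \<in> idl UNIV ?G"
      proof cases
        case 1 then show ?thesis using pf.coord[OF 1] by (intro bexI[of _ "\<lambda>N. N i j"]) (auto intro: idl.zero)
      next
        case 2 then show ?thesis using idl_base[OF 2] pf.const[of 0] by (intro bexI[of _ "\<lambda>_. 0"]) auto
      next
        case 3 then show ?thesis using idl_base[OF 3] pf.const[of "M i j"] by (intro bexI[of _ "\<lambda>_. M i j"]) auto
      qed
    qed
    fix \<phi> :: "'a pt"
    let ?N1 = "mv y' y ((M y' x2 - \<phi> y' x2) / M y x2) M"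
    let ?N2 = "mv x2 y' ((\<phi> y y' - ?N1 y y') / M y x2) ?N1"
    have "orb (set L) M ?N2" using L xy by (intro orb_move orb_self) auto
    moreover have "?N2 i j = \<phi> i j" if "(i,j) \<in> ?V" for i j using that xy c by (auto simp: mv_def)
    ultimately show "\<exists>N. orb (set L) M N \<and> (\<forall>i j. (i,j) \<in> ?V \<longrightarrow> N i j = \<phi> i j)" by blast
  next
    show "?G \<subseteq> pf UNIV" by (intro insert_subsetI pf_diff pf.coord pf.const) auto
  next
    fix g N assume "g \<in> ?G" "orb (set L) M N"
    then show "g N = 0" using inv[of N] by auto
  qed
  then have "good (set L) M (gens L {LP 1, LP1 1, LM, LP2 1} d) ?V" unfolding G .
  then show ?thesis unfolding type3b_def last_type_def Let_def
    using L c by (auto simp: d_def intro!: exI[of _ d])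
qed

text \<open>\<open>good_next\<close> applies with j_0 = 1. This is the last possible index exactly
  for four indices; there P''_1 is the corner of a complement with two indices and may vanish, which
  is the case a).\<close>

lemma next_base:
  assumes L: "L = x # mid @ [r,y]" "sorted_wrt (<) L" "mid \<noteq> []" and c: "M r x \<noteq> 0" and z: "M y x = 0"
    and gen: "generic (mid @ [y]) (schur x r (M r x) M)"
  shows "type1 L M \<or> type3a L M"
proof -
  let ?m = "length mid" and ?S = "schur x r (M r x) M" and ?n = "length L"
  define h where "h = Suc ?m div 2"
  have s: "sorted_wrt (<) (mid @ [y])" using L by (auto simp: sorted_wrt_append)
  have m: "1 \<le> ?m" using L(3) by (cases mid) auto
  have h: "1 \<le> h" "h \<le> ?m" using m unfolding h_def by auto
  have len: "?n = ?m + 3" using L by simp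
  obtain V d where g: "good (set (mid @ [y])) ?S (gens (mid @ [y]) (LP ` {1..h}) d) V"
    and nz: "\<And>i. i \<in> {1..?m div 2} \<Longrightarrow> d (LP i) \<noteq> 0"
    using generic_good[OF s gen] unfolding h_def by auto
  define d' where "d' t = (case t of LP i \<Rightarrow> if i = 1 then 0 else (-1) ^ (i - 2) * M r x * d (LP (i - 1))
     | LP1 _ \<Rightarrow> M r x | LP2 _ \<Rightarrow> d (LP 1)
     | _ \<Rightarrow> (-1) ^ (length L - 1) * (\<Sum>k\<in>set (mid @ [r]). M y k * M k x))" for t
  have dS: "d' (LP (Suc i)) = (-1) ^ (i - 1) * M r x * d (LP i)" if "1 \<le> i" for i
    using that by (simp add: d'_def)
  obtain V' where g': "good (set L) M (gens L (LP ` {3..Suc h} \<union> {LP1 1, LP2 1, LP 1, LZ 1}) d') V'"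
    using good_next[OF L(1,2) HOL.refl c z h g, of d'] dS by (auto simp: d'_def)
  have n2: "?n div 2 = Suc h" unfolding len h_def by simp
  show ?thesis
  proof (cases "?m = 1")
    case True
    then have "?n = 4" "h = 1" using len h_def by auto
    then show ?thesis using g' c
      by (intro disjI2, unfold type3a_def last_type_def Let_def, intro conjI exI[of _ d'])
        (auto simp: d'_def)
  next
    case False
    let ?k = "(?n - 1) div 2"
    have k: "?k = Suc (?m div 2)" "1 \<le> ?m div 2" using False m len by auto
    have nz': "d' (LP i) \<noteq> 0" if i: "i \<in> {1..0} \<union> {3..?k}" for i
    proof -
      have "3 \<le> i" "i \<le> Suc (?m div 2)" using i k by auto
      then obtain l where "i = Suc l" "1 \<le> l" "l \<le> ?m div 2" by (cases i) auto
      then show ?thesis using dS[of l] c nz[of l] by simp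
    qed
    have q: "qf L (LP ?k) M \<noteq> 0"
    proof -
      have "qf (mid @ [y]) (LP (?m div 2)) ?S = d (LP (?m div 2))"
        by (rule good_gens[OF g]) (use k h_def in auto)
      then show ?thesis using qf_next[OF L(1,2) k(2), of M "M r x"] c z nz[of "?m div 2"] k by (simp del: qf.simps)
    qed
    have I: "{1..1 - (1::nat)} \<union> {1 + 2..?n div 2} = {3..Suc h}" unfolding n2 by auto
    have "good (set L) M (gens L (LP ` ({1..1 - 1} \<union> {1 + 2..?n div 2}) \<union> {LP1 1, LP2 1, LP 1, LZ 1}) d') V'"
      using g' by (simp only: I)
    moreover have "d' (LP i) \<noteq> 0" if "i \<in> {1..1 - 1} \<union> {1 + 2..?k}" for i
      using nz'[of i] that by auto
    moreover have "d' (LP1 1) \<noteq> 0" "d' (LP2 1) \<noteq> 0" "d' (LP 1) = 0" using c nz[of 1] k by (auto simp: d'_def)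
    moreover have "1 < ?k" using k by simp
    ultimately have "type1 L M" unfolding type1_def using q by (intro exI[of _ 1] exI[of _ d'] exI[of _ V']) blast
    then show ?thesis ..
  qed
qed

text \<open>For a zero corner its two neighbours M r x and M y x2 decide. If M r x is nonzero,
  everything depends on whether the complement is generic. If both vanish, the orbit is too small.
  If only M y x2 is nonzero, the reflected array shows a too small orbit unless just four indices
  are left, and this exception is form b). With three indices the orbit is a point.\<close>

theorem orbit_trichotomy:
  fixes M :: "'a::field pt"
  assumes "sorted_wrt (<) L" "3 \<le> length L"
  shows "generic L M \<or> (\<exists>m. UB (set L) M m \<and> m + 3 \<le> reg (length L)) \<or>
    type1 L M \<or> type2 L M \<or> type3a L M \<or> type3b L M"
  using assms
proof (induction "length L" arbitrary: L M rule: less_induct)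
  case less
  then obtain x K where LK: "L = x # K" by (cases L) auto
  then have "K \<noteq> []" using less(3) by auto
  then obtain mid y where L: "L = x # mid @ [y]" using LK by (metis append_butlast_last_id)
  have len: "length L = Suc (Suc (length mid))" using L by simp
  have mid: "mid \<noteq> []" using less(3) len by auto
  have s: "sorted_wrt (<) mid" using less(2) L by (auto simp: sorted_wrt_append)
  show ?case
  proof (cases "M y x = 0")
    case False
    let ?S = "schur x y (M y x) M"
    show ?thesis
    proof (cases "length mid \<le> 2")
      case True
      then show ?thesis using False generic_short[OF True] unfolding L generic_Cons_snoc by blast
    next
      case False
      note c = \<open>M y x \<noteq> 0\<close>
      have "3 \<le> length mid" using False by simp
      note st = types_step[where M = M, OF L less(2) this c] type1_step[where M = M, OF L less(2) c]
      have ub: "\<exists>m. UB (set L) M m \<and> m + 3 \<le> reg (length L)"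
        if "UB (set mid) ?S m" "m + 3 \<le> reg (length mid)" for m
      proof -
        have "UB (set (x # mid @ y # [])) M (m + 2 * length mid + 2 * (length ([] :: nat list) - 1))"
          by (rule UB_pivot_list(1)) (use less(2) L c that in auto)
        then show ?thesis using that(2) L len by (intro exI[of _ "m + 2 * length mid"]) auto
      qed
      have gen: "generic L M" if "generic mid ?S" using that c unfolding L generic_Cons_snoc by blast
      have "generic mid ?S \<or> (\<exists>m. UB (set mid) ?S m \<and> m + 3 \<le> reg (length mid)) \<or>
          type1 mid ?S \<or> type2 mid ?S \<or> type3a mid ?S \<or> type3b mid ?S"
        by (rule less(1)) (use len s \<open>3 \<le> length mid\<close> in auto)
      then show ?thesis using st gen ub by blast
    qed
  next
    case True
    obtain K r where K: "mid = K @ [r]" using mid by (metis append_butlast_last_id)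
    have L': "L = x # K @ [r,y]" using L K by simp
    show ?thesis
    proof (cases K)
      case Nil
      then show ?thesis using type2_base[of L x r y M] L' less(2) True by simp
    next
      case (Cons x2 K')
      have L2: "L = x # x2 # K' @ [r,y]" using L' Cons by simp
      show ?thesis
      proof (cases "M r x = 0")
        case False
        then show ?thesis
          using UB_next_corner[where M = M, OF L' less(2) False True] next_base[where M = M, OF L' less(2) _ False True] Cons by blast
      next
        case r: True
        show ?thesis
        proof (cases "M y x2 = 0")
          case False
          then show ?thesis
            using type3b_base[of L x x2 r y M] UB_next_corner_row[where M = M, OF L2 less(2) _ True r False] L2 less(2) True r
            by (cases "K' = []") auto
        next
          case y2: True
          then show ?thesis using UB_two_corners[where M = M, OF L2 less(2) True r y2] by blast
        qed
      qed
    qed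
  qed
qed

section \<open>Evaluation of polynomials\<close>

abbreviation "lookup \<equiv> Poly_Mapping.lookup"
abbreviation "keys \<equiv> Poly_Mapping.keys"

definition mev :: "('v \<Rightarrow> 'a::comm_semiring_1) \<Rightarrow> ('v \<Rightarrow>\<^sub>0 nat) \<Rightarrow> 'a" where
  "mev a m = (\<Prod>v\<in>keys m. a v ^ lookup m v)"

lemma mev_superset: "finite A \<Longrightarrow> keys m \<subseteq> A \<Longrightarrow> mev a m = (\<Prod>v\<in>A. a v ^ lookup m v)"
  unfolding mev_def by (rule prod.mono_neutral_left) (auto simp: in_keys_iff)

lemma mev_add: "mev a (m + m') = mev a m * mev a m'"
proof -
  let ?A = "keys m \<union> keys m'"
  have "mev a (m + m') = (\<Prod>v\<in>?A. a v ^ lookup (m + m') v)"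
    using Poly_Mapping.keys_add[of m m'] by (intro mev_superset) auto
  also have "\<dots> = (\<Prod>v\<in>?A. a v ^ lookup m v) * (\<Prod>v\<in>?A. a v ^ lookup m' v)"
    by (simp add: lookup_add power_add prod.distrib)
  finally show ?thesis using mev_superset[of ?A m a] mev_superset[of ?A m' a] by simp
qed

lemma mev_mult: "mev (\<lambda>v. a v * b v) m = mev a m * mev b m"
  by (simp add: mev_def power_mult_distrib prod.distrib)

lemma mpol_eval_mev: "mpol_eval a p = (\<Sum>m\<in>keys p. lookup p m * mev a m)"
  by (simp add: mpol_eval_def mev_def)

lemma mpol_eval_superset: "finite A \<Longrightarrow> keys p \<subseteq> A \<Longrightarrow> mpol_eval a p = (\<Sum>m\<in>A. lookup p m * mev a m)"
  unfolding mpol_eval_mev by (rule sum.mono_neutral_left) (auto simp: in_keys_iff)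

lemma mpol_eval_add: "mpol_eval a (p + q) = mpol_eval a p + mpol_eval a q"
proof -
  let ?A = "keys p \<union> keys q"
  have "mpol_eval a (p + q) = (\<Sum>m\<in>?A. lookup (p + q) m * mev a m)"
    using Poly_Mapping.keys_add[of p q] by (intro mpol_eval_superset) auto
  also have "\<dots> = (\<Sum>m\<in>?A. lookup p m * mev a m) + (\<Sum>m\<in>?A. lookup q m * mev a m)"
    by (simp add: lookup_add distrib_right sum.distrib)
  finally show ?thesis using mpol_eval_superset[of ?A p a] mpol_eval_superset[of ?A q a] by simp
qed

lemma mpol_eval_0 [simp]: "mpol_eval a 0 = 0" by (simp add: mpol_eval_def)

lemma mpol_eval_single: "mpol_eval a (Poly_Mapping.single m c) = c * mev a m"
  by (cases "c = 0") (auto simp: mpol_eval_mev)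

lemma mpol_eval_sum: "mpol_eval a (sum f A) = (\<Sum>x\<in>A. mpol_eval a (f x))"
  by (induction A rule: infinite_finite_induct) (auto simp: mpol_eval_add)

lemma mpol_eval_1 [simp]: "mpol_eval a 1 = 1"
  by (simp only: single_one[symmetric] mpol_eval_single) (simp add: mev_def)

lemma poly_mapping_sum_single: "p = (\<Sum>m\<in>keys p. Poly_Mapping.single m (lookup p m))"
  by (rule poly_mapping_eqI) (auto simp: lookup_sum lookup_single when_def in_keys_iff)

lemma mpol_eval_mult: "mpol_eval a (p * q) = mpol_eval a p * mpol_eval a (q :: ('v, 'a::comm_ring_1) mpol)"
proof -
  have "p * q = (\<Sum>m\<in>keys p. Poly_Mapping.single m (lookup p m)) * (\<Sum>m\<in>keys q. Poly_Mapping.single m (lookup q m))"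
    using poly_mapping_sum_single[of p] poly_mapping_sum_single[of q] by simp
  also have "\<dots> = (\<Sum>m\<in>keys p. \<Sum>m'\<in>keys q. Poly_Mapping.single (m + m') (lookup p m * lookup q m'))"
    by (simp add: sum_product mult_single)
  finally have "mpol_eval a (p * q) = (\<Sum>m\<in>keys p. \<Sum>m'\<in>keys q. (lookup p m * lookup q m') * (mev a m * mev a m'))"
    by (simp add: mpol_eval_sum mpol_eval_single mev_add)
  also have "\<dots> = mpol_eval a p * mpol_eval a q"
    unfolding mpol_eval_mev sum_product by (intro sum.cong) (auto simp: ac_simps)
  finally show ?thesis .
qed

lemma mpol_eval_uminus: "mpol_eval a (- p) = - mpol_eval a (p :: ('v, 'a::comm_ring_1) mpol)"
  using mpol_eval_add[of a p "- p"] by (simp add: eq_neg_iff_add_eq_0 add.commute)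

lemma mpol_eval_diff: "mpol_eval a (p - q) = mpol_eval a p - mpol_eval a (q :: ('v, 'a::comm_ring_1) mpol)"
  using mpol_eval_add[of a p "- q"] by (simp add: mpol_eval_uminus)

lemma mpol_eval_const [simp]: "mpol_eval a (mpol_const c) = c"
  by (simp add: mpol_const_def mpol_eval_single mev_def)

lemma mpol_eval_var [simp]: "mpol_eval a (mpol_var v) = a v"
  by (simp add: mpol_var_def mpol_eval_single mev_def)

lemma comm_ring_hom_mpol_eval: "comm_ring_hom (mpol_eval a :: ('v, 'a::comm_ring_1) mpol \<Rightarrow> 'a)"
  by unfold_locales (auto simp: mpol_eval_add mpol_eval_mult)

text \<open>Dedekind's independence of characters: distinct monomials are distinct characters of the
  multiplicative monoid of points.\<close>

lemma monomials_independent: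
  fixes c :: "('v \<Rightarrow>\<^sub>0 nat) \<Rightarrow> 'a::field_char_0"
  assumes "finite F" "\<And>a. (\<Sum>m\<in>F. c m * mev a m) = 0" "m \<in> F"
  shows "c m = 0"
  using assms
proof (induction F arbitrary: c m)
  case (insert m0 F)
  have z: "c m = 0" if m: "m \<in> F" for m
  proof -
    have "m \<noteq> m0" using m insert.hyps by auto
    then obtain v where v: "lookup m v \<noteq> lookup m0 v" using poly_mapping_eqI by metis
    \<comment> \<open>In characteristic zero the powers of 2 are distinct, so this point separates
      the two monomials.\<close>
    define b where "b u = (if u = v then 2 else 1 :: 'a)" for u
    have mb: "mev b m' = 2 ^ lookup m' v" for m'
      using mev_superset[of "insert v (keys m')" m' b]
      by (cases "v \<in> keys m'") (auto simp: b_def prod.insert_remove prod.neutral in_keys_iff)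
    have "(\<Sum>m\<in>F. (c m * (mev b m - mev b m0)) * mev a m) = 0" for a
    proof -
      have "(\<Sum>m\<in>insert m0 F. c m * mev (\<lambda>v. a v * b v) m) - mev b m0 * (\<Sum>m\<in>insert m0 F. c m * mev a m) = 0"
        using insert.prems(1)[of "\<lambda>v. a v * b v"] insert.prems(1)[of a] by simp
      then show ?thesis using insert.hyps
        by (simp add: mev_mult algebra_simps sum.distrib sum_subtractf sum_distrib_left)
    qed
    from insert.IH[of "\<lambda>m. c m * (mev b m - mev b m0)", OF this m]
    have "c m * (2 ^ lookup m v - 2 ^ lookup m0 v) = 0" using mb by simp
    moreover have "(2::'a) ^ lookup m v \<noteq> 2 ^ lookup m0 v"
    proof
      assume "(2::'a) ^ lookup m v = 2 ^ lookup m0 v"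
      then have "of_nat (2 ^ lookup m v) = (of_nat (2 ^ lookup m0 v) :: 'a)" by simp
      then have "(2::nat) ^ lookup m v = 2 ^ lookup m0 v" using of_nat_eq_iff by blast
      then show False using v by simp
    qed
    ultimately show ?thesis by simp
  qed
  have "c m0 = 0" using insert.prems(1)[of "\<lambda>_. 1"] insert.hyps z by (simp add: mev_def)
  then show ?case using z insert.prems(2) by auto
qed simp

lemma mpol_eval_eq_0:
  fixes p :: "('v, 'a::field_char_0) mpol"
  assumes "\<And>a. mpol_eval a p = 0" shows "p = 0"
proof -
  have "lookup p m = 0" if "m \<in> keys p" for m
    by (rule monomials_independent[OF _ _ that]) (use assms in \<open>auto simp: mpol_eval_mev\<close>)
  then show ?thesis by (intro poly_mapping_eqI) (metis in_keys_iff lookup_zero)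
qed

section \<open>Algebraic dependence by counting monomials\<close>

lemma homogeneous_system:
  fixes c :: "'i \<Rightarrow> 'j \<Rightarrow> 'a::field"
  assumes "finite B" "finite A" "card B < card A"
  shows "\<exists>x. (\<exists>a\<in>A. x a \<noteq> 0) \<and> (\<forall>b\<in>B. (\<Sum>a\<in>A. x a * c a b) = 0)"
  using assms
proof (induction B arbitrary: A c)
  case empty
  then show ?case by (intro exI[of _ "\<lambda>_. 1"]) (auto simp: card_gt_0_iff)
next
  case (insert b B)
  show ?case
  proof (cases "\<forall>a\<in>A. c a b = 0")
    case True
    obtain x where "\<exists>a\<in>A. x a \<noteq> 0" "\<forall>b\<in>B. (\<Sum>a\<in>A. x a * c a b) = 0"
      using insert.IH[of A c] insert.prems insert.hyps by auto
    then show ?thesis using True by (intro exI[of _ x]) auto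
  next
    case False
    then obtain a0 where a0: "a0 \<in> A" "c a0 b \<noteq> 0" by auto
    let ?A = "A - {a0}" and ?c = "\<lambda>a b'. c a b' - c a b / c a0 b * c a0 b'"
    have "card B < card ?A" using insert.prems insert.hyps a0 by simp
    then obtain x where x: "\<exists>a\<in>?A. x a \<noteq> 0" "\<And>b'. b' \<in> B \<Longrightarrow> (\<Sum>a\<in>?A. x a * ?c a b') = 0"
      using insert.IH[of ?A ?c] insert.prems by auto
    define s where "s = (\<Sum>a\<in>?A. x a * c a b)"
    define y where "y = x(a0 := - s / c a0 b)"
    have split: "(\<Sum>a\<in>A. y a * c a b') = - s / c a0 b * c a0 b' + (\<Sum>a\<in>?A. x a * c a b')" for b'
      using a0 insert.prems(1) by (simp add: sum.remove[of A a0] y_def)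
    have "(\<Sum>a\<in>A. y a * c a b') = 0" if "b' \<in> insert b B" for b'
    proof (cases "b' = b")
      case True
      then show ?thesis using split[of b] a0 by (simp add: s_def)
    next
      case False
      then have "(\<Sum>a\<in>?A. x a * ?c a b') = 0" using x(2) that by auto
      moreover have "(\<Sum>a\<in>?A. x a * ?c a b') = (\<Sum>a\<in>?A. x a * c a b' - (x a * c a b) * (c a0 b' / c a0 b))"
        by (rule sum.cong) (auto simp: algebra_simps)
      then have "(\<Sum>a\<in>?A. x a * ?c a b') = (\<Sum>a\<in>?A. x a * c a b') - s * (c a0 b' / c a0 b)"
        by (simp only: sum_subtractf s_def sum_distrib_right)
      ultimately show ?thesis using split[of b'] by simp
    qed
    moreover have "\<exists>a\<in>A. y a \<noteq> 0" using x(1) by (auto simp: y_def)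
    ultimately show ?thesis by blast
  qed
qed

section \<open>Polynomials with exponents in a box\<close>

definition pmon :: "(nat \<times> nat) set \<Rightarrow> (nat \<times> nat \<Rightarrow> nat) \<Rightarrow> 'a::comm_ring_1 pt \<Rightarrow> 'a" where
  "pmon V \<beta> N = (\<Prod>v\<in>V. N (fst v) (snd v) ^ \<beta> v)"

text \<open>Bounding each exponent separately, rather than the total degree, makes the numbers of
  monomials plain powers.\<close>

definition boxed :: "(nat \<times> nat) set \<Rightarrow> nat \<Rightarrow> ('a::comm_ring_1 pt \<Rightarrow> 'a) set" where
  "boxed V D = {f. \<exists>c. \<forall>N. f N = (\<Sum>\<beta>\<in>PiE V (\<lambda>_. {..D}). c \<beta> * pmon V \<beta> N)}"

lemma boxedI:
  assumes V: "finite V" and A: "finite A" "\<And>a. a \<in> A \<Longrightarrow> \<phi> a \<in> PiE V (\<lambda>_. {..D})"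
    and f: "\<And>N. f N = (\<Sum>a\<in>A. c a * pmon V (\<phi> a) N)"
  shows "f \<in> boxed V D"
proof -
  let ?B = "PiE V (\<lambda>_. {..D})"
  have "f N = (\<Sum>\<beta>\<in>?B. (\<Sum>a\<in>{a\<in>A. \<phi> a = \<beta>}. c a) * pmon V \<beta> N)" for N
  proof -
    have "f N = (\<Sum>\<beta>\<in>?B. \<Sum>a\<in>{a\<in>A. \<phi> a = \<beta>}. c a * pmon V (\<phi> a) N)"
      unfolding f using V A by (subst sum.group) (auto intro: finite_PiE)
    also have "\<dots> = (\<Sum>\<beta>\<in>?B. (\<Sum>a\<in>{a\<in>A. \<phi> a = \<beta>}. c a) * pmon V \<beta> N)"
      by (auto simp: sum_distrib_right intro!: sum.cong)
    finally show ?thesis .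
  qed
  then show ?thesis unfolding boxed_def mem_Collect_eq
    by (intro exI[of _ "\<lambda>\<beta>. \<Sum>a\<in>{a\<in>A. \<phi> a = \<beta>}. c a"]) simp
qed

lemma boxed_mono: assumes "finite V" "f \<in> boxed V D" "D \<le> D'" shows "f \<in> boxed V D'"
proof -
  obtain c where "\<And>N. f N = (\<Sum>\<beta>\<in>PiE V (\<lambda>_. {..D}). c \<beta> * pmon V \<beta> N)" using assms(2) unfolding boxed_def by blast
  then show ?thesis using assms(1,3)
    by (intro boxedI[where A = "PiE V (\<lambda>_. {..D})" and \<phi> = "\<lambda>\<beta>. \<beta>" and c = c]) (auto intro: finite_PiE simp: PiE_iff)
qed

lemma boxed_const: "finite V \<Longrightarrow> (\<lambda>_. c) \<in> boxed V D"
  by (rule boxedI[where A = "{()}" and \<phi> = "\<lambda>_. \<lambda>v\<in>V. 0" and c = "\<lambda>_. c"]) (auto simp: pmon_def)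

lemma boxed_mult:
  assumes V: "finite V" and "f \<in> boxed V D" "g \<in> boxed V D'"
  shows "(\<lambda>N. f N * g N) \<in> boxed V (D + D')"
proof -
  let ?A = "PiE V (\<lambda>_. {..D})" and ?A' = "PiE V (\<lambda>_. {..D'})"
  obtain c c' where c: "\<And>N. f N = (\<Sum>\<beta>\<in>?A. c \<beta> * pmon V \<beta> N)" "\<And>N. g N = (\<Sum>\<beta>\<in>?A'. c' \<beta> * pmon V \<beta> N)"
    using assms(2,3) unfolding boxed_def by blast
  have m: "pmon V \<beta> N * pmon V \<beta>' N = pmon V (\<lambda>v\<in>V. \<beta> v + \<beta>' v) N" for \<beta> \<beta>' and N :: "'a pt"
    by (simp add: pmon_def power_add prod.distrib)
  show ?thesis
  proof (rule boxedI[where A = "?A \<times> ?A'" and \<phi> = "\<lambda>(\<beta>,\<beta>'). \<lambda>v\<in>V. \<beta> v + \<beta>' v" and c = "\<lambda>(\<beta>,\<beta>'). c \<beta> * c' \<beta>'"])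
    show "finite (?A \<times> ?A')" using V by (intro finite_cartesian_product finite_PiE) auto
    show "(case a of (\<beta>,\<beta>') \<Rightarrow> \<lambda>v\<in>V. \<beta> v + \<beta>' v) \<in> PiE V (\<lambda>_. {..D + D'})" if "a \<in> ?A \<times> ?A'" for a
      using that by (fastforce simp: PiE_iff intro: add_mono)
    show "f N * g N = (\<Sum>a\<in>?A \<times> ?A'. (case a of (\<beta>,\<beta>') \<Rightarrow> c \<beta> * c' \<beta>') * pmon V (case a of (\<beta>,\<beta>') \<Rightarrow> \<lambda>v\<in>V. \<beta> v + \<beta>' v) N)" for N
      unfolding c sum_product sum.cartesian_product
      by (rule sum.cong) (auto simp: m[symmetric] ac_simps)
  qed (rule V)
qed

lemma boxed_add:
  assumes V: "finite V" and "f \<in> boxed V D" "g \<in> boxed V D"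
  shows "(\<lambda>N. f N + g N) \<in> boxed V D"
proof -
  obtain c c' where c: "\<And>N. f N = (\<Sum>\<beta>\<in>PiE V (\<lambda>_. {..D}). c \<beta> * pmon V \<beta> N)" "\<And>N. g N = (\<Sum>\<beta>\<in>PiE V (\<lambda>_. {..D}). c' \<beta> * pmon V \<beta> N)"
    using assms(2,3) unfolding boxed_def by blast
  show ?thesis unfolding boxed_def mem_Collect_eq
    by (intro exI[of _ "\<lambda>\<beta>. c \<beta> + c' \<beta>"]) (simp add: c distrib_right sum.distrib)
qed

lemma pf_boxed:
  fixes f :: "'a::comm_ring_1 pt \<Rightarrow> 'a"
  assumes "finite V" "f \<in> pf V" shows "\<exists>D. f \<in> boxed V D"
  using assms(2)
proof induction
  case (const c)
  then show ?case using boxed_const[OF assms(1)] by blast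
next
  case (coord i j)
  have "(\<lambda>N::'a pt. N i j) \<in> boxed V 1"
  proof (rule boxedI[where A = "{()}" and \<phi> = "\<lambda>_. \<lambda>v\<in>V. if v = (i,j) then 1 else 0" and c = "\<lambda>_. 1"])
    fix N :: "'a pt"
    have "pmon V (\<lambda>v\<in>V. if v = (i,j) then 1 else 0) N = (\<Prod>v\<in>V. if v = (i,j) then N i j else 1)"
      unfolding pmon_def by (rule prod.cong) auto
    then show "N i j = (\<Sum>a\<in>{()}. 1 * pmon V (\<lambda>v\<in>V. if v = (i,j) then 1 else 0) N)"
      using coord assms(1) by (simp add: prod.delta)
  qed (use assms(1) in auto)
  then show ?case by blast
next
  case (add f g)
  then obtain D D' where "f \<in> boxed V D" "g \<in> boxed V D'" by blast
  then have "f \<in> boxed V (max D D')" "g \<in> boxed V (max D D')" using boxed_mono[OF assms(1)] by (metis max.cobounded1, metis max.cobounded2)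
  then show ?case using boxed_add[OF assms(1)] by blast
next
  case (mult f g)
  then show ?case using boxed_mult[OF assms(1)] by blast
qed

lemma boxed_power: "finite V \<Longrightarrow> f \<in> boxed V D \<Longrightarrow> (\<lambda>N. f N ^ k) \<in> boxed V (k * D)"
  by (induction k) (auto intro: boxed_const boxed_mult)

lemma boxed_prod: "finite V \<Longrightarrow> (\<And>i. i \<in> K \<Longrightarrow> f i \<in> boxed V D) \<Longrightarrow> (\<lambda>N. \<Prod>i\<in>K. f i N) \<in> boxed V (card K * D)"
  by (induction K rule: infinite_finite_induct) (auto intro: boxed_const boxed_mult)

definition expo :: "nat \<Rightarrow> (nat \<Rightarrow> nat) \<Rightarrow> nat \<Rightarrow>\<^sub>0 nat" where
  "expo k \<alpha> = (\<Sum>i<k. Poly_Mapping.single i (\<alpha> i))"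

lemma lookup_expo: "lookup (expo k \<alpha>) i = (if i < k then \<alpha> i else 0)"
  by (auto simp: expo_def lookup_sum lookup_single when_def)

text \<open>The d^k monomials in the g i with exponents below d all lie in the span of (k d e +
  1)^card V monomials in V. As card V < k, for large d there are more of the former, and a linear
  dependence between them is the polynomial q.\<close>

lemma algebraically_dependent:
  fixes g :: "nat \<Rightarrow> 'a::field pt \<Rightarrow> 'a"
  assumes V: "finite V" and k: "card V < k" and g: "\<And>i. i < k \<Longrightarrow> g i \<in> pf V"
  shows "\<exists>q :: (nat, 'a) mpol. q \<noteq> 0 \<and> mpol_vars q \<subseteq> {..<k} \<and> (\<forall>N. mpol_eval (\<lambda>i. g i N) q = 0)"
proof -
  have "\<forall>i\<in>{..<k}. \<exists>D. g i \<in> boxed V D" using pf_boxed[OF V] g by auto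
  from bchoice[OF this] obtain D where D: "\<And>i. i < k \<Longrightarrow> g i \<in> boxed V (D i)" by auto
  define e where "e = Max (D ` {..<k})"
  have gb: "g i \<in> boxed V e" if "i < k" for i
    by (rule boxed_mono[OF V D[OF that]]) (use that in \<open>auto simp: e_def\<close>)
  \<comment> \<open>The choice gives (k e + 1)^card V < d, hence (k d e + 1)^card V <= d^card V (k e
    + 1)^card V < d^(card V + 1) <= d^k.\<close>
  define d where "d = Suc ((Suc (k * e)) ^ card V)"
  let ?A = "PiE {..<k} (\<lambda>_. {..<d})" and ?B = "PiE V (\<lambda>_. {..k * (d * e)})"
  define H where "H \<alpha> N = (\<Prod>i<k. g i N ^ \<alpha> i)" for \<alpha> N
  have "H \<alpha> \<in> boxed V (k * (d * e))" if "\<alpha> \<in> ?A" for \<alpha>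
  proof -
    have "(\<lambda>N. g i N ^ \<alpha> i) \<in> boxed V (d * e)" if "i < k" for i
    proof (rule boxed_mono[OF V boxed_power[OF V gb[OF that]]])
      have "\<alpha> i < d" using \<open>\<alpha> \<in> ?A\<close> that by auto
      then show "\<alpha> i * e \<le> d * e" by simp
    qed
    then have "(\<lambda>N. \<Prod>i<k. g i N ^ \<alpha> i) \<in> boxed V (card {..<k} * (d * e))"
      by (intro boxed_prod[OF V]) auto
    then show ?thesis by (simp add: H_def[abs_def])
  qed
  then have "\<forall>\<alpha>\<in>?A. \<exists>c. \<forall>N. H \<alpha> N = (\<Sum>\<beta>\<in>?B. c \<beta> * pmon V \<beta> N)" unfolding boxed_def by blast
  from bchoice[OF this] obtain c where c: "\<And>\<alpha> N. \<alpha> \<in> ?A \<Longrightarrow> H \<alpha> N = (\<Sum>\<beta>\<in>?B. c \<alpha> \<beta> * pmon V \<beta> N)" by blast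
  have fA: "finite ?A" and fB: "finite ?B" using V by (auto intro: finite_PiE)
  have cardA: "card ?A = d ^ k" by (simp add: card_PiE)
  have "card ?B = (Suc (k * (d * e))) ^ card V" using V by (simp add: card_PiE)
  also have "\<dots> \<le> (d * Suc (k * e)) ^ card V" by (intro power_mono) (auto simp: d_def algebra_simps)
  also have "\<dots> = d ^ card V * Suc (k * e) ^ card V" by (simp only: power_mult_distrib)
  also have "\<dots> < d ^ card V * d" by (intro mult_strict_left_mono) (auto simp: d_def)
  also have "\<dots> = d ^ Suc (card V)" by simp
  also have "\<dots> \<le> d ^ k" using k by (intro power_increasing) (auto simp: d_def)
  finally have "card ?B < card ?A" using cardA by simp
  from homogeneous_system[OF fB fA this, of c]
  obtain x where x: "\<exists>\<alpha>\<in>?A. x \<alpha> \<noteq> 0" "\<And>\<beta>. \<beta> \<in> ?B \<Longrightarrow> (\<Sum>\<alpha>\<in>?A. x \<alpha> * c \<alpha> \<beta>) = 0" by blast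
  define q where "q = (\<Sum>\<alpha>\<in>?A. Poly_Mapping.single (expo k \<alpha>) (x \<alpha>))"
  have inj: "\<alpha> = \<alpha>'" if "\<alpha> \<in> ?A" "\<alpha>' \<in> ?A" "expo k \<alpha> = expo k \<alpha>'" for \<alpha> \<alpha>'
  proof (rule PiE_ext[OF that(1,2)])
    fix i assume "i \<in> {..<k}"
    then show "\<alpha> i = \<alpha>' i" using arg_cong[OF that(3), of "\<lambda>m. lookup m i"] by (simp add: lookup_expo)
  qed
  have "lookup q (expo k \<alpha>) = x \<alpha>" if "\<alpha> \<in> ?A" for \<alpha>
  proof -
    have "lookup q (expo k \<alpha>) = (\<Sum>\<alpha>'\<in>?A. if \<alpha>' = \<alpha> then x \<alpha> else 0)"
      unfolding q_def lookup_sum by (rule sum.cong) (use inj that in \<open>auto simp: lookup_single when_def\<close>)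
    then show ?thesis using that fA by simp
  qed
  then have "q \<noteq> 0" using x(1) by (metis lookup_zero)
  moreover have "mpol_vars q \<subseteq> {..<k}"
  proof
    fix v assume "v \<in> mpol_vars q"
    then obtain m where m: "m \<in> keys q" "v \<in> keys m" unfolding mpol_vars_def by blast
    have "lookup q m \<noteq> 0" using m(1) by (simp add: in_keys_iff)
    then obtain \<alpha> where "lookup (Poly_Mapping.single (expo k \<alpha>) (x \<alpha>)) m \<noteq> 0"
      unfolding q_def lookup_sum by (metis (lifting) sum.neutral)
    then have "m = expo k \<alpha>" by (auto simp: lookup_single when_def split: if_splits)
    then have "lookup (expo k \<alpha>) v \<noteq> 0" using m(2) by (simp add: in_keys_iff)
    then show "v \<in> {..<k}" by (auto simp: lookup_expo split: if_splits)
  qed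
  moreover have "mpol_eval (\<lambda>i. g i N) q = 0" for N
  proof -
    have "mev (\<lambda>i. g i N) (expo k \<alpha>) = H \<alpha> N" for \<alpha>
    proof -
      have "keys (expo k \<alpha>) \<subseteq> {..<k}" by (auto simp: in_keys_iff lookup_expo split: if_splits)
      then show ?thesis by (subst mev_superset[of "{..<k}"]) (auto simp: lookup_expo H_def)
    qed
    then have "mpol_eval (\<lambda>i. g i N) q = (\<Sum>\<alpha>\<in>?A. x \<alpha> * H \<alpha> N)"
      by (simp add: q_def mpol_eval_sum mpol_eval_single)
    also have "\<dots> = (\<Sum>\<alpha>\<in>?A. \<Sum>\<beta>\<in>?B. x \<alpha> * c \<alpha> \<beta> * pmon V \<beta> N)"
      by (rule sum.cong) (auto simp: c sum_distrib_left ac_simps)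
    also have "\<dots> = (\<Sum>\<beta>\<in>?B. (\<Sum>\<alpha>\<in>?A. x \<alpha> * c \<alpha> \<beta>) * pmon V \<beta> N)"
      by (subst sum.swap) (simp add: sum_distrib_right)
    also have "\<dots> = 0" using x(2) by simp
    finally show ?thesis .
  qed
  ultimately show ?thesis by blast
qed

section \<open>The coadjoint action in coordinates\<close>

lemma addrow_UT: "l < k \<Longrightarrow> k < n \<Longrightarrow> addrow_mat n t k l \<in> carrier (UT n)"
  by (auto simp: UT_def)

text \<open>Gaussian elimination, working in the first row k that has a nonzero entry below the
  diagonal. All earlier rows are unit vectors, so one row operation clears exactly one entry and the
  number of nonzero entries drops.\<close>

lemma UT_induct [consumes 1, case_names one addrow]:
  fixes g :: "'a::field mat"
  assumes g: "g \<in> carrier (UT n)" and one: "Q (1\<^sub>m n)"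
    and step: "\<And>g k l t. g \<in> carrier (UT n) \<Longrightarrow> Q g \<Longrightarrow> l < k \<Longrightarrow> k < n \<Longrightarrow> Q (addrow_mat n t k l * g)"
  shows "Q g"
  using g
proof (induction "card {(i,j). j < i \<and> i < n \<and> g $$ (i,j) \<noteq> 0}" arbitrary: g rule: less_induct)
  case less
  let ?s = "\<lambda>g. {(i,j). j < i \<and> i < n \<and> (g::'a mat) $$ (i,j) \<noteq> 0}"
  have fin: "finite (?s h)" for h by (rule finite_subset[of _ "{..<n} \<times> {..<n}"]) auto
  have gc: "g \<in> carrier_mat n n" using less(2) by (auto simp: UT_def)
  show ?case
  proof (cases "?s g = {}")
    case True
    have "g = 1\<^sub>m n"
    proof (rule eq_matI)
      fix i j assume "i < dim_row (1\<^sub>m n :: 'a mat)" "j < dim_col (1\<^sub>m n :: 'a mat)"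
      then show "g $$ (i,j) = 1\<^sub>m n $$ (i,j)"
        using True less(2) by (cases i j rule: linorder_cases) (auto simp: UT_def)
    qed (use gc in auto)
    then show ?thesis using one by simp
  next
    case False
    define k where "k = (LEAST i. \<exists>j. (i,j) \<in> ?s g)"
    have "\<exists>j. (k,j) \<in> ?s g" unfolding k_def by (rule LeastI_ex) (use False in auto)
    then obtain l where kl: "l < k" "k < n" "g $$ (k,l) \<noteq> 0" by auto
    have row: "g $$ (l,j) = 0" if "j < l" for j
      using not_less_Least[of l "\<lambda>i. \<exists>j. (i,j) \<in> ?s g"] kl that unfolding k_def[symmetric] by auto
    let ?t = "g $$ (k,l)" and ?h = "addrow_mat n (- g $$ (k,l)) k l * g"
    have eq: "?h = addrow (- ?t) k l g" by (rule addrow_mat[symmetric, OF gc]) (use kl in auto)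
    have dim: "dim_row g = n" "dim_col g = n" using gc by auto
    have rowl: "g $$ (l,j) = (if j = l then 1 else 0)" if "j < n" for j
      using that row[of j] less(2) kl by (cases j l rule: linorder_cases) (auto simp: UT_def)
    have hij: "?h $$ (i,j) = (if i = k \<and> j = l then 0 else g $$ (i,j))" if "i < n" "j < n" for i j
      unfolding eq using that dim kl rowl by auto
    have hc: "?h \<in> carrier_mat n n" by (rule mult_carrier_mat[OF _ gc]) simp
    have h: "?h \<in> carrier (UT n)"
      using less(2) hij hc kl by (auto simp: UT_def simp del: index_mult_mat)
    have sub: "?s ?h \<subseteq> ?s g - {(k,l)}"
    proof
      fix p assume "p \<in> ?s ?h"
      then obtain i j where p: "p = (i,j)" "j < i" "i < n" "?h $$ (i,j) \<noteq> 0" by blast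
      then show "p \<in> ?s g - {(k,l)}" using hij[of i j] by (auto split: if_splits simp del: index_mult_mat)
    qed
    have "card (?s ?h) \<le> card (?s g - {(k,l)})" by (rule card_mono[OF _ sub]) (use fin in blast)
    also have "\<dots> < card (?s g)" by (rule card_Diff1_less[OF fin]) (use kl in simp)
    finally have "card (?s ?h) < card (?s g)" .
    from less(1)[OF this h] have "Q (addrow_mat n ?t k l * ?h)" by (intro step[OF h _ kl(1,2)])
    also have "addrow_mat n ?t k l * ?h = (addrow_mat n ?t k l * addrow_mat n (- ?t) k l) * g"
      using gc by (intro assoc_mult_mat[symmetric, of _ n n _ n _ n]) auto
    also have "\<dots> = g" using addrow_mat_inv[of k n l ?t] kl gc by simp
    finally show ?thesis .
  qed
qed

lemma UT_simps: "mult (UT n) = (*)" "one (UT n) = 1\<^sub>m n" "g \<in> carrier (UT n) \<Longrightarrow> g \<in> carrier_mat n n"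
  by (auto simp: UT_def)

lemma ut_simps: "x \<in> ut n \<Longrightarrow> x \<in> carrier_mat n n" "x \<in> ut n \<Longrightarrow> z \<in> ut n \<Longrightarrow> x + z \<in> ut n"
  "x \<in> ut n \<Longrightarrow> a \<cdot>\<^sub>m x \<in> ut n"
  by (auto simp: ut_def)

lemma coadj_apply: "f \<in> ut_dual n \<Longrightarrow> x \<in> ut n \<Longrightarrow> coadj n g f x = f (inv\<^bsub>UT n\<^esub> g * x * g)"
  by (simp add: coadj_def)

lemma coadj_dual:
  assumes g: "g \<in> carrier (UT n)" and f: "f \<in> ut_dual n"
  shows "coadj n g f \<in> ut_dual n"
proof -
  interpret group "UT n" by (rule group_UT)
  let ?h = "inv\<^bsub>UT n\<^esub> g"
  have h: "?h \<in> carrier (UT n)" using g by simp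
  have hc: "?h \<in> carrier_mat n n" "g \<in> carrier_mat n n" using UT_simps(3) g h by auto
  have add: "?h * (x + z) * g = ?h * x * g + ?h * z * g" if "x \<in> ut n" "z \<in> ut n" for x z
  proof -
    have c: "x \<in> carrier_mat n n" "z \<in> carrier_mat n n" using that ut_simps(1) by auto
    then show ?thesis using hc by (simp add: mult_add_distrib_mat[of _ n n] add_mult_distrib_mat[of _ n n])
  qed
  have smult: "?h * (a \<cdot>\<^sub>m x) * g = a \<cdot>\<^sub>m (?h * x * g)" if "x \<in> ut n" for a x
  proof -
    have xc: "x \<in> carrier_mat n n" using that ut_simps(1) by auto
    show ?thesis
      unfolding mult_smult_distrib[OF hc(1) xc]
      by (rule mult_smult_assoc_mat[OF mult_carrier_mat[OF hc(1) xc] hc(2)])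
  qed
  have "coadj n g f (x + z) = coadj n g f x + coadj n g f z" if "x \<in> ut n" "z \<in> ut n" for x z
    using that f UT_conj[OF g h] by (simp add: coadj_apply ut_simps add) (auto simp: ut_dual_def)
  moreover have "coadj n g f (a \<cdot>\<^sub>m x) = a * coadj n g f x" if "x \<in> ut n" for a x
    using that f UT_conj[OF g h] by (simp add: coadj_apply ut_simps smult) (auto simp: ut_dual_def)
  moreover have "coadj n g f \<in> extensional (ut n)" using f by (simp add: coadj_def)
  ultimately show ?thesis by (simp add: ut_dual_def)
qed

lemma coadj_mult:
  fixes f :: "'a::field mat \<Rightarrow> 'a"
  assumes g: "g \<in> carrier (UT n)" and h: "h \<in> carrier (UT n)" and f: "f \<in> ut_dual n"
  shows "coadj n (h * g) f = coadj n h (coadj n g f)"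
proof -
  interpret group "UT n" by (rule group_UT)
  have i: "inv\<^bsub>UT n\<^esub> (h * g) = inv\<^bsub>UT n\<^esub> g * inv\<^bsub>UT n\<^esub> h"
    using inv_mult_group[OF h g] by (simp add: UT_simps)
  have c: "g \<in> carrier_mat n n" "h \<in> carrier_mat n n" "inv\<^bsub>UT n\<^esub> g \<in> carrier_mat n n" "inv\<^bsub>UT n\<^esub> h \<in> carrier_mat n n"
    using g h UT_simps(3) by auto
  show ?thesis
  proof (rule extensionalityI[of _ "ut n"])
    fix x :: "'a mat" assume x: "x \<in> ut n"
    have xc: "x \<in> carrier_mat n n" using x ut_simps by blast
    have hx: "inv\<^bsub>UT n\<^esub> h * x * h \<in> ut n" using UT_conj[OF h _ x] h by simp
    have "inv\<^bsub>UT n\<^esub> g * inv\<^bsub>UT n\<^esub> h * x * (h * g) = inv\<^bsub>UT n\<^esub> g * (inv\<^bsub>UT n\<^esub> h * x * h) * g"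
      using c xc by (simp add: assoc_mult_mat[of _ n n _ n _ n] mult_carrier_mat[of _ n n])
    then show "coadj n (h * g) f x = coadj n h (coadj n g f) x"
      using x hx f coadj_dual[OF g f] by (simp add: coadj_apply i)
  qed (use f coadj_dual[OF g f] in \<open>auto simp: coadj_def\<close>)
qed

lemma coadj_one:
  fixes f :: "'a::field mat \<Rightarrow> 'a"
  assumes f: "f \<in> ut_dual n" shows "coadj n (1\<^sub>m n) f = f"
proof -
  interpret group "UT n :: 'a mat monoid" by (rule group_UT)
  have i: "inv\<^bsub>UT n\<^esub> (1\<^sub>m n) = (1\<^sub>m n :: 'a mat)" using inv_one by (simp add: UT_simps)
  show ?thesis
  proof (rule extensionalityI[of _ "ut n"])
    fix x :: "'a mat" assume x: "x \<in> ut n"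
    have "1\<^sub>m n * x * 1\<^sub>m n = x" using ut_simps(1)[OF x] by simp
    then show "coadj n (1\<^sub>m n) f x = f x" using coadj_apply[OF f x, of "1\<^sub>m n"] i by simp
  qed (use f in \<open>auto simp: coadj_def ut_dual_def\<close>)
qed

section \<open>Linear forms as arrays\<close>

definition marr :: "nat \<Rightarrow> ('a::field mat \<Rightarrow> 'a) \<Rightarrow> 'a pt" where
  "marr n f i j = f (y_unit n i j)"

lemma y_unit_ut: "(i,j) \<in> lowp {1..n} \<Longrightarrow> y_unit n i j \<in> ut n"
  by (auto simp: y_unit_def ut_def lowp_def)

text \<open>For g = E + t E_ba, conjugating E_ij to g^-1 E_ij g subtracts t E_bj if i = a and adds t
  E_ia if j = b. The quadratic term would need i = a < b = j, which is excluded below the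
  diagonal.\<close>

lemma marr_addrow:
  assumes f: "f \<in> ut_dual n" and ab: "1 \<le> a" "a < b" "b \<le> n"
  shows "agree {1..n} (marr n (coadj n (addrow_mat n t (b - 1) (a - 1)) f)) (mv a b t (marr n f))"
  unfolding agree_def
proof (intro ballI impI)
  fix i j assume "i \<in> {1..n}" "j \<in> {1..n}" "j < i"
  then have ij: "(i,j) \<in> lowp {1..n}" "1 \<le> j" "i \<le> n" "j < i" by (auto simp: lowp_def)
  interpret group "UT n" by (rule group_UT)
  let ?e = "addrow_mat n t (b - 1) (a - 1)" and ?e' = "addrow_mat n (- t) (b - 1) (a - 1)" and ?y = "y_unit n i j :: 'a mat"
  have kl: "a - 1 < b - 1" "b - 1 < n" using ab by auto
  have "inv\<^bsub>UT n\<^esub> ?e = ?e'"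
  proof (rule inv_equality)
    show "?e' \<otimes>\<^bsub>UT n\<^esub> ?e = \<one>\<^bsub>UT n\<^esub>"
      using addrow_mat_inv[of "b - 1" n "a - 1" "- t"] kl by (simp add: UT_simps)
  qed (use addrow_UT[OF kl] in auto)
  have yc: "?y \<in> carrier_mat n n" by (simp add: y_unit_def)
  have "?e' * ?y = addrow (- t) (b - 1) (a - 1) ?y" by (rule addrow_mat[symmetric, OF yc]) (use kl in auto)
  moreover have "addrow (- t) (b - 1) (a - 1) ?y * ?e = addcol t (a - 1) (b - 1) (addrow (- t) (b - 1) (a - 1) ?y)"
    by (rule addcol_mat[symmetric, of _ n]) (use kl yc in auto)
  ultimately have e: "inv\<^bsub>UT n\<^esub> ?e * ?y * ?e = addcol t (a - 1) (b - 1) (addrow (- t) (b - 1) (a - 1) ?y)"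
    by (simp only: \<open>inv\<^bsub>UT n\<^esub> ?e = ?e'\<close>)
  have add: "f (x + s \<cdot>\<^sub>m z) = f x + s * f z" if "x \<in> ut n" "z \<in> ut n" for x z s
    using f that ut_simps(3)[of z n s] unfolding ut_dual_def by auto
  have "marr n (coadj n ?e f) i j = f (addcol t (a - 1) (b - 1) (addrow (- t) (b - 1) (a - 1) ?y))"
    using coadj_apply[OF f y_unit_ut[OF ij(1)]] e by (simp add: marr_def)
  also have "\<dots> = mv a b t (marr n f) i j"
  proof -
    consider "i = a" | "j = b" | "i \<noteq> a" "j \<noteq> b" by blast
    then show ?thesis
    proof cases
      case 1
      have l: "(b,j) \<in> lowp {1..n}" using ij ab 1 by (auto simp: lowp_def)
      have "addcol t (a - 1) (b - 1) (addrow (- t) (b - 1) (a - 1) ?y) = ?y + (- t) \<cdot>\<^sub>m y_unit n b j"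
        by (rule eq_matI) (use ij ab 1 in \<open>auto simp: y_unit_def\<close>)
      then show ?thesis using add[OF y_unit_ut[OF ij(1)] y_unit_ut[OF l], of "- t"] ij ab 1
        by (simp add: mv_def marr_def)
    next
      case 2
      have l: "(i,a) \<in> lowp {1..n}" using ij ab 2 by (auto simp: lowp_def)
      have "addcol t (a - 1) (b - 1) (addrow (- t) (b - 1) (a - 1) ?y) = ?y + t \<cdot>\<^sub>m y_unit n i a"
        by (rule eq_matI) (use ij ab 2 in \<open>auto simp: y_unit_def\<close>)
      then show ?thesis using add[OF y_unit_ut[OF ij(1)] y_unit_ut[OF l], of t] ij ab 2
        by (simp add: mv_def marr_def)
    next
      case 3
      have "addcol t (a - 1) (b - 1) (addrow (- t) (b - 1) (a - 1) ?y) = ?y"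
        by (rule eq_matI) (use ij ab 3 in \<open>auto simp: y_unit_def\<close>)
      then show ?thesis using 3 by (simp add: mv_def marr_def)
    qed
  qed
  finally show "marr n (coadj n ?e f) i j = mv a b t (marr n f) i j" .
qed

lemma orb_coadj:
  assumes g: "g \<in> carrier (UT n)" and f: "f \<in> ut_dual n"
  shows "orb {1..n} (marr n f) (marr n (coadj n g f))"
  using g
proof (induction rule: UT_induct)
  case one
  then show ?case using f by (simp add: coadj_one)
next
  case (addrow g k l t)
  have ab: "1 \<le> Suc l" "Suc l < Suc k" "Suc k \<le> n" using addrow by auto
  have "agree {1..n} (marr n (coadj n (addrow_mat n t k l) (coadj n g f))) (mv (Suc l) (Suc k) t (marr n (coadj n g f)))"
    using marr_addrow[OF coadj_dual[OF addrow(1) f] ab] by simp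
  then show ?case
    unfolding coadj_mult[OF addrow(1) addrow_UT[OF addrow(2,3)] f]
    by (intro orb.step[OF addrow(4), of "Suc l" "Suc k"]) (use ab in auto)
qed

lemma coadj_orb:
  assumes "orb {1..n} (marr n f) N" and f: "f \<in> ut_dual n"
  shows "\<exists>g\<in>carrier (UT n). agree {1..n} (marr n (coadj n g f)) N"
  using assms(1)
proof induction
  case (refl N)
  interpret group "UT n" by (rule group_UT)
  have "1\<^sub>m n \<in> carrier (UT n)" using one_closed by (simp add: UT_simps)
  then show ?case using refl f coadj_one agree_sym by metis
next
  case (step N a b N' t)
  then obtain g where g: "g \<in> carrier (UT n)" "agree {1..n} (marr n (coadj n g f)) N" by blast
  interpret group "UT n" by (rule group_UT)
  have ab: "1 \<le> a" "a < b" "b \<le> n" using step by auto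
  let ?e = "addrow_mat n t (b - 1) (a - 1)"
  have e: "?e \<in> carrier (UT n)" using ab by (intro addrow_UT) auto
  have "agree {1..n} (marr n (coadj n (?e * g) f)) (mv a b t (marr n (coadj n g f)))"
    unfolding coadj_mult[OF g(1) e f] by (rule marr_addrow[OF coadj_dual[OF g(1) f] ab])
  moreover have "agree {1..n} (mv a b t (marr n (coadj n g f))) (mv a b t N)"
    by (rule agree_mv[OF g(2)]) (use step in auto)
  ultimately have "agree {1..n} (marr n (coadj n (?e * g) f)) N'"
    using agree_trans agree_sym step(5) by blast
  moreover have "?e * g \<in> carrier (UT n)" using m_closed[OF e g(1)] by (simp add: UT_simps)
  ultimately show ?case by blast
qed

lemma marr_surj: "\<exists>f\<in>ut_dual n. agree {1..n} (marr n f) M"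
proof -
  define f where "f = (\<lambda>x\<in>ut n. \<Sum>(i,j)\<in>lowp {1..n}. x $$ (i - 1, j - 1) * M i j)"
  have fin: "finite (lowp {1..n})" by (rule finite_subset[of _ "{1..n} \<times> {1..n}"]) (auto simp: lowp_def)
  have "f \<in> ut_dual n"
    unfolding ut_dual_def
  proof (intro CollectI conjI ballI allI)
    fix x z :: "'a mat" assume x: "x \<in> ut n" "z \<in> ut n"
    have "dim_row x = n" "dim_col x = n" "dim_row z = n" "dim_col z = n" using x by (auto simp: ut_def)
    then show "f (x + z) = f x + f z"
      using x ut_simps(2)[OF x] by (auto simp: f_def sum.distrib[symmetric] lowp_def distrib_right intro!: sum.cong)
  next
    fix a and x :: "'a mat" assume x: "x \<in> ut n"
    have "dim_row x = n" "dim_col x = n" using x by (auto simp: ut_def)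
    then show "f (a \<cdot>\<^sub>m x) = a * f x"
      using x ut_simps(3)[OF x] by (auto simp: f_def sum_distrib_left lowp_def intro!: sum.cong)
  qed (simp add: f_def)
  moreover have "marr n f i j = M i j" if ij: "(i,j) \<in> lowp {1..n}" for i j
  proof -
    have "marr n f i j = (\<Sum>p\<in>lowp {1..n}. if p = (i,j) then M i j else 0)"
      unfolding marr_def f_def using y_unit_ut[OF ij]
      by (auto simp: y_unit_def lowp_def intro!: sum.cong)
    then show ?thesis using fin ij by simp
  qed
  ultimately show ?thesis by (intro bexI[of _ f]) (auto simp: agree_def lowp_def)
qed

section \<open>The generators in the polynomial ring\<close>

text \<open>Just the closure needed to keep Leibniz expansions inside C; it is applied to the
  carrier of \<open>Sym n\<close> and to polynomials with coefficients there.\<close>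

definition ring_closed :: "'b::comm_ring_1 set \<Rightarrow> bool" where
  "ring_closed C \<longleftrightarrow> 0 \<in> C \<and> 1 \<in> C \<and> (\<forall>a\<in>C. - a \<in> C) \<and> (\<forall>a\<in>C. \<forall>b\<in>C. a + b \<in> C \<and> a * b \<in> C)"

lemma closed_sum: "ring_closed C \<Longrightarrow> (\<And>x. x \<in> A \<Longrightarrow> f x \<in> C) \<Longrightarrow> sum f A \<in> C"
  by (induction A rule: infinite_finite_induct) (auto simp: ring_closed_def)

lemma closed_prod: "ring_closed C \<Longrightarrow> (\<And>x. x \<in> A \<Longrightarrow> f x \<in> C) \<Longrightarrow> prod f A \<in> C"
  by (induction A rule: infinite_finite_induct) (auto simp: ring_closed_def)

lemma closed_mnr:
  assumes "ring_closed C" "length cs = length rs" "\<And>i j. i \<in> set rs \<Longrightarrow> j \<in> set cs \<Longrightarrow> A i j \<in> C"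
  shows "mnr A rs cs \<in> C"
proof -
  have "signof p \<in> C" for p :: "nat \<Rightarrow> nat" using assms(1) by (auto simp: sign_def ring_closed_def)
  moreover have "(\<Prod>i\<in>{0..<length rs}. A (rs ! i) (cs ! p i)) \<in> C" if "p permutes {0..<length rs}" for p
    using permutes_in_image[OF that] assms by (intro closed_prod) auto
  ultimately show ?thesis unfolding mnr_expand[OF assms(2)]
    using assms(1) by (intro closed_sum) (auto simp: ring_closed_def)
qed

lemma closed_coeffs: assumes "ring_closed C" shows "ring_closed {p. \<forall>k. coeff p k \<in> C}"
proof -
  have "coeff (p * q) k \<in> C" if "\<forall>k. coeff p k \<in> C" "\<forall>k. coeff q k \<in> C" for p q k
    unfolding coeff_mult using assms that by (intro closed_sum) (auto simp: ring_closed_def)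
  moreover have "coeff 1 k \<in> C" for k using assms by (cases k) (auto simp: ring_closed_def)
  ultimately show ?thesis using assms by (auto simp: ring_closed_def)
qed

lemma (in comm_ring_hom) hom_mnr: "hom (mnr A rs cs) = mnr (\<lambda>i j. hom (A i j)) rs cs"
proof -
  have "map_mat hom (mat (length rs) (length rs) (\<lambda>(a,b). A (rs ! a) (cs ! b))) =
     mat (length rs) (length rs) (\<lambda>(a,b). hom (A (rs ! a) (cs ! b)))"
    by (rule eq_matI) auto
  then show ?thesis unfolding mnr_def hom_det[symmetric] by simp
qed

lemma (in comm_ring_hom) map_poly_hom: "comm_ring_hom (map_poly hom)"
  by unfold_locales
    (auto intro!: poly_eqI simp: coeff_map_poly coeff_mult hom_distribs)

lemma pick_nth:
  assumes s: "sorted_wrt (<) L" and a: "a < length L"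
  shows "pick (set L) a = L ! a"
proof -
  have d: "distinct L" using s strict_sorted_iff by blast
  have "{x \<in> set L. x < L ! a} = (\<lambda>i. L ! i) ` {..<a}"
  proof (intro equalityI subsetI)
    fix x assume "x \<in> {x \<in> set L. x < L ! a}"
    then obtain i where i: "i < length L" "x = L ! i" "L ! i < L ! a" by (auto simp: in_set_conv_nth)
    have "i < a"
    proof (rule ccontr)
      assume "\<not> i < a"
      then have "a = i \<or> L ! a < L ! i" using sorted_wrt_nth_less[OF s, of a i] i by (cases "a = i") auto
      then show False using i by auto
    qed
    then show "x \<in> (\<lambda>i. L ! i) ` {..<a}" using i by auto
  next
    fix x assume "x \<in> (\<lambda>i. L ! i) ` {..<a}"
    then show "x \<in> {x \<in> set L. x < L ! a}" using sorted_wrt_nth_less[OF s] a by auto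
  qed
  moreover have "inj_on (\<lambda>i. L ! i) {..<a}" using d a by (auto simp: inj_on_def nth_eq_iff_index_eq)
  ultimately have "card {x \<in> set L. x < L ! a} = a" by (simp add: card_image)
  then show ?thesis using pick_card_in_set[of "L ! a" "set L"] a by simp
qed

lemma minor_mnr:
  assumes A: "A \<in> carrier_mat n n" and len: "length cs = length rs"
    and rs: "sorted_wrt (<) rs" "set rs \<subseteq> {1..n}" and cs: "sorted_wrt (<) cs" "set cs \<subseteq> {1..n}"
  shows "minor A (set rs) (set cs) = mnr (\<lambda>i j. A $$ (i - 1, j - 1)) rs cs"
proof -
  have aux: "card {i. i < n \<and> i \<in> (\<lambda>i. i - 1) ` set L} = length L" "\<And>a. a < length L \<Longrightarrow> pick ((\<lambda>i. i - 1) ` set L) a = L ! a - 1"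
    if L: "sorted_wrt (<) L" "set L \<subseteq> {1..n}" for L
  proof -
    have s: "sorted_wrt (<) (map (\<lambda>i. i - 1) L)"
      unfolding sorted_wrt_map by (rule sorted_wrt_mono_rel[OF _ L(1)]) (use L(2) in \<open>auto simp: subset_eq intro!: diff_less_mono\<close>)
    have "{i. i < n \<and> i \<in> (\<lambda>i. i - 1) ` set L} = set (map (\<lambda>i. i - 1) L)" using L(2) by (fastforce simp: subset_eq)
    then show "card {i. i < n \<and> i \<in> (\<lambda>i. i - 1) ` set L} = length L"
      using s by (metis distinct_card length_map strict_sorted_iff)
    show "pick ((\<lambda>i. i - 1) ` set L) a = L ! a - 1" if "a < length L" for a
      using pick_nth[OF s, of a] that by simp
  qed
  have dim: "dim_row A = n" "dim_col A = n" using A by auto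
  have "submatrix A ((\<lambda>i. i - 1) ` set rs) ((\<lambda>i. i - 1) ` set cs)
     = mat (length rs) (length rs) (\<lambda>(a,b). A $$ (rs ! a - 1, cs ! b - 1))"
    unfolding submatrix_def dim aux(1)[OF rs] aux(1)[OF cs] len
    by (rule eq_matI) (use aux(2)[OF rs] aux(2)[OF cs] len in auto)
  then show ?thesis by (simp add: minor_def mnr_def)
qed

text \<open>\<open>Phi\<close> is zero on and above the diagonal while an array may have any entries
  there: evaluating a formal minor at N gives the minor of \<open>lown n N\<close>.\<close>

definition lown :: "nat \<Rightarrow> 'a::zero pt \<Rightarrow> 'a pt" where
  "lown n N i j = (if (i,j) \<in> lowp {1..n} then N i j else 0)"

abbreviation "ev N \<equiv> mpol_eval (\<lambda>(i,j). N i j)"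

lemma carrier_Sym: "carrier (Sym n) = {p. mpol_vars p \<subseteq> lowp {1..n}}"
  by (auto simp: Sym_def lowp_def)

lemma closed_Sym: "ring_closed (carrier (Sym n) :: (nat \<times> nat, 'a::field) mpol set)"
proof -
  interpret cring "Sym n :: (nat \<times> nat, 'a) mpol ring" by (rule cring_Sym)
  have "0 \<in> carrier (Sym n :: (nat \<times> nat, 'a) mpol ring)" "1 \<in> carrier (Sym n :: (nat \<times> nat, 'a) mpol ring)"
    using zero_closed one_closed by (simp_all add: Sym_def)
  moreover have "- a \<in> carrier (Sym n)" if "a \<in> carrier (Sym n)" for a :: "(nat \<times> nat, 'a) mpol"
    using that by (auto simp: Sym_def mpol_vars_def)
  moreover have "a + b \<in> carrier (Sym n)" "a * b \<in> carrier (Sym n)"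
    if "a \<in> carrier (Sym n)" "b \<in> carrier (Sym n)" for a b :: "(nat \<times> nat, 'a) mpol"
    using a_closed[OF that] m_closed[OF that] by (simp_all add: Sym_def)
  ultimately show ?thesis unfolding ring_closed_def by blast
qed

lemma mpol_vars_simps [simp]: "mpol_vars (mpol_const c) = {}"
  "mpol_vars (mpol_var v :: ('v, 'a::zero_neq_one) mpol) = {v}" "mpol_vars 0 = {}"
  by (auto simp: mpol_vars_def mpol_const_def mpol_var_def)

section \<open>Values of the formal minors\<close>

lemma Phi_entry:
  assumes "i \<in> {1..n}" "j \<in> {1..n}"
  shows "Phi n $$ (i - 1, j - 1) = (if j < i then mpol_var (i,j) else 0)"
  using assms by (auto simp: Phi_def)

lemma Phi_Sym: "i \<in> {1..n} \<Longrightarrow> j \<in> {1..n} \<Longrightarrow> Phi n $$ (i - 1, j - 1) \<in> carrier (Sym n)"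
  by (subst Phi_entry) (auto simp: carrier_Sym lowp_def)

lemma ev_Phi: "i \<in> {1..n} \<Longrightarrow> j \<in> {1..n} \<Longrightarrow> ev N (Phi n $$ (i - 1, j - 1)) = lown n N i j"
  by (subst Phi_entry) (auto simp: lown_def lowp_def)

lemma mnr_cong:
  assumes "length cs = length rs" "\<And>i j. i \<in> set rs \<Longrightarrow> j \<in> set cs \<Longrightarrow> A i j = B i j"
  shows "mnr A rs cs = mnr B rs cs"
  unfolding mnr_def by (rule arg_cong[of _ _ det], rule eq_matI) (use assms in auto)

lemma minor_Phi:
  fixes N :: "'a::field pt"
  assumes "length cs = length rs" "sorted_wrt (<) rs" "set rs \<subseteq> {1..n}" "sorted_wrt (<) cs" "set cs \<subseteq> {1..n}"
  shows "(minor (Phi n) (set rs) (set cs) :: (nat \<times> nat, 'a) mpol) \<in> carrier (Sym n)"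
    and "ev N (minor (Phi n) (set rs) (set cs)) = mnr (lown n N) rs cs"
proof -
  have eq: "(minor (Phi n) (set rs) (set cs) :: (nat \<times> nat, 'a) mpol) = mnr (\<lambda>i j. Phi n $$ (i - 1, j - 1)) rs cs"
    by (rule minor_mnr[OF _ assms]) (simp add: Phi_def)
  have sub: "i \<in> {1..n}" if "i \<in> set rs \<or> i \<in> set cs" for i using that assms by auto
  show "(minor (Phi n) (set rs) (set cs) :: (nat \<times> nat, 'a) mpol) \<in> carrier (Sym n)"
    unfolding eq
  proof (rule closed_mnr[OF closed_Sym assms(1)])
    fix i j assume "i \<in> set rs" "j \<in> set cs"
    then show "Phi n $$ (i - 1, j - 1) \<in> carrier (Sym n)" by (intro Phi_Sym sub) auto
  qed
  interpret comm_ring_hom "ev N" by (rule comm_ring_hom_mpol_eval)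
  show "ev N (minor (Phi n) (set rs) (set cs)) = mnr (lown n N) rs cs"
    unfolding eq hom_mnr
  proof (rule mnr_cong[OF assms(1)])
    fix i j assume "i \<in> set rs" "j \<in> set cs"
    then show "ev N (Phi n $$ (i - 1, j - 1)) = lown n N i j" by (intro ev_Phi sub) auto
  qed
qed

lemma coeff_minor_Phi_tau:
  fixes N :: "'a::field pt"
  assumes "length cs = length rs" "sorted_wrt (<) rs" "set rs \<subseteq> {1..n}" "sorted_wrt (<) cs" "set cs \<subseteq> {1..n}"
  shows "(coeff (minor (Phi_tau n) (set rs) (set cs)) k :: (nat \<times> nat, 'a) mpol) \<in> carrier (Sym n)"
    and "ev N (coeff (minor (Phi_tau n) (set rs) (set cs)) k) = coeff (mnr (charm (lown n N)) rs cs) k"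
proof -
  have eq: "(minor (Phi_tau n) (set rs) (set cs) :: (nat \<times> nat, 'a) mpol poly) = mnr (\<lambda>i j. Phi_tau n $$ (i - 1, j - 1)) rs cs"
    by (rule minor_mnr[OF _ assms]) (simp add: Phi_tau_def Phi_def)
  have sub: "i \<in> {1..n}" if "i \<in> set rs \<or> i \<in> set cs" for i using that assms by auto
  have ent: "(Phi_tau n :: (nat \<times> nat, 'a) mpol poly mat) $$ (i - 1, j - 1) = [:if i = j then 1 else 0, Phi n $$ (i - 1, j - 1):]"
    if "i \<in> {1..n}" "j \<in> {1..n}" for i j
    using that by (auto simp: Phi_tau_def Phi_def one_pCons)
  let ?C = "{p. \<forall>k. coeff p k \<in> carrier (Sym n :: (nat \<times> nat, 'a) mpol ring)}"
  have entC: "Phi_tau n $$ (i - 1, j - 1) \<in> ?C" if "i \<in> {1..n}" "j \<in> {1..n}" for i j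
    using Phi_Sym[OF that] closed_Sym[of n] unfolding ent[OF that] ring_closed_def
    by (auto simp: coeff_pCons split: nat.splits)
  have "mnr (\<lambda>i j. Phi_tau n $$ (i - 1, j - 1)) rs cs \<in> ?C"
  proof (rule closed_mnr[OF closed_coeffs[OF closed_Sym] assms(1)])
    fix i j assume "i \<in> set rs" "j \<in> set cs"
    then show "Phi_tau n $$ (i - 1, j - 1) \<in> ?C" by (intro entC sub) auto
  qed
  then show "(coeff (minor (Phi_tau n) (set rs) (set cs)) k :: (nat \<times> nat, 'a) mpol) \<in> carrier (Sym n)" unfolding eq by blast
  interpret e: comm_ring_hom "ev N" by (rule comm_ring_hom_mpol_eval)
  interpret m: comm_ring_hom "map_poly (ev N)" by (rule e.map_poly_hom)
  have "map_poly (ev N) (mnr (\<lambda>i j. Phi_tau n $$ (i - 1, j - 1)) rs cs) =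
      mnr (\<lambda>i j. map_poly (ev N) (Phi_tau n $$ (i - 1, j - 1))) rs cs"
    by (rule m.hom_mnr)
  also have "\<dots> = mnr (charm (lown n N)) rs cs"
  proof (rule mnr_cong[OF assms(1)])
    fix i j assume "i \<in> set rs" "j \<in> set cs"
    then have ij: "i \<in> {1..n}" "j \<in> {1..n}" using sub by auto
    show "map_poly (ev N) (Phi_tau n $$ (i - 1, j - 1)) = charm (lown n N) i j"
      unfolding ent[OF ij] charm_def ev_Phi[OF ij, symmetric] by (auto intro!: poly_eqI simp: coeff_map_poly coeff_pCons split: nat.splits)
  qed
  finally show "ev N (coeff (minor (Phi_tau n) (set rs) (set cs)) k) = coeff (mnr (charm (lown n N)) rs cs) k"
    unfolding eq using coeff_map_poly[of "ev N", OF e.hom_zero] by (metis (no_types))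
qed

fun Pl :: "nat \<Rightarrow> lab \<Rightarrow> (nat \<times> nat, 'a::field) mpol" where
  "Pl n (LP j) = P n j" | "Pl n (LP1 j) = P' n j" | "Pl n (LP2 j) = P'' n j"
| "Pl n (LZ j) = Z n j" | "Pl n LM = P'_mid n"

lemma Pl_qf:
  fixes N :: "'a::field pt"
  assumes v: "valid n t"
  shows "(Pl n t :: (nat \<times> nat, 'a) mpol) \<in> carrier (Sym n)" "ev N (Pl n t) = qf [1..<Suc n] t (lown n N)"
proof -
  let ?L = "[1..<Suc n]"
  have "(Pl n t :: (nat \<times> nat, 'a) mpol) \<in> carrier (Sym n) \<and> ev N (Pl n t) = qf ?L t (lown n N)"
  proof (cases t)
    case (LP j)
    have j: "1 \<le> j" "j \<le> n" using v LP by auto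
    have e: "drop (length ?L - j) ?L = [n - j + 1..<Suc n]" "take j ?L = [1..<Suc j]"
      using j by (simp_all add: drop_upt take_upt del: upt_Suc)
    have s: "{n - j + 1..n} = set [n - j + 1..<Suc n]" "{1..j} = set [1..<Suc j]" by auto
    show ?thesis unfolding LP Pl.simps P_def qf.simps e s
      by (intro conjI minor_Phi) (use j in \<open>auto simp del: upt_Suc\<close>)
  next
    case (LP1 j)
    have j: "1 \<le> j" "j < n" using v LP1 by auto
    have e: "?L ! (length ?L - j - 1) # drop (length ?L - j + 1) ?L = (n - j) # [n - j + 2..<Suc n]" "take j ?L = [1..<Suc j]"
      using j by (simp_all add: drop_upt take_upt nth_upt del: upt_Suc)
    have s: "insert (n - j) {n - j + 2..n} = set ((n - j) # [n - j + 2..<Suc n])" "{1..j} = set [1..<Suc j]" by auto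
    show ?thesis unfolding LP1 Pl.simps P'_def qf.simps e s
      by (intro conjI minor_Phi) (use j in \<open>auto simp del: upt_Suc\<close>)
  next
    case (LP2 j)
    have j: "1 \<le> j" "j < n" using v LP2 by auto
    have e: "drop (length ?L - j) ?L = [n - j + 1..<Suc n]" "take (j - 1) ?L @ [?L ! j] = [1..<j] @ [j + 1]"
      using j by (simp_all add: drop_upt take_upt nth_upt del: upt_Suc)
    have s: "{n - j + 1..n} = set [n - j + 1..<Suc n]" "insert (j + 1) {1..j - 1} = set ([1..<j] @ [j + 1])" using j by auto
    show ?thesis unfolding LP2 Pl.simps P''_def qf.simps e s
      by (intro conjI minor_Phi) (use j in \<open>auto simp: sorted_wrt_append simp del: upt_Suc\<close>)
  next
    case (LZ k)
    have k: "1 \<le> k" "k \<le> n" using v LZ by auto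
    have e: "drop k ?L = [k + 1..<Suc n]" "take (length ?L - k) ?L = [1..<Suc (n - k)]"
      using k by (simp_all add: drop_upt take_upt del: upt_Suc)
    have s: "{n - (n - k) + 1..n} = set [k + 1..<Suc n]" "{1..n - k} = set [1..<Suc (n - k)]" using k by auto
    show ?thesis unfolding LZ Pl.simps Z_def P_tau_def qf.simps e s
      by (intro conjI coeff_minor_Phi_tau) (use k in \<open>auto simp del: upt_Suc\<close>)
  next
    case LM
    have n: "4 \<le> n" "even n" using v LM by auto
    let ?h = "n div 2"
    have h: "2 \<le> ?h" "n = 2 * ?h" using n by auto
    have e: "?L ! (length ?L div 2 - 1) # drop (length ?L div 2 + 2) ?L = ?h # [?h + 3..<Suc n]"
      "take (length ?L div 2 - 1) ?L = [1..<?h]"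
      using h by (auto simp: drop_upt take_upt nth_upt numeral_3_eq_3 simp del: upt_Suc)
    have s: "insert (n_zero n) {n_zero n + 3..n} = set (?h # [?h + 3..<Suc n])" "{1..n_zero n - 1} = set [1..<?h]"
      using h by (auto simp: n_zero_def)
    show ?thesis unfolding LM Pl.simps P'_mid_def qf.simps e s
      by (intro conjI minor_Phi) (use h in \<open>auto simp del: upt_Suc\<close>)
  qed
  then show "(Pl n t :: (nat \<times> nat, 'a) mpol) \<in> carrier (Sym n)" "ev N (Pl n t) = qf [1..<Suc n] t (lown n N)" by auto
qed

section \<open>Dimensions\<close>

lemma finite_lowp: "finite I \<Longrightarrow> finite (lowp I)"
  by (rule finite_subset[of _ "I \<times> I"]) (auto simp: lowp_def)

lemma pf_power: "f \<in> pf V \<Longrightarrow> (\<lambda>N. f N ^ k) \<in> pf V"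
  by (induction k) (auto intro: pf.const pf.mult)

lemma ev_pf: "mpol_vars p \<subseteq> V \<Longrightarrow> (\<lambda>N. ev N p) \<in> pf V"
  unfolding mpol_eval_def
  by (intro pf_sum pf.mult pf.const pf_prod pf_power) (auto simp: mpol_vars_def intro!: pf.coord)

lemma mpol_eval_cong:
  assumes "\<And>v. v \<in> mpol_vars p \<Longrightarrow> a v = b v" shows "mpol_eval a p = mpol_eval b p"
  unfolding mpol_eval_mev mev_def
proof (rule sum.cong[OF HOL.refl])
  fix m assume m: "m \<in> keys p"
  have "a v = b v" if "v \<in> keys m" for v using assms that m unfolding mpol_vars_def by blast
  then show "lookup p m * (\<Prod>v\<in>keys m. a v ^ lookup m v) = lookup p m * (\<Prod>v\<in>keys m. b v ^ lookup m v)" by simp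
qed

lemma eval_at_marr: "eval_at n f p = ev (marr n f) p"
  by (simp add: eval_at_def marr_def)

text \<open>Along the parametrisation h, k functions on the orbit become polynomials in
  \<open>card V\<close> coordinates, which are algebraically dependent once k exceeds m.\<close>

lemma variety_dim_le:
  fixes \<Omega> :: "('a::field mat \<Rightarrow> 'a) set"
  assumes f0: "f0 \<in> ut_dual n" and O: "\<Omega> = orbit (UT n) (coadj n) f0" and ub: "UB {1..n} (marr n f0) m"
  shows "variety_dim n \<Omega> \<le> enat m"
  unfolding variety_dim_def
proof (rule SUP_least)
  fix k assume "k \<in> {k. \<exists>p. alg_indep_on n \<Omega> k p}"
  then obtain p where p: "alg_indep_on n \<Omega> k p" by blast
  obtain V h where V: "V \<subseteq> lowp {1..n}" "card V \<le> m" and h: "\<And>i j. (i,j) \<in> lowp {1..n} \<Longrightarrow> h i j \<in> pf V"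
    and par: "\<And>N. orb {1..n} (marr n f0) N \<Longrightarrow> \<exists>\<theta>. \<forall>i j. (i,j) \<in> lowp {1..n} \<longrightarrow> N i j = h i j \<theta>"
    using ub unfolding UB_def by metis
  have "k \<le> m"
  proof (rule ccontr)
    assume "\<not> k \<le> m"
    then have km: "card V < k" using V by simp
    have finV: "finite V" using V(1) finite_lowp finite_subset by blast
    have pv: "mpol_vars (p i) \<subseteq> lowp {1..n}" if "i < k" for i
      using p that unfolding alg_indep_on_def carrier_Sym by blast
    let ?g = "\<lambda>i \<theta>. ev (\<lambda>a b. h a b \<theta>) (p i)"
    have gV: "?g i \<in> pf V" if "i < k" for i
      by (rule pf_comp[OF ev_pf[OF pv[OF that]]]) (rule h)
    have "\<exists>q :: (nat, 'a) mpol. q \<noteq> 0 \<and> mpol_vars q \<subseteq> {..<k} \<and> (\<forall>\<theta>. mpol_eval (\<lambda>i. ?g i \<theta>) q = 0)"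
      by (rule algebraically_dependent[OF finV km]) (rule gV)
    then obtain q :: "(nat, 'a) mpol" where q': "q \<noteq> 0 \<and> mpol_vars q \<subseteq> {..<k} \<and> (\<forall>\<theta>. mpol_eval (\<lambda>i. ?g i \<theta>) q = 0)"
      by (elim exE)
    then have q: "q \<noteq> 0" "mpol_vars q \<subseteq> {..<k}" "\<And>\<theta>. mpol_eval (\<lambda>i. ?g i \<theta>) q = 0" by simp_all
    have "mpol_eval (\<lambda>i. eval_at n f (p i)) q = 0" if f: "f \<in> \<Omega>" for f
    proof -
      obtain g where "g \<in> carrier (UT n)" "f = coadj n g f0" using f unfolding O orbit_def by blast
      then obtain \<theta> where th: "\<And>i j. (i,j) \<in> lowp {1..n} \<Longrightarrow> marr n f i j = h i j \<theta>"
        using par orb_coadj[OF _ f0] by blast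
      have "mpol_eval (\<lambda>i. eval_at n f (p i)) q = mpol_eval (\<lambda>i. ?g i \<theta>) q"
      proof (rule mpol_eval_cong)
        fix i assume "i \<in> mpol_vars q"
        then have "i < k" using q(2) by auto
        then show "eval_at n f (p i) = ?g i \<theta>"
          unfolding eval_at_marr by (intro mpol_eval_cong) (use pv th in fastforce)
      qed
      then show ?thesis using q(3) by simp
    qed
    then show False using p q unfolding alg_indep_on_def by blast
  qed
  then show "enat k \<le> enat m" by simp
qed

text \<open>The coordinates in V are independent: they take all values on the orbit, and in
  characteristic zero only the zero polynomial vanishes at every point.\<close>

lemma variety_dim_ge:
  fixes \<Omega> :: "('a::field_char_0 mat \<Rightarrow> 'a) set"
  assumes f0: "f0 \<in> ut_dual n" and O: "\<Omega> = orbit (UT n) (coadj n) f0" and V: "V \<subseteq> lowp {1..n}" "finite V"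
    and surj: "\<And>\<phi>. \<exists>N. orb {1..n} (marr n f0) N \<and> (\<forall>i j. (i,j) \<in> V \<longrightarrow> N i j = \<phi> i j)"
  shows "enat (card V) \<le> variety_dim n \<Omega>"
proof -
  obtain v where v: "bij_betw v {..<card V} V" using ex_bij_betw_nat_finite[OF V(2)] atLeast0LessThan by metis
  have vV: "v i \<in> V" if "i < card V" for i using v that by (auto simp: bij_betw_def)
  let ?p = "\<lambda>i. mpol_var (v i) :: (nat \<times> nat, 'a) mpol"
  have "alg_indep_on n \<Omega> (card V) ?p"
    unfolding alg_indep_on_def
  proof (intro conjI allI impI)
    fix i assume "i < card V"
    then show "?p i \<in> carrier (Sym n)" unfolding carrier_Sym
      using vV V(1) by auto
  next
    fix q :: "(nat, 'a) mpol"
    assume q: "mpol_vars q \<subseteq> {..<card V}" "\<forall>f\<in>\<Omega>. mpol_eval (\<lambda>i. eval_at n f (?p i)) q = 0"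
    show "q = 0"
    proof (rule mpol_eval_eq_0)
      fix a
      obtain N where N: "orb {1..n} (marr n f0) N" "\<And>i j. (i,j) \<in> V \<Longrightarrow> N i j = a (the_inv_into {..<card V} v (i,j))"
        using surj[of "\<lambda>i j. a (the_inv_into {..<card V} v (i,j))"] by blast
      obtain g where g: "g \<in> carrier (UT n)" "agree {1..n} (marr n (coadj n g f0)) N"
        using coadj_orb[OF N(1) f0] by blast
      have "coadj n g f0 \<in> \<Omega>" using g O unfolding orbit_def by blast
      then have "mpol_eval (\<lambda>i. eval_at n (coadj n g f0) (?p i)) q = 0" using q(2) by blast
      moreover have "eval_at n (coadj n g f0) (?p i) = a i" if "i \<in> mpol_vars q" for i
      proof -
        have i: "i < card V" using that q(1) by auto
        obtain c d where cd: "v i = (c,d)" by fastforce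
        have "(c,d) \<in> V" using vV[OF i] cd by simp
        then have "marr n (coadj n g f0) c d = N c d" using g(2) V(1) by (auto simp: agree_def lowp_def)
        also have "\<dots> = a (the_inv_into {..<card V} v (v i))" using N(2)[OF \<open>(c,d) \<in> V\<close>] cd by simp
        also have "the_inv_into {..<card V} v (v i) = i"
          using v i by (intro the_inv_into_f_f) (auto simp: bij_betw_def)
        finally show ?thesis by (simp add: eval_at_marr cd)
      qed
      ultimately show "mpol_eval a q = 0" by (metis (no_types, lifting) mpol_eval_cong)
    qed
  qed
  then show ?thesis unfolding variety_dim_def by (intro SUP_upper) blast
qed

section \<open>The vanishing ideal\<close>

lemma vanishing_ideal_ideal: "ideal (vanishing_ideal n \<Omega>) (Sym n)" for \<Omega> :: "('a::field mat \<Rightarrow> 'a) set"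
proof -
  interpret cring "Sym n :: (nat \<times> nat, 'a) mpol ring" by (rule cring_Sym)
  have ops: "a \<otimes>\<^bsub>Sym n\<^esub> b = a * b" "a \<oplus>\<^bsub>Sym n\<^esub> b = a + b" "\<zero>\<^bsub>Sym n\<^esub> = (0 :: (nat \<times> nat, 'a) mpol)"
    for a b :: "(nat \<times> nat, 'a) mpol" by (simp_all add: Sym_def)
  have neg: "\<ominus>\<^bsub>Sym n\<^esub> a = - a" if "a \<in> carrier (Sym n)" for a :: "(nat \<times> nat, 'a) mpol"
  proof (rule minus_equality)
    show "- a \<in> carrier (Sym n)" using that closed_Sym[of n] unfolding ring_closed_def by blast
  qed (use that in \<open>auto simp: ops\<close>)
  show ?thesis
  proof (rule idealI)
    show "subgroup (vanishing_ideal n \<Omega>) (add_monoid (Sym n))"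
    proof (rule add.subgroupI)
      have "0 \<in> vanishing_ideal n \<Omega>" using zero_closed unfolding ops by (auto simp: vanishing_ideal_def eval_at_def)
      then show "vanishing_ideal n \<Omega> \<noteq> {}" by blast
    qed (use neg ops a_closed closed_Sym[of n] in \<open>auto simp: vanishing_ideal_def eval_at_def mpol_eval_add mpol_eval_uminus ring_closed_def\<close>)
  qed (use ring_axioms m_closed in \<open>auto simp: ops vanishing_ideal_def eval_at_def mpol_eval_mult\<close>)
qed

lemma pf_Sym: "f \<in> pf (lowp {1..n}) \<Longrightarrow> \<exists>q\<in>carrier (Sym n). \<forall>N. ev N q = f N"
proof (induction rule: pf.induct)
  case (const c)
  show ?case by (rule bexI[of _ "mpol_const c"]) (auto simp: carrier_Sym)
next
  case (coord i j)
  then show ?case by (intro bexI[of _ "mpol_var (i,j)"]) (auto simp: carrier_Sym)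
next
  case (add f g)
  then obtain p q where "p \<in> carrier (Sym n)" "q \<in> carrier (Sym n)" "\<forall>N. ev N p = f N" "\<forall>N. ev N q = g N" by blast
  then show ?case using closed_Sym[of n] by (intro bexI[of _ "p + q"]) (auto simp: mpol_eval_add ring_closed_def)
next
  case (mult f g)
  then obtain p q where "p \<in> carrier (Sym n)" "q \<in> carrier (Sym n)" "\<forall>N. ev N p = f N" "\<forall>N. ev N q = g N" by blast
  then show ?case using closed_Sym[of n] by (intro bexI[of _ "p * q"]) (auto simp: mpol_eval_mult ring_closed_def)
qed

text \<open>\<open>good_ideal\<close> expresses p by the generators as functions of arbitrary
  arrays. Composing with \<open>lown\<close> leaves coefficients in the strictly lower entries and
  turns each generator into the values of its formal counterpart. This combination lifts to an
  element q of the generated ideal with the same values as p, so q = p in characteristic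
  zero.\<close>

lemma vanishing_ideal_eq:
  fixes \<Omega> :: "('a::field_char_0 mat \<Rightarrow> 'a) set"
  assumes f0: "f0 \<in> ut_dual n" and O: "\<Omega> = orbit (UT n) (coadj n) f0"
    and g: "good {1..n} (marr n f0) (gens [1..<Suc n] T d) V" and v: "\<And>t. t \<in> T \<Longrightarrow> valid n t"
  shows "vanishing_ideal n \<Omega> = Idl\<^bsub>Sym n\<^esub> ((\<lambda>t. Pl n t - mpol_const (d t)) ` T)"
proof -
  interpret cring "Sym n :: (nat \<times> nat, 'a) mpol ring" by (rule cring_Sym)
  let ?G = "(\<lambda>t. Pl n t - mpol_const (d t)) ` T"
  have ops: "a \<otimes>\<^bsub>Sym n\<^esub> b = a * b" "a \<oplus>\<^bsub>Sym n\<^esub> b = a + b" "\<zero>\<^bsub>Sym n\<^esub> = (0 :: (nat \<times> nat, 'a) mpol)"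
    for a b :: "(nat \<times> nat, 'a) mpol" by (simp_all add: Sym_def)
  have const: "mpol_const c \<in> carrier (Sym n)" for c :: 'a by (auto simp: carrier_Sym)
  have "a - b \<in> carrier (Sym n)" if "a \<in> carrier (Sym n)" "b \<in> carrier (Sym n)" for a b :: "(nat \<times> nat, 'a) mpol"
    using that closed_Sym[of n] unfolding ring_closed_def by (metis add_uminus_conv_diff)
  then have G: "?G \<subseteq> carrier (Sym n)" using Pl_qf(1) v const by blast
  have evG: "ev N (Pl n t - mpol_const (d t)) = qf [1..<Suc n] t (lown n N) - d t" if "t \<in> T" for t N
    using Pl_qf(2)[OF v[OF that], of N] by (simp add: mpol_eval_diff)
  have lo: "agree {1..n} (lown n N) N" for N :: "'a pt" by (auto simp: agree_def lown_def lowp_def)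
  show ?thesis
  proof
    show "Idl\<^bsub>Sym n\<^esub> ?G \<subseteq> vanishing_ideal n \<Omega>"
    proof (rule genideal_minimal[OF vanishing_ideal_ideal], rule subsetI)
      fix p assume p: "p \<in> ?G"
      then obtain t where t: "t \<in> T" "p = Pl n t - mpol_const (d t)" by blast
      have "eval_at n f p = 0" if f: "f \<in> \<Omega>" for f
      proof -
        obtain h where "h \<in> carrier (UT n)" "f = coadj n h f0" using f unfolding O orbit_def by blast
        then have "orb {1..n} (marr n f0) (lown n (marr n f))" using orb_coadj[OF _ f0] orb_cong lo by blast
        then show ?thesis using good_gens[OF g t(1)] evG[OF t(1)] unfolding eval_at_marr t(2) by simp
      qed
      then show "p \<in> vanishing_ideal n \<Omega>" using p G unfolding vanishing_ideal_def by blast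
    qed
    show "vanishing_ideal n \<Omega> \<subseteq> Idl\<^bsub>Sym n\<^esub> ?G"
    proof
      fix p assume p: "p \<in> vanishing_ideal n \<Omega>"
      then have pv: "mpol_vars p \<subseteq> lowp {1..n}" unfolding vanishing_ideal_def carrier_Sym by blast
      have "ev N p = 0" if N: "orb {1..n} (marr n f0) N" for N
      proof -
        obtain h where h: "h \<in> carrier (UT n)" "agree {1..n} (marr n (coadj n h f0)) N"
          using coadj_orb[OF N f0] by blast
        then have "eval_at n (coadj n h f0) p = 0" using p O unfolding vanishing_ideal_def orbit_def by blast
        moreover have "ev (marr n (coadj n h f0)) p = ev N p"
          by (rule mpol_eval_cong) (use pv h(2) in \<open>auto simp: agree_def lowp_def\<close>)
        ultimately show ?thesis by (simp add: eval_at_marr)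
      qed
      then have "(\<lambda>N. ev N p) \<in> idl UNIV (gens [1..<Suc n] T d)"
        by (rule good_ideal[OF g ev_pf[OF pv]])
      then have "(\<lambda>N. ev (lown n N) p) \<in> idl (lowp {1..n}) ((\<lambda>g N. g (lown n N)) ` gens [1..<Suc n] T d)"
        by (rule idl_comp) (auto simp: lown_def intro!: pf_if pf.coord pf.const)
      moreover have "\<exists>q\<in>Idl\<^bsub>Sym n\<^esub> ?G. \<forall>N. ev N q = F N"
        if "F \<in> idl (lowp {1..n}) ((\<lambda>g N. g (lown n N)) ` gens [1..<Suc n] T d)" for F
        using that
      proof induction
        case zero
        have "0 \<in> Idl\<^bsub>Sym n\<^esub> ?G" using additive_subgroup.zero_closed[OF ideal.axioms(1)[OF genideal_ideal[OF G]]] unfolding ops .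
        then show ?case by (intro bexI[of _ 0]) auto
      next
        case (step F r g')
        obtain t where t: "t \<in> T" "g' = (\<lambda>N. qf [1..<Suc n] t (lown n N) - d t)"
          using step(3) unfolding gens_def by blast
        obtain q where q: "q \<in> Idl\<^bsub>Sym n\<^esub> ?G" "\<And>N. ev N q = F N" using step by blast
        obtain s where s: "s \<in> carrier (Sym n)" "\<And>N. ev N s = r N" using pf_Sym[OF step(2)] by blast
        let ?u = "Pl n t - mpol_const (d t)"
        have "?u \<in> Idl\<^bsub>Sym n\<^esub> ?G" using genideal_self[OF G] t(1) by blast
        then have "s \<otimes>\<^bsub>Sym n\<^esub> ?u \<in> Idl\<^bsub>Sym n\<^esub> ?G" using ideal.I_l_closed[OF genideal_ideal[OF G]] s(1) by blast
        then have "q \<oplus>\<^bsub>Sym n\<^esub> (s \<otimes>\<^bsub>Sym n\<^esub> ?u) \<in> Idl\<^bsub>Sym n\<^esub> ?G"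
          using additive_subgroup.a_closed[OF ideal.axioms(1)[OF genideal_ideal[OF G]] q(1)] by blast
        then show ?case unfolding ops t(2)
          by (intro bexI[of _ "q + s * ?u"]) (simp_all add: mpol_eval_add mpol_eval_mult q(2) s(2) evG[OF t(1)])
      qed
      ultimately obtain q where q: "q \<in> Idl\<^bsub>Sym n\<^esub> ?G" "\<And>N. ev N q = ev (lown n N) p" by blast
      have "ev (lown n N) p = ev N p" for N :: "'a pt"
        by (rule mpol_eval_cong) (use pv in \<open>auto simp: lown_def\<close>)
      then have e: "ev N (q - p) = 0" for N :: "'a pt" using q(2) by (simp add: mpol_eval_diff)
      have "q - p = 0"
      proof (rule mpol_eval_eq_0)
        fix a show "mpol_eval a (q - p) = 0" using e[of "\<lambda>i j. a (i,j)"] by simp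
      qed
      then show "p \<in> Idl\<^bsub>Sym n\<^esub> ?G" using q(1) by simp
    qed
  qed
qed

section \<open>Regular and subregular orbits\<close>

lemma generic_cong:
  assumes "sorted_wrt (<) L" "agree (set L) M N" "generic L M"
  shows "generic L N"
  using assms
proof (induction "length L" arbitrary: L M N rule: less_induct)
  case less
  show ?case
  proof (cases "length L \<le> 2")
    case False
    then obtain x K where LK: "L = x # K" by (cases L) auto
    then have "K \<noteq> []" using False by auto
    then obtain mid y where L: "L = x # mid @ [y]" using LK by (metis append_butlast_last_id)
    have s: "sorted_wrt (<) mid" and lt: "x < y" "\<And>d. d \<in> set mid \<Longrightarrow> x < d \<and> d < y"
      using less(2) L by (auto simp: sorted_wrt_append)
    have e: "N y x = M y x" using less(3) lt unfolding L agree_def by auto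
    have "agree (set mid) (schur x y (M y x) M) (schur x y (M y x) N)"
      using less(3) lt unfolding L agree_def schur_def by auto
    then have "generic mid (schur x y (M y x) N)" if "generic mid (schur x y (M y x) M)"
      using less(1)[OF _ s _ that] L by simp
    then show ?thesis using less(4) e unfolding L generic_Cons_snoc by auto
  qed (simp add: generic_short)
qed

lemma ex_generic:
  assumes "sorted_wrt (<) L"
  shows "\<exists>M :: 'a::field pt. generic L M"
  using assms
proof (induction "length L" arbitrary: L rule: less_induct)
  case less
  show ?case
  proof (cases "length L \<le> 2")
    case False
    then obtain x K where LK: "L = x # K" by (cases L) auto
    then have "K \<noteq> []" using False by auto
    then obtain mid y where L: "L = x # mid @ [y]" using LK by (metis append_butlast_last_id)
    have s: "sorted_wrt (<) mid" and ne: "x \<noteq> y" "\<And>d. d \<in> set mid \<Longrightarrow> d \<noteq> x \<and> d \<noteq> y"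
      using less(2) L by (auto simp: sorted_wrt_append)
    obtain M :: "'a pt" where M: "generic mid M" using less(1)[OF _ s] L by auto
    \<comment> \<open>Row y and column x are zero apart from the corner, so the Schur complement on
      \<open>mid\<close> is M itself.\<close>
    define N :: "'a pt" where "N i j = (if i = y then (if j = x then 1 else 0) else if j = x then 0 else M i j)" for i j
    have "agree (set mid) M (schur x y (N y x) N)"
      unfolding agree_def schur_def N_def using ne by auto
    then have "generic mid (schur x y (N y x) N)" using generic_cong[OF s _ M] by blast
    then show ?thesis unfolding L generic_Cons_snoc by (intro exI[of _ N]) (auto simp: N_def)
  qed (use generic_short[of L] in blast)
qed

lemma coadjoint_orbitE:
  assumes "\<Omega> \<in> coadjoint_orbits n"
  obtains f where "f \<in> ut_dual n" "\<Omega> = orbit (UT n) (coadj n) f"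
  using assms unfolding coadjoint_orbits_def orbits_def by blast

lemma set_upt_Suc: "set [1..<Suc n] = {1..n}" "sorted_wrt (<) [1..<Suc n]" "length [1..<Suc n] = n"
  by (auto simp del: upt_Suc)

lemma variety_dim_generic:
  fixes f0 :: "'a::field_char_0 mat \<Rightarrow> 'a"
  assumes f0: "f0 \<in> ut_dual n" and gen: "generic [1..<Suc n] (marr n f0)"
  shows "enat (reg n) \<le> variety_dim n (orbit (UT n) (coadj n) f0)"
proof -
  obtain V d where g: "good {1..n} (marr n f0) (gens [1..<Suc n] (LP ` {1..n div 2}) d) V"
    and V: "card V = reg n" "finite V"
    using generic_good[OF set_upt_Suc(2) gen] unfolding set_upt_Suc by blast
  have "V \<subseteq> lowp {1..n}" using g unfolding good_def elim_def by blast
  then show ?thesis unfolding V(1)[symmetric]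
    by (rule variety_dim_ge[OF f0 HOL.refl _ V(2)]) (use g in \<open>simp add: good_def\<close>)
qed

lemma variety_dim_regular:
  fixes \<Omega> :: "('a::field_char_0 mat \<Rightarrow> 'a) set"
  assumes "regular_orbit n \<Omega>"
  shows "variety_dim n \<Omega> = enat (reg n)"
proof (rule antisym)
  obtain f where f: "f \<in> ut_dual n" "\<Omega> = orbit (UT n) (coadj n) f"
    using assms unfolding regular_orbit_def by (blast elim: coadjoint_orbitE)
  obtain m where "UB {1..n} (marr n f) m" "m \<le> reg n"
    using UB_reg[OF set_upt_Suc(2), of n "marr n f"] unfolding set_upt_Suc by blast
  then show "variety_dim n \<Omega> \<le> enat (reg n)"
    using variety_dim_le[OF f] order_trans enat_ord_simps(1) by blast
next
  obtain M :: "'a pt" where M: "generic [1..<Suc n] M" using ex_generic[OF set_upt_Suc(2)] by blast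
  obtain f :: "'a mat \<Rightarrow> 'a" where f: "f \<in> ut_dual n" "agree {1..n} (marr n f) M" using marr_surj by blast
  have "generic [1..<Suc n] (marr n f)"
    by (rule generic_cong[OF set_upt_Suc(2) _ M]) (use agree_sym[OF f(2)] set_upt_Suc in simp)
  then have "enat (reg n) \<le> variety_dim n (orbit (UT n) (coadj n) f)" by (rule variety_dim_generic[OF f(1)])
  also have "\<dots> \<le> variety_dim n \<Omega>"
    using assms f(1) unfolding regular_orbit_def coadjoint_orbits_def orbits_def by blast
  finally show "enat (reg n) \<le> variety_dim n \<Omega>" .
qed

text \<open>The dimension reg n - 2 excludes the other alternatives of the classification, which
  force at least reg n and at most reg n - 3 respectively.\<close>

lemma subregular_types:
  fixes f0 :: "'a::field_char_0 mat \<Rightarrow> 'a"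
  assumes n: "3 \<le> n" and f0: "f0 \<in> ut_dual n" and d: "variety_dim n (orbit (UT n) (coadj n) f0) + 2 = enat (reg n)"
  shows "type1 [1..<Suc n] (marr n f0) \<or> type2 [1..<Suc n] (marr n f0) \<or>
    type3a [1..<Suc n] (marr n f0) \<or> type3b [1..<Suc n] (marr n f0)"
proof -
  obtain v where v: "variety_dim n (orbit (UT n) (coadj n) f0) = enat v"
    using d by (cases "variety_dim n (orbit (UT n) (coadj n) f0)") auto
  have v2: "v + 2 = reg n" using d unfolding v by (simp add: numeral_eq_enat)
  have "\<not> generic [1..<Suc n] (marr n f0)"
    using variety_dim_generic[OF f0] v v2 by auto
  moreover have False if "UB {1..n} (marr n f0) m" "m + 3 \<le> reg n" for m
    using variety_dim_le[OF f0 HOL.refl that(1)] that(2) v v2 by simp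
  ultimately show ?thesis
    using orbit_trichotomy[OF set_upt_Suc(2), of n "marr n f0"] n unfolding set_upt_Suc by blast
qed

lemma eval_Pl:
  assumes "f0 \<in> ut_dual n" "good {1..n} (marr n f0) (gens [1..<Suc n] T d) V" "t \<in> T" "valid n t"
    and f: "f \<in> orbit (UT n) (coadj n) f0"
  shows "eval_at n f (Pl n t) = d t"
proof -
  obtain g where g: "g \<in> carrier (UT n)" "f = coadj n g f0" using f unfolding orbit_def by blast
  have "orb {1..n} (marr n f0) (marr n f)" unfolding g(2) by (rule orb_coadj[OF g(1) assms(1)])
  then have "orb {1..n} (marr n f0) (lown n (marr n f))"
    by (rule orb_cong) (auto simp: agree_def lown_def lowp_def)
  then show ?thesis unfolding eval_at_marr Pl_qf(2)[OF assms(4)] by (rule good_gens[OF assms(2,3)])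
qed

text \<open>The bound 2 j <= n keeps the minor strictly below the diagonal, where
  \<open>lown\<close> changes nothing.\<close>

lemma eval_P:
  assumes "1 \<le> j" "2 * j \<le> n"
  shows "eval_at n f (P n j) = qf [1..<Suc n] (LP j) (marr n f)"
proof -
  have "eval_at n f (P n j) = qf [1..<Suc n] (LP j) (lown n (marr n f))"
    using Pl_qf(2)[of n "LP j" "marr n f"] assms unfolding eval_at_marr by simp
  also have "\<dots> = qf [1..<Suc n] (LP j) (marr n f)"
    unfolding qf.simps by (rule mnr_cong)
      (use assms in \<open>auto simp: lown_def lowp_def drop_upt take_upt simp del: upt_Suc\<close>)
  finally show ?thesis .
qed

lemma orbit_self:
  assumes "f0 \<in> ut_dual n" shows "f0 \<in> orbit (UT n) (coadj n) f0"
proof -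
  interpret group "UT n" by (rule group_UT)
  have "1\<^sub>m n \<in> carrier (UT n)" using one_closed by (simp add: UT_simps)
  then show ?thesis unfolding orbit_def using coadj_one[OF assms] by force
qed

lemma mpol_const_0 [simp]: "mpol_const 0 = 0" by (simp add: mpol_const_def)

theorem theorem3p3:
  fixes n :: nat and \<Omega> :: "('a::field_char_0 mat \<Rightarrow> 'a) set"
  assumes "n \<ge> 3" and "subregular_orbit n \<Omega>"
  shows
    "(\<not> (\<forall>f\<in>\<Omega>. eval_at n f (P n (n_otimes n)) = 0) \<longrightarrow>
       (\<exists>j0 (c :: nat \<Rightarrow> 'a) c' c'' cZ.
          1 \<le> j0 \<and> j0 < n_otimes n \<and>
          (\<forall>i \<in> {1..j0 - 1} \<union> {j0 + 2..n_zero n - 1}. c i \<noteq> 0) \<and>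
          (odd n \<longrightarrow> c (n_zero n) \<noteq> 0) \<and> c' \<noteq> 0 \<and> c'' \<noteq> 0 \<and>
          vanishing_ideal n \<Omega> =
            Idl\<^bsub>Sym n\<^esub>
              ((\<lambda>i. P n i - mpol_const (c i)) ` ({1..j0 - 1} \<union> {j0 + 2..n_zero n}) \<union>
               {P' n j0 - mpol_const c', P'' n j0 - mpol_const c'', P n j0,
                Z n j0 - mpol_const cZ})))
     \<and>
     ((\<forall>f\<in>\<Omega>. eval_at n f (P n (n_otimes n)) = 0) \<and> odd n \<longrightarrow>
       (\<exists>(c :: nat \<Rightarrow> 'a) c' c''.
          (\<forall>i \<in> {1..n_otimes n - 1}. c i \<noteq> 0) \<and>
          vanishing_ideal n \<Omega> =
            Idl\<^bsub>Sym n\<^esub>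
              ((\<lambda>i. P n i - mpol_const (c i)) ` {1..n_otimes n - 1} \<union>
               {P' n (n_otimes n) - mpol_const c', P'' n (n_otimes n) - mpol_const c'',
                P n (n_otimes n)})))
     \<and>
     ((\<forall>f\<in>\<Omega>. eval_at n f (P n (n_otimes n)) = 0) \<and> even n \<longrightarrow>
       (\<exists>(c :: nat \<Rightarrow> 'a) c' c'' cZ.
          (\<forall>i \<in> {1..n_otimes n - 1}. c i \<noteq> 0) \<and> c' \<noteq> 0 \<and>
          (vanishing_ideal n \<Omega> =
             Idl\<^bsub>Sym n\<^esub>
               ((\<lambda>i. P n i - mpol_const (c i)) ` {1..n_otimes n - 1} \<union>
                {P' n (n_otimes n) - mpol_const c', P'' n (n_otimes n) - mpol_const c'',
                 P n (n_otimes n), Z n (n_otimes n) - mpol_const cZ}) \<or>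
           vanishing_ideal n \<Omega> =
             Idl\<^bsub>Sym n\<^esub>
               ((\<lambda>i. P n i - mpol_const (c i)) ` {1..n_otimes n - 1} \<union>
                {P n (n_otimes n), P' n (n_otimes n), P'_mid n - mpol_const c'',
                 P'' n (n_otimes n) - mpol_const c'}))))"
    (is "(\<not> ?van \<longrightarrow> ?C1) \<and> (?van \<and> odd n \<longrightarrow> ?C2) \<and> (?van \<and> even n \<longrightarrow> ?C3)")
proof -
  obtain f0 :: "'a mat \<Rightarrow> 'a" where f0: "f0 \<in> ut_dual n" and O: "\<Omega> = orbit (UT n) (coadj n) f0"
    using assms(2) unfolding subregular_orbit_def by (blast elim: coadjoint_orbitE)
  let ?L = "[1..<Suc n]" and ?M = "marr n f0" and ?k = "n_otimes n"
  have k: "1 \<le> ?k" "2 * ?k \<le> n" "?k \<le> n_zero n" "n_zero n \<le> n" "even n \<Longrightarrow> n_zero n = Suc ?k" "odd n \<Longrightarrow> n_zero n = ?k"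
    using assms(1) by (auto simp: n_otimes_def n_zero_def elim!: evenE oddE)
  note ideal = vanishing_ideal_eq[OF f0 O]
  \<comment> \<open>Each family determines whether P with index n_otimes vanishes on the orbit and,
    if it does, the parity of n. The hypothesis of a case therefore leaves only the families that
    belong to it.\<close>
  have logic: "(A \<longrightarrow> \<not> B \<and> C1) \<Longrightarrow> (A' \<longrightarrow> B \<and> odd n \<and> C2) \<Longrightarrow> (A'' \<longrightarrow> B \<and> even n \<and> C3) \<Longrightarrow> A \<or> A' \<or> A'' \<Longrightarrow>
      (\<not> B \<longrightarrow> C1) \<and> (B \<and> odd n \<longrightarrow> C2) \<and> (B \<and> even n \<longrightarrow> C3)" for A A' A'' B C1 C2 C3 by blast
  have types: "type1 ?L ?M \<or> type2 ?L ?M \<or> type3a ?L ?M \<or> type3b ?L ?M"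
  proof (rule subregular_types[OF assms(1) f0])
    obtain \<Omega>r :: "('a mat \<Rightarrow> 'a) set" where "regular_orbit n \<Omega>r" "variety_dim n \<Omega> + 2 = variety_dim n \<Omega>r"
      using assms(2) unfolding subregular_orbit_def by blast
    then show "variety_dim n (orbit (UT n) (coadj n) f0) + 2 = enat (reg n)"
      using variety_dim_regular O by metis
  qed
  have 1: "\<not> ?van \<and> ?C1" if type: "type1 ?L ?M"
  proof -
    obtain j d V where j: "1 \<le> j" "j < ?k"
      and g: "good {1..n} ?M (gens ?L (LP ` ({1..j - 1} \<union> {j + 2..n_zero n}) \<union> {LP1 j, LP2 j, LP j, LZ j}) d) V"
      and d: "\<And>i. i \<in> {1..j - 1} \<union> {j + 2..?k} \<Longrightarrow> d (LP i) \<noteq> 0" "d (LP1 j) \<noteq> 0" "d (LP2 j) \<noteq> 0" "d (LP j) = 0"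
      and q: "qf ?L (LP ?k) ?M \<noteq> 0"
      using type unfolding type1_def set_upt_Suc n_otimes_def[of n, symmetric] n_zero_def[of n, symmetric] by blast
    have "eval_at n f0 (P n ?k) \<noteq> 0" unfolding eval_P[OF k(1,2)] by (rule q)
    then have nv: "\<not> ?van" using orbit_self[OF f0] unfolding O by blast
    \<comment> \<open>For odd n the index n_zero may be j + 1, which has no generator P_i - c_i; the
      claim still asks for a nonzero constant there, and 1 is supplied.\<close>
    let ?c = "\<lambda>i. if i = Suc j then 1 else d (LP i)"
    have I: "vanishing_ideal n \<Omega> = Idl\<^bsub>Sym n\<^esub> ((\<lambda>t. Pl n t - mpol_const (d t)) ` (LP ` ({1..j - 1} \<union> {j + 2..n_zero n}) \<union> {LP1 j, LP2 j, LP j, LZ j}))"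
      by (rule ideal[OF g]) (use j k in auto)
    have "(\<lambda>i. P n i - mpol_const (d (LP i))) ` ({1..j - 1} \<union> {j + 2..n_zero n}) =
        (\<lambda>i. P n i - mpol_const (?c i)) ` ({1..j - 1} \<union> {j + 2..n_zero n})"
      by (rule image_cong) auto
    then have "vanishing_ideal n \<Omega> = Idl\<^bsub>Sym n\<^esub> ((\<lambda>i. P n i - mpol_const (?c i)) ` ({1..j - 1} \<union> {j + 2..n_zero n}) \<union>
       {P' n j - mpol_const (d (LP1 j)), P'' n j - mpol_const (d (LP2 j)), P n j, Z n j - mpol_const (d (LZ j))})"
      unfolding I image_Un image_image Pl.simps by (simp only: image_insert image_empty Pl.simps d(4) mpol_const_0 diff_zero)
    moreover have "\<forall>i \<in> {1..j - 1} \<union> {j + 2..n_zero n - 1}. ?c i \<noteq> 0"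
    proof
      fix i assume "i \<in> {1..j - 1} \<union> {j + 2..n_zero n - 1}"
      moreover have "n_zero n - 1 \<le> ?k" using k(5,6) by (cases "even n") auto
      ultimately have "i \<in> {1..j - 1} \<union> {j + 2..?k}" by auto
      then show "?c i \<noteq> 0" using d(1) by simp
    qed
    moreover have "odd n \<longrightarrow> ?c (n_zero n) \<noteq> 0" using d(1)[of ?k] k(6) j by auto
    ultimately show ?thesis using nv j d(2,3) by (intro conjI exI[of _ j] exI[of _ ?c] exI[of _ "d (LP1 j)"] exI[of _ "d (LP2 j)"] exI[of _ "d (LZ j)"])
  qed
  have last: "?van \<and> vanishing_ideal n \<Omega> = Idl\<^bsub>Sym n\<^esub>
      ((\<lambda>i. P n i - mpol_const (d (LP i))) ` {1..?k - 1} \<union> (\<lambda>t. Pl n t - mpol_const (d t)) ` T)"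
    "\<And>i. i \<in> {1..?k - 1} \<Longrightarrow> d (LP i) \<noteq> 0" "d (LP ?k) = 0"
    if type: "last_type ?L ?M T d" and T: "LP ?k \<in> T" "\<And>t. t \<in> T \<Longrightarrow> valid n t" for T d
  proof -
    obtain V where g: "good {1..n} ?M (gens ?L (LP ` {1..?k - 1} \<union> T) d) V"
      and d: "\<And>i. i \<in> {1..?k - 1} \<Longrightarrow> d (LP i) \<noteq> 0" "d (LP ?k) = 0"
      using type unfolding last_type_def set_upt_Suc n_otimes_def[of n, symmetric] by blast
    have v: "valid n t" if "t \<in> LP ` {1..?k - 1} \<union> T" for t using that T(2) k by auto
    have "?van"
    proof
      fix f assume "f \<in> \<Omega>"
      then show "eval_at n f (P n ?k) = 0"
        using eval_Pl[OF f0 g, of "LP ?k" f] T v[of "LP ?k"] d(2) O by simp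
    qed
    then show "?van \<and> vanishing_ideal n \<Omega> = Idl\<^bsub>Sym n\<^esub>
      ((\<lambda>i. P n i - mpol_const (d (LP i))) ` {1..?k - 1} \<union> (\<lambda>t. Pl n t - mpol_const (d t)) ` T)"
      using ideal[OF g v] unfolding image_Un image_image Pl.simps by blast
    show "\<And>i. i \<in> {1..?k - 1} \<Longrightarrow> d (LP i) \<noteq> 0" "d (LP ?k) = 0" by (fact d)+
  qed
  have 2: "?van \<and> odd n \<and> ?C2" if type: "type2 ?L ?M"
  proof -
    obtain d where o: "odd n" and l: "last_type ?L ?M {LP1 ?k, LP2 ?k, LP ?k} d"
      using type unfolding type2_def set_upt_Suc n_otimes_def[of n, symmetric] Let_def by blast
    have v: "valid n t" if "t \<in> {LP1 ?k, LP2 ?k, LP ?k}" for t using that k assms(1) by auto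
    note l' = last[OF l _ v]
    have nz: "\<forall>i\<in>{1..?k - 1}. d (LP i) \<noteq> 0" using l'(2) by simp
    have eq: "vanishing_ideal n \<Omega> = Idl\<^bsub>Sym n\<^esub> ((\<lambda>i. P n i - mpol_const (d (LP i))) ` {1..?k - 1} \<union>
        {P' n ?k - mpol_const (d (LP1 ?k)), P'' n ?k - mpol_const (d (LP2 ?k)), P n ?k})"
      using l'(1,3) by (simp only: image_insert image_empty Pl.simps mpol_const_0 diff_zero insertI1 insertI2 simp_thms)
    have ?C2
      by (rule exI[of _ "\<lambda>i. d (LP i)"], rule exI[of _ "d (LP1 ?k)"], rule exI[of _ "d (LP2 ?k)"], rule conjI[OF nz eq])
    moreover have "?van" using l'(1) by simp
    ultimately show ?thesis using o by (intro conjI)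
  qed
  have 3: "?van \<and> even n \<and> ?C3" if type: "type3a ?L ?M"
  proof -
    obtain d where e: "even n" and l: "last_type ?L ?M {LP1 ?k, LP2 ?k, LP ?k, LZ ?k} d" and c: "d (LP1 ?k) \<noteq> 0"
      using type unfolding type3a_def set_upt_Suc n_otimes_def[of n, symmetric] Let_def by blast
    have v: "valid n t" if "t \<in> {LP1 ?k, LP2 ?k, LP ?k, LZ ?k}" for t using that k assms(1) by auto
    note l' = last[OF l _ v]
    have nz: "\<forall>i\<in>{1..?k - 1}. d (LP i) \<noteq> 0" using l'(2) by simp
    have eq: "vanishing_ideal n \<Omega> = Idl\<^bsub>Sym n\<^esub> ((\<lambda>i. P n i - mpol_const (d (LP i))) ` {1..?k - 1} \<union>
        {P' n ?k - mpol_const (d (LP1 ?k)), P'' n ?k - mpol_const (d (LP2 ?k)), P n ?k, Z n ?k - mpol_const (d (LZ ?k))})"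
      using l'(1,3) by (simp only: image_insert image_empty Pl.simps mpol_const_0 diff_zero insertI1 insertI2 simp_thms)
    have ?C3
      by (rule exI[of _ "\<lambda>i. d (LP i)"], rule exI[of _ "d (LP1 ?k)"], rule exI[of _ "d (LP2 ?k)"], rule exI[of _ "d (LZ ?k)"])
        (rule conjI[OF nz conjI[OF c disjI1[OF eq]]])
    moreover have "?van" using l'(1) by simp
    ultimately show ?thesis using e by (intro conjI)
  qed
  have 4: "?van \<and> even n \<and> ?C3" if type: "type3b ?L ?M"
  proof -
    obtain d where e: "even n" and l: "last_type ?L ?M {LP ?k, LP1 ?k, LM, LP2 ?k} d" and c: "d (LP1 ?k) = 0" "d (LP2 ?k) \<noteq> 0"
      using type unfolding type3b_def set_upt_Suc n_otimes_def[of n, symmetric] Let_def by blast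
    have "n \<noteq> 3" using e by auto
    then have v: "valid n t" if "t \<in> {LP ?k, LP1 ?k, LM, LP2 ?k}" for t using that k e assms(1) by auto
    note l' = last[OF l _ v]
    have nz: "\<forall>i\<in>{1..?k - 1}. d (LP i) \<noteq> 0" using l'(2) by simp
    have eq: "vanishing_ideal n \<Omega> = Idl\<^bsub>Sym n\<^esub> ((\<lambda>i. P n i - mpol_const (d (LP i))) ` {1..?k - 1} \<union>
        {P n ?k, P' n ?k, P'_mid n - mpol_const (d LM), P'' n ?k - mpol_const (d (LP2 ?k))})"
      using l'(1,3) c(1) by (simp only: image_insert image_empty Pl.simps mpol_const_0 diff_zero insertI1 insertI2 simp_thms)
    \<comment> \<open>Form b) involves no Z, so its constant is given the value 0; the nonzero c' is
      here the value of P''.\<close>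
    have ?C3
      by (rule exI[of _ "\<lambda>i. d (LP i)"], rule exI[of _ "d (LP2 ?k)"], rule exI[of _ "d LM"], rule exI[of _ "0"])
        (rule conjI[OF nz conjI[OF c(2) disjI2[OF eq]]])
    moreover have "?van" using l'(1) by simp
    ultimately show ?thesis using e by (intro conjI)
  qed
  show ?thesis
  proof (rule logic)
    show "type1 ?L ?M \<longrightarrow> \<not> ?van \<and> ?C1" by (rule impI) (rule 1)
    show "type2 ?L ?M \<longrightarrow> ?van \<and> odd n \<and> ?C2" by (rule impI) (rule 2)
    show "type3a ?L ?M \<or> type3b ?L ?M \<longrightarrow> ?van \<and> even n \<and> ?C3" by (rule impI, erule disjE) (rule 3, assumption, rule 4)
    show "type1 ?L ?M \<or> type2 ?L ?M \<or> type3a ?L ?M \<or> type3b ?L ?M" by (rule types)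
  qed
qed

end
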